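(* Assume that the bilinear Bochner–Riesz square function $\mathcal G^\alpha$ is bounded from $L^{p_1}(\mathbb R^n)\times L^{p_2}(\mathbb R^n)$ to $L^p(\mathbb R^n)$. Then the following necessary conditions hold: (1) $\alpha>\max\left\{n\left(\frac1p-1\right)-\frac12,\,-\frac12\right\}$, for all $n\ge1$ and $p_1,p_2\ge1$; (2) $\alpha>\max\left\{\frac n2-\frac n{p_1}-\frac n{2p_2}-1,\ \frac n2-\frac n{2p_1}-\frac n{p_2}-1,\ -\frac12\right\}$, when $n\ge2$ and $1\le p_1,p_2,p\le\infty$.
   Context: Fourier transform: $\hat f(\xi)=\int_{\mathbb R^n}f(x)e^{-2\pi i x\cdot\xi}\,dx$. For $n\ge1$, $\alpha>-1$ and Schwartz functions $f,g$ on $\mathbb R^n$, the bilinear Bochner–Riesz square function is $$\mathcal G^{\alpha}(f,g)(x)=\left(\int_0^\infty\left|\frac{\partial}{\partial R}\mathcal B_R^{\alpha+1}(f,g)(x)\right|^2R\,dR\right)^{1/2}=\left(\int_0^\infty|\mathcal K_R^\alpha*(f,g)(x)|^2\frac{dR}{R}\right)^{1/2},$$ where $$\mathcal B_R^{\alpha}(f,g)(x)=\int_{\mathbb R^n}\int_{\mathbb R^n}\left(1-\frac{|\xi|^2+|\eta|^2}{R^2}\right)_+^{\alpha}\hat f(\xi)\hat g(\eta)e^{2\pi i x\cdot(\xi+\eta)}\,d\xi\,d\eta,\qquad R>0,$$ and $$\mathcal K_R^\alpha*(f,g)(x)=2(\alpha+1)\int_{\mathbb R^n}\int_{\mathbb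 R^n}\frac{|\xi|^2+|\eta|^2}{R^2}\left(1-\frac{|\xi|^2+|\eta|^2}{R^2}\right)_+^{\alpha}\hat f(\xi)\hat g(\eta)e^{2\pi i x\cdot(\xi+\eta)}\,d\xi\,d\eta .$$ "Bounded from $L^{p_1}\times L^{p_2}$ to $L^p$" means that there is a constant $C$ with $\|\mathcal G^\alpha(f,g)\|_p\le C\|f\|_{p_1}\|g\|_{p_2}$ for all Schwartz functions $f,g$ ($p$ may be less than $1$, with the usual quasi-norm). Convention: $1/\infty=0$. *)

theory Defs
  imports "HOL-Probability.Essential_Supremum"
begin

primrec iter_partial ::
  "'n list \<Rightarrow> (real ^ 'n \<Rightarrow> complex) \<Rightarrow> real ^ 'n \<Rightarrow> complex" where
  "iter_partial [] f = f"
| "iter_partial (j # js) f =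
     (\<lambda>x. frechet_derivative (iter_partial js f) (at x) (axis j 1))"

text \<open>
  Asking every iterated partial derivative to be (Frechet) differentiable everywhere is the same
  as smoothness, so \<open>frechet_derivative\<close> is never applied at a point of non-differentiability
  when \<open>schwartz f\<close> holds.
\<close>

definition schwartz :: "(real ^ 'n \<Rightarrow> complex) \<Rightarrow> bool" where
  "schwartz f \<longleftrightarrow>
     (\<forall>js. (\<forall>x. iter_partial js f differentiable (at x)) \<and>
           (\<forall>k::nat. \<exists>C. \<forall>x. norm x ^ k * norm (iter_partial js f x) \<le> C))"

definition fourier :: "(real ^ 'n \<Rightarrow> complex) \<Rightarrow> real ^ 'n \<Rightarrow> complex" where
  "fourier f \<xi> = (LINT x|lborel. f x * cis (- 2 * pi * (x \<bullet> \<xi>)))"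

text \<open>
  The power \<open>t\<^sub>+\<^sup>\<alpha>\<close> is \<open>max 0 t powr \<alpha>\<close>; as \<open>0 powr \<alpha> = 0\<close> for every \<open>\<alpha>\<close>, it vanishes for
  \<open>t \<le> 0\<close> even if \<open>\<alpha> \<le> 0\<close>.
\<close>

definition bilinear_BR ::
  "real \<Rightarrow> real \<Rightarrow> (real ^ 'n \<Rightarrow> complex) \<Rightarrow> (real ^ 'n \<Rightarrow> complex) \<Rightarrow> real ^ 'n \<Rightarrow> complex" where
  "bilinear_BR \<alpha> R f g x =
     (LINT \<xi>|lborel. LINT \<eta>|lborel.
        complex_of_real (max 0 (1 - ((norm \<xi>)\<^sup>2 + (norm \<eta>)\<^sup>2) / R\<^sup>2) powr \<alpha>)
        * fourier f \<xi> * fourier g \<eta> * cis (2 * pi * (x \<bullet> (\<xi> + \<eta>))))"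

text \<open>Powers with exponent \<open>a > 0\<close> on \<open>[0, \<infinity>]\<close>.\<close>

definition epowr :: "ennreal \<Rightarrow> real \<Rightarrow> ennreal" where
  "epowr t a = (if t = \<infinity> then \<infinity> else ennreal (enn2real t powr a))"

text \<open>
  The square function takes values in \<open>[0, \<infinity>]\<close>, so that a divergent integral over \<open>R\<close>
  gives the value \<open>\<infinity>\<close> and not \<open>0\<close>.
\<close>

definition BR_square ::
  "real \<Rightarrow> (real ^ 'n \<Rightarrow> complex) \<Rightarrow> (real ^ 'n \<Rightarrow> complex) \<Rightarrow> real ^ 'n \<Rightarrow> ennreal" where
  "BR_square \<alpha> f g x =
     epowr (\<integral>\<^sup>+R\<in>{0<..}.
              ennreal ((norm (vector_derivative (\<lambda>r. bilinear_BR (\<alpha> + 1) r f g x) (at R)))\<^sup>2 * R)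
            \<partial>lborel) (1/2)"

definition Lp_norm :: "ennreal \<Rightarrow> (real ^ 'n \<Rightarrow> ennreal) \<Rightarrow> ennreal" where
  "Lp_norm p u =
     (if p = \<infinity> then esssup lborel u
      else epowr (\<integral>\<^sup>+x. epowr (u x) (enn2real p) \<partial>lborel) (1 / enn2real p))"

definition bilinear_bounded ::
  "((real ^ 'n \<Rightarrow> complex) \<Rightarrow> (real ^ 'n \<Rightarrow> complex) \<Rightarrow> real ^ 'n \<Rightarrow> ennreal)
    \<Rightarrow> ennreal \<Rightarrow> ennreal \<Rightarrow> ennreal \<Rightarrow> bool" where
  "bilinear_bounded T p1 p2 p \<longleftrightarrow>
     (\<exists>C::real. C \<ge> 0 \<and> (\<forall>f g. schwartz f \<longrightarrow> schwartz g \<longrightarrow>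
        Lp_norm p (T f g)
          \<le> ennreal C * Lp_norm p1 (\<lambda>x. ennreal (norm (f x)))
                      * Lp_norm p2 (\<lambda>x. ennreal (norm (g x)))))"

end

theory Submission
  imports Defs "HOL-Complex_Analysis.Conformal_Mappings" "HOL-Probability.Characteristic_Functions"
begin

text \<open>
  The square function is bounded from below on explicit Gaussians \<open>f = g\<close>, with the Laplace transform
  in \<open>R\<^sup>2\<close> in place of Bessel function asymptotics.  Fix \<open>x\<close>, let \<open>F (\<xi>, \<eta>)\<close> be the Fourier transform of \<open>f\<close> at \<open>\<xi>\<close> times that of
  \<open>g\<close> at \<open>\<eta>\<close> times \<open>cis (2 * pi * (x \<bullet> (\<xi> + \<eta>)))\<close>, a bounded continuous function of \<open>z = (\<xi>, \<eta>)\<close>,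
  and put \<open>u = R\<^sup>2\<close>.  Up to constants the square of \<open>BR_square \<alpha> f g x\<close> is then
    \<open>\<integral> u powr (- 2 * \<alpha> - 3) * \<bar>H u\<bar>\<^sup>2 du\<close>  with  \<open>H u = \<integral> (u - \<bar>z\<bar>\<^sup>2)\<^sub>+ powr \<alpha> * \<bar>z\<bar>\<^sup>2 * F z dz\<close>.
  In the variable \<open>u\<close> the function \<open>H\<close> is a convolution with the power \<open>\<alpha>\<close>, so its Laplace transform
  factorizes: it is \<open>Gamma (\<alpha> + 1) * s powr (- \<alpha> - 1) * W s\<close> with
  \<open>W s = \<integral> \<bar>z\<bar>\<^sup>2 * F z * exp (- s * \<bar>z\<bar>\<^sup>2) dz\<close>.  The exponentials \<open>exp (- s * u)\<close> with
  \<open>s = \<sigma> * (1 + \<i> * k)\<close>, \<open>k\<close> a natural number, are almost orthogonal for the weight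
  \<open>u powr (2 * \<alpha> + 3)\<close>, and Bessel's inequality (\<open>laplace_bessel\<close>) bounds the square function from
  below by a sum of \<open>\<bar>s\<bar> powr (- 2 * \<alpha> - 2) * \<bar>W s\<bar>\<^sup>2\<close> (\<open>BR_square_lower_bound\<close>).  For Gaussians \<open>W\<close>
  is elementary (\<open>laplace_gabor\<close>), because it is a Gaussian integral.

  Three families of Gaussians give everything.
    \<^item> For the standard Gaussian the values of \<open>s\<close> with \<open>k\<close> comparable to \<open>\<bar>x\<bar>\<close> show that the square
      function is at least a multiple of \<open>\<bar>x\<bar> powr (- (\<alpha> + n + 1 / 2))\<close> at infinity.  Finiteness of
      the \<open>L\<^sup>p\<close> norm forces \<open>p * (\<alpha> + n + 1 / 2) > n\<close> (\<open>kernel_decay_imp_exponent_gt\<close>).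
    \<^item> A Gaussian modulated to a frequency of size \<open>N\<close> concentrates \<open>F\<close> near a sphere, so that \<open>\<bar>W\<bar>\<close>
      does not decay before \<open>k\<close> reaches \<open>N\<close>.  If \<open>\<alpha> \<le> - 1 / 2\<close>, then the square function on the unit
      ball is at least a multiple of the square root of the \<open>N\<close>-th harmonic number
      (\<open>wave_packets_imp_exponent_gt_minus_half\<close>).
    \<^item> A chirp, that is a Gaussian of complex width with \<open>\<bar>f x\<bar>\<close> spread over \<open>\<bar>x\<bar> \<le> N\<close>, turns a single
      \<open>s\<close> with \<open>k = N\<close> into a resonance.  This gives \<open>\<alpha> \<ge> n - n / p1 - n / p2 - 1\<close>
      (\<open>chirps_imp_exponent_ge\<close>).
  The first two bounds are part (1).  The chirp bound exceeds the first entry of the maximum in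
  part (2) by \<open>n / 2 * (1 - 1 / p2)\<close> and the second one by \<open>n / 2 * (1 - 1 / p1)\<close>; this gives the
  strict inequality of part (2), except for \<open>p2 = 1\<close> or \<open>p1 = 1\<close>, where the entry in question is
  below \<open>- 1 / 2\<close>.
\<close>

section \<open>Integrals that are holomorphic in the right half-plane\<close>

lemma exp_remainder_bound:
  fixes w :: complex
  shows "norm (exp w - 1 - w) \<le> exp \<bar>Re w\<bar> * (norm w)\<^sup>2"
  using Taylor_exp[of w 1] by (simp add: numeral_2_eq_2 algebra_simps)

lemma le_exp_scaled:
  fixes r t :: real
  assumes "r > 0" "t \<ge> 0"
  shows "t \<le> exp (r * t) / r" "t\<^sup>2 \<le> 2 * exp (r * t) / r\<^sup>2"
proof -
  have *: "1 + r * t + (r * t)\<^sup>2 / 2 \<le> exp (r * t)"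
    using assms by (intro exp_lower_Taylor_quadratic) auto
  have "r * t \<ge> 0" "r\<^sup>2 * t\<^sup>2 \<ge> 0" using assms by auto
  then have "r * t \<le> exp (r * t)" "r\<^sup>2 * t\<^sup>2 \<le> 2 * exp (r * t)"
    using * unfolding power_mult_distrib by linarith+
  then show "t \<le> exp (r * t) / r" "t\<^sup>2 \<le> 2 * exp (r * t) / r\<^sup>2"
    using assms by (auto simp: field_simps)
qed

text \<open>
  Integrals of the form \<open>\<integral> h * exp (- s * \<phi>)\<close> are holomorphic in the right half-plane as soon as they
  converge absolutely there.  With \<open>\<phi> t = max 0 t\<close> this is used for the Gamma integral, with \<open>\<phi> t = pi * t\<^sup>2\<close> for
  Gaussians of complex width, and with \<open>\<phi> z = (norm z)\<^sup>2\<close> to differentiate the Laplace transform of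
  a function on Euclidean space.
\<close>

lemma
  fixes h :: "'a \<Rightarrow> complex" and \<phi> :: "'a \<Rightarrow> real" and s :: complex
  assumes \<phi>_nonneg: "\<And>x. \<phi> x \<ge> 0"
    and h_meas [measurable]: "h \<in> borel_measurable M" and \<phi>_meas [measurable]: "\<phi> \<in> borel_measurable M"
    and int: "\<And>s::real. s > 0 \<Longrightarrow> integrable M (\<lambda>x. norm (h x) * exp (- s * \<phi> x))"
    and re: "Re s > 0"
  shows integrable_exp_mult: "integrable M (\<lambda>x. h x * exp (- s * \<phi> x))"
    and has_field_derivative_exp_integral:
      "((\<lambda>s::complex. LINT x|M. h x * exp (- s * \<phi> x)) has_field_derivative
         - (LINT x|M. of_real (\<phi> x) * h x * exp (- s * \<phi> x))) (at s)"
proof -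
  have I0: "integrable M (\<lambda>x. h x * exp (- z * \<phi> x))" if "Re z > 0" for z
    by (rule Bochner_Integration.integrable_bound[OF int[OF that]]) (auto simp: norm_mult)
  then show "integrable M (\<lambda>x. h x * exp (- s * \<phi> x))" using re by blast
  \<comment> \<open>One third of the decay absorbs the shift from \<open>s\<close> to \<open>z\<close>, one third absorbs \<open>\<phi>\<^sup>2\<close> in the Taylor
    remainder, and the last third keeps the bound integrable.\<close>
  define r where "r = Re s / 3"
  have r: "r > 0" using re by (simp add: r_def)
  have I1: "integrable M (\<lambda>x. of_real (\<phi> x) * h x * exp (- s * \<phi> x))"
  proof (rule Bochner_Integration.integrable_bound)
    show "integrable M (\<lambda>x. norm (h x) * exp (- r * \<phi> x) / r)" using int[OF r] by simp
    show "AE x in M. norm (of_real (\<phi> x) * h x * exp (- s * \<phi> x)) \<le> norm (norm (h x) * exp (- r * \<phi> x) / r)"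
    proof (rule AE_I2)
      fix x
      have "\<phi> x * exp (- (Re s * \<phi> x)) \<le> exp (r * \<phi> x) / r * exp (- (Re s * \<phi> x))"
        using le_exp_scaled(1)[OF r \<phi>_nonneg[of x]] by (intro mult_right_mono) auto
      also have "\<dots> = exp (- (2 * r * \<phi> x)) / r" by (simp add: r_def flip: exp_add)
      also have "\<dots> \<le> exp (- r * \<phi> x) / r"
        using r \<phi>_nonneg[of x] by (intro divide_right_mono) (auto simp: mult_right_mono)
      finally show "norm (of_real (\<phi> x) * h x * exp (- s * \<phi> x)) \<le> norm (norm (h x) * exp (- r * \<phi> x) / r)"
        using mult_left_mono[of _ _ "norm (h x)"] r \<phi>_nonneg[of x] by (fastforce simp: norm_mult mult_ac)
    qed
  qed simp
  let ?f = "\<lambda>s::complex. LINT x|M. h x * exp (- s * \<phi> x)"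
  let ?D = "- (LINT x|M. of_real (\<phi> x) * h x * exp (- s * \<phi> x))"
  define C where "C = (LINT x|M. (2 / r\<^sup>2) * (norm (h x) * exp (- r * \<phi> x)))"
  have est: "norm (?f z - ?f s - (z - s) * ?D) \<le> C * (norm (z - s))\<^sup>2" if z: "norm (z - s) < r" for z
  proof -
    have "\<bar>Re (z - s)\<bar> < r" using z abs_Re_le_cmod le_less_trans by blast
    then have rez: "Re z > 0" using r unfolding r_def minus_complex.sel by linarith
    have "?f z - ?f s - (z - s) * ?D
        = (LINT x|M. h x * exp (- z * \<phi> x) - h x * exp (- s * \<phi> x) + (z - s) * (of_real (\<phi> x) * h x * exp (- s * \<phi> x)))"
      using I0[OF rez] I0[OF re] I1 by simp
    also have "norm \<dots> \<le> (LINT x|M. (norm (z - s))\<^sup>2 * ((2 / r\<^sup>2) * (norm (h x) * exp (- r * \<phi> x))))"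
    proof (rule order_trans[OF integral_norm_bound integral_mono])
      show "integrable M (\<lambda>x. norm (h x * exp (- z * \<phi> x) - h x * exp (- s * \<phi> x) + (z - s) * (of_real (\<phi> x) * h x * exp (- s * \<phi> x))))"
        using I0[OF rez] I0[OF re] I1 by (intro integrable_norm) simp
      show "integrable M (\<lambda>x. (norm (z - s))\<^sup>2 * ((2 / r\<^sup>2) * (norm (h x) * exp (- r * \<phi> x))))"
        using int[OF r] by simp
      fix x
      let ?w = "- (z - s) * of_real (\<phi> x)"
      have "h x * exp (- z * \<phi> x) - h x * exp (- s * \<phi> x) + (z - s) * (of_real (\<phi> x) * h x * exp (- s * \<phi> x))
         = h x * exp (- s * \<phi> x) * (exp ?w - 1 - ?w)"
        by (simp add: algebra_simps flip: exp_add)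
      also have "norm \<dots> \<le> norm (h x) * exp (- (Re s * \<phi> x)) * (exp (r * \<phi> x) * ((norm (z - s))\<^sup>2 * (\<phi> x)\<^sup>2))"
      proof -
        have "\<bar>Re ?w\<bar> \<le> r * \<phi> x"
          using \<open>\<bar>Re (z - s)\<bar> < r\<close> \<phi>_nonneg[of x] by (auto simp: abs_mult intro!: mult_right_mono)
        then have "exp \<bar>Re ?w\<bar> * (norm ?w)\<^sup>2 \<le> exp (r * \<phi> x) * ((norm (z - s))\<^sup>2 * (\<phi> x)\<^sup>2)"
          by (intro mult_mono) (auto simp: norm_mult power_mult_distrib norm_minus_commute)
        then have "norm (exp ?w - 1 - ?w) \<le> exp (r * \<phi> x) * ((norm (z - s))\<^sup>2 * (\<phi> x)\<^sup>2)"
          using exp_remainder_bound[of ?w] by linarith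
        then show ?thesis by (simp add: norm_mult mult_left_mono)
      qed
      also have "\<dots> \<le> norm (h x) * exp (- (Re s * \<phi> x)) * (exp (r * \<phi> x) * ((norm (z - s))\<^sup>2 * (2 * exp (r * \<phi> x) / r\<^sup>2)))"
        using le_exp_scaled(2)[OF r \<phi>_nonneg[of x]] by (intro mult_left_mono) auto
      also have "\<dots> = (norm (z - s))\<^sup>2 * ((2 / r\<^sup>2) * (norm (h x) * (exp (- (Re s * \<phi> x)) * exp (r * \<phi> x) * exp (r * \<phi> x))))"
        by simp
      also have "exp (- (Re s * \<phi> x)) * exp (r * \<phi> x) * exp (r * \<phi> x) = exp (- r * \<phi> x)"
        by (simp add: r_def flip: exp_add)
      finally show "norm (h x * exp (- z * \<phi> x) - h x * exp (- s * \<phi> x) + (z - s) * (of_real (\<phi> x) * h x * exp (- s * \<phi> x)))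
         \<le> (norm (z - s))\<^sup>2 * ((2 / r\<^sup>2) * (norm (h x) * exp (- r * \<phi> x)))" .
    qed
    also have "\<dots> = C * (norm (z - s))\<^sup>2" by (simp add: C_def)
    finally show ?thesis .
  qed
  show "(?f has_field_derivative ?D) (at s)"
    unfolding has_field_derivative_iff
  proof (rule LIM_zero_cancel, rule Lim_null_comparison)
    show "\<forall>\<^sub>F z in at s. norm ((?f z - ?f s) / (z - s) - ?D) \<le> C * norm (z - s)"
      unfolding eventually_at
    proof (intro exI[of _ r] conjI ballI impI r)
      fix z assume z: "z \<noteq> s \<and> dist z s < r"
      then have "z - s \<noteq> 0" by simp
      then have "(?f z - ?f s) / (z - s) - ?D = (?f z - ?f s - (z - s) * ?D) / (z - s)"
        by (simp add: field_simps)
      then have "norm ((?f z - ?f s) / (z - s) - ?D) = norm (?f z - ?f s - (z - s) * ?D) / norm (z - s)"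
        by (simp add: norm_divide)
      also have "\<dots> \<le> C * (norm (z - s))\<^sup>2 / norm (z - s)"
        using est[of z] z by (intro divide_right_mono) (auto simp: dist_norm)
      finally show "norm ((?f z - ?f s) / (z - s) - ?D) \<le> C * norm (z - s)"
        using z by (simp add: power2_eq_square)
    qed
    have "((\<lambda>z. C * norm (z - s)) \<longlongrightarrow> C * norm (s - s)) (at s)"
      by (intro tendsto_intros)
    then show "((\<lambda>z. C * norm (z - s)) \<longlongrightarrow> 0) (at s)" by simp
  qed
qed

lemma holomorphic_exp_integral:
  fixes h :: "'a \<Rightarrow> complex" and \<phi> :: "'a \<Rightarrow> real"
  assumes "\<And>x. \<phi> x \<ge> 0" "h \<in> borel_measurable M" "\<phi> \<in> borel_measurable M"
    and "\<And>s::real. s > 0 \<Longrightarrow> integrable M (\<lambda>x. norm (h x) * exp (- s * \<phi> x))"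
  shows "(\<lambda>s. LINT x|M. h x * exp (- s * of_real (\<phi> x))) holomorphic_on {s. Re s > 0}"
proof (rule holomorphic_onI, rule field_differentiable_at_within)
  fix s :: complex assume "s \<in> {s. Re s > 0}"
  then show "(\<lambda>s. LINT x|M. h x * exp (- s * of_real (\<phi> x))) field_differentiable at s"
    unfolding field_differentiable_def
    using has_field_derivative_exp_integral[OF assms, of s] by auto
qed

text \<open>
  The closed forms below are classical for a real parameter; this lemma carries them over to a
  complex one.
\<close>

lemma right_half_plane_identity:
  assumes "f holomorphic_on {z. Re z > 0}" "g holomorphic_on {z. Re z > 0}"
    and eq: "\<And>x::real. x > 0 \<Longrightarrow> f (of_real x) = g (of_real x)"
    and "Re z > 0"
  shows "f z = g z"
proof -
  have "f z - g z = 0"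
  proof (rule analytic_continuation[where f="\<lambda>z. f z - g z" and S="{z. Re z > 0}" and U="of_real ` {0<..}" and \<xi>=1])
    show "(\<lambda>z. f z - g z) holomorphic_on {z. Re z > 0}" using assms by (intro holomorphic_intros)
    show "open {z. Re z > 0}" by (rule open_halfspace_Re_gt)
    show "connected {z. Re z > 0}" by (rule convex_connected[OF convex_halfspace_Re_gt])
    show "(1::complex) islimpt of_real ` {0::real<..}"
      unfolding islimpt_approachable
    proof (intro allI impI)
      fix e :: real assume "e > 0"
      then show "\<exists>x'\<in>complex_of_real ` {0<..}. x' \<noteq> 1 \<and> dist x' 1 < e"
        by (intro bexI[of _ "of_real (1 + e / 2)"]) (auto simp: dist_norm intro!: image_eqI[of _ _ "1 + e / 2"])
    qed
  qed (use assms in auto)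
  then show ?thesis by simp
qed

lemma
  fixes s x :: real
  assumes "s > -1" "x > 0"
  shows integrable_powr_exp: "integrable lborel (\<lambda>u. indicator {0<..} u * u powr s * exp (- x * u))"
    and integral_powr_exp: "(LINT u|lborel. indicator {0<..} u * u powr s * exp (- x * u)) = Gamma (s + 1) * x powr (- s - 1)"
proof -
  let ?g = "\<lambda>u::real. indicator {0<..} u * u powr s * exp (- u)"
  have "((\<lambda>t. t powr s / exp t) has_integral Gamma (s + 1)) {0..}"
    using Gamma_integral_real[of "s + 1"] assms by simp
  then have "((\<lambda>t. t powr s / exp t) has_integral Gamma (s + 1)) {0<..}"
    by (rule has_integral_spike_set_eq[THEN iffD1, rotated -1])
       (auto intro: negligible_subset[OF negligible_sing[of 0]])
  then have "(?g has_integral Gamma (s + 1)) UNIV"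
    by (subst (asm) has_integral_restrict_UNIV[symmetric], elim has_integral_eq[rotated])
       (auto simp: exp_minus field_simps indicator_def)
  moreover have [measurable]: "?g \<in> borel_measurable borel" by measurable
  ultimately have nn: "(\<integral>\<^sup>+u. ?g u \<partial>lborel) = ennreal (Gamma (s + 1))"
    by (intro nn_integral_has_integral_lborel) auto
  have G: "integrable lborel ?g" "(LINT u|lborel. ?g u) = Gamma (s + 1)"
    using nn assms by (auto intro!: integrableI_nonneg integral_eq_nn_integral[THEN trans] simp: Gamma_real_nonneg)
  have sc: "?g (0 + x * u) = x powr s * (indicator {0<..} u * u powr s * exp (- x * u))" for u
    using assms by (auto simp: powr_mult indicator_def zero_less_mult_iff)
  from lborel_integrable_real_affine[OF G(1), of x 0] assms
  show "integrable lborel (\<lambda>u. indicator {0<..} u * u powr s * exp (- x * u))"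
    unfolding sc by (simp add: integrable_mult_right_iff)
  have "Gamma (s + 1) = x * (x powr s * (LINT u|lborel. indicator {0<..} u * u powr s * exp (- x * u)))"
    using lborel_integral_real_affine[of x ?g 0] assms unfolding sc G(2) by simp
  then show "(LINT u|lborel. indicator {0<..} u * u powr s * exp (- x * u)) = Gamma (s + 1) * x powr (- s - 1)"
    using assms by (simp add: powr_diff powr_minus field_simps)
qed

lemma
  fixes s :: real and z :: complex
  assumes "s > -1" "Re z > 0"
  shows integrable_powr_exp_complex: "integrable lborel (\<lambda>u. of_real (indicator {0<..} u * u powr s) * exp (- z * of_real u))"
    and integral_powr_exp_complex: "(LINT u|lborel. of_real (indicator {0<..} u * u powr s) * exp (- z * of_real u)) = of_real (Gamma (s + 1)) * z powr (- of_real s - 1)"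
proof -
  let ?h = "\<lambda>u::real. complex_of_real (indicator {0<..} u * u powr s)"
  have eq: "?h u * exp (- z * of_real u) = ?h u * exp (- z * of_real (max 0 u))" for u z
    by (auto simp: indicator_def max_def)
  have int: "integrable lborel (\<lambda>u. norm (?h u) * exp (- x * max 0 u))" if "x > 0" for x
  proof -
    have "norm (?h u) * exp (- x * max 0 u) = indicator {0<..} u * u powr s * exp (- x * u)" for u
      by (auto simp: indicator_def max_def)
    then show ?thesis using integrable_powr_exp[OF assms(1) that] by simp
  qed
  note D = integrable_exp_mult[where h="?h" and \<phi>="max 0" and M=lborel, OF _ _ _ int]
     holomorphic_exp_integral[where h="?h" and \<phi>="max 0" and M=lborel, OF _ _ _ int]
  show "integrable lborel (\<lambda>u. ?h u * exp (- z * of_real u))"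
    unfolding eq by (rule D(1)) (use assms in auto)
  show "(LINT u|lborel. ?h u * exp (- z * of_real u)) = of_real (Gamma (s + 1)) * z powr (- of_real s - 1)"
  proof (rule right_half_plane_identity[where z=z])
    show "(\<lambda>z. LINT u|lborel. ?h u * exp (- z * of_real u)) holomorphic_on {z. Re z > 0}"
      unfolding eq by (rule D(2)) auto
    show "(\<lambda>z. of_real (Gamma (s + 1)) * z powr (- of_real s - 1)) holomorphic_on {z. Re z > 0}"
      by (intro holomorphic_intros) (auto simp: complex_nonpos_Reals_iff)
    fix x :: real assume x: "x > 0"
    have "?h u * exp (- of_real x * of_real u) = of_real (indicator {0<..} u * u powr s * exp (- x * u))" for u
      by (simp flip: exp_of_real)
    then have "(LINT u|lborel. ?h u * exp (- of_real x * of_real u)) = of_real (Gamma (s + 1) * x powr (- s - 1))"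
      unfolding integral_powr_exp[OF assms(1) x, symmetric] by (simp only: integral_complex_of_real)
    then show "(LINT u|lborel. ?h u * exp (- of_real x * of_real u)) = of_real (Gamma (s + 1)) * of_real x powr (- of_real s - 1)"
      using x powr_of_real[of x "- s - 1"] by simp
  qed fact
qed

section \<open>Gaussian integrals\<close>

lemma
  fixes f :: "'a::euclidean_space \<Rightarrow> real \<Rightarrow> complex"
  assumes int: "\<And>b. b \<in> Basis \<Longrightarrow> integrable lborel (f b)"
  shows integrable_lborel_prod: "integrable lborel (\<lambda>x::'a. \<Prod>b\<in>Basis. f b (x \<bullet> b))"
    and integral_lborel_prod: "(LINT x|lborel. (\<Prod>b\<in>Basis. f b (x \<bullet> b))) = (\<Prod>b\<in>Basis. (LINT t|lborel. f b t))"
proof -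
  interpret product_sigma_finite "\<lambda>_::'a. lborel :: real measure" by standard
  have [measurable]: "f b \<in> borel_measurable borel" if "b \<in> Basis" for b
    using int[OF that] borel_measurable_integrable by fastforce
  have [simp]: "(\<Sum>b\<in>Basis. x b *\<^sub>R b) \<bullet> c = x c" if "c \<in> Basis" for x :: "'a \<Rightarrow> real" and c
    using that by simp
  have m: "(\<lambda>x. \<Sum>b\<in>Basis. x b *\<^sub>R b) \<in> Pi\<^sub>M Basis (\<lambda>_::'a. lborel :: real measure) \<rightarrow>\<^sub>M borel"
    by measurable
  have mf: "(\<lambda>x::'a. \<Prod>b\<in>Basis. f b (x \<bullet> b)) \<in> borel_measurable borel"
    by measurable
  show "integrable lborel (\<lambda>x::'a. \<Prod>b\<in>Basis. f b (x \<bullet> b))"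
    unfolding lborel_eq[where 'a='a]
    by (subst integrable_distr_eq[OF m mf],
        subst Bochner_Integration.integrable_cong[OF refl, where g="\<lambda>x. \<Prod>b\<in>Basis. f b (x b)"])
       (auto intro!: product_integrable_prod[OF finite_Basis int] prod.cong)
  show "(LINT x|lborel. (\<Prod>b\<in>Basis. f b (x \<bullet> b))) = (\<Prod>b\<in>Basis. (LINT t|lborel. f b t))"
    unfolding lborel_eq[where 'a='a]
    by (subst integral_distr[OF m mf], subst product_integral_prod[symmetric, OF finite_Basis int])
       (auto intro!: Bochner_Integration.integral_cong prod.cong)
qed

lemma
  fixes b :: real and c :: complex
  assumes b: "b > 0"
  shows integrable_gaussian_real: "integrable lborel (\<lambda>t::real. exp (2 * pi * c * t) * exp (- b * (pi * t\<^sup>2)))"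
    and integral_gaussian_real: "(LINT t|lborel. exp (2 * pi * c * t) * exp (- b * (pi * t\<^sup>2))) = exp (pi * c\<^sup>2 / b) / csqrt b"
proof -
  define r y \<sigma> where "r = Re c" and "y = Im c" and "\<sigma> = 1 / sqrt (2 * pi * b)"
  define f :: "real \<Rightarrow> complex" where "f = (\<lambda>t. exp (2 * pi * c * t) * exp (- b * (pi * t\<^sup>2)))"
  have \<sigma>: "\<sigma> > 0" "\<sigma>\<^sup>2 = 1 / (2 * pi * b)" using b by (auto simp: \<sigma>_def power_divide)
  have c: "c = of_real r + \<i> * of_real y" by (simp add: r_def y_def complex_eq)
  define K where "K = exp (of_real (pi * r\<^sup>2 / b)) * cis (2 * pi * y * r / b) * sqrt (2 * pi)"
  \<comment> \<open>Completing the square in the real part of \<open>c\<close> and rescaling turns the integrand into a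
    standard normal density times a character.\<close>
  have fs: "f (r / b + \<sigma> * s) = K * (std_normal_density s * iexp ((2 * pi * y * \<sigma>) * s))" for s
  proof -
    have "2 * pi * c * of_real (r / b + \<sigma> * s) + of_real (- b * (pi * (r / b + \<sigma> * s)\<^sup>2))
        = of_real (pi * r\<^sup>2 / b) + \<i> * of_real (2 * pi * y * r / b) + of_real (- (pi * b * \<sigma>\<^sup>2) * s\<^sup>2) + \<i> * of_real (2 * pi * y * \<sigma> * s)"
      using b by (simp add: c power2_eq_square field_simps)
    also have "pi * b * \<sigma>\<^sup>2 = 1 / 2" using b \<sigma> by simp
    finally have e: "2 * pi * c * of_real (r / b + \<sigma> * s) + of_real (- b * (pi * (r / b + \<sigma> * s)\<^sup>2))
        = of_real (pi * r\<^sup>2 / b) + \<i> * of_real (2 * pi * y * r / b) + of_real (- (1 / 2) * s\<^sup>2) + \<i> * of_real (2 * pi * y * \<sigma> * s)" .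
    have "f (r / b + \<sigma> * s) = exp (2 * pi * c * of_real (r / b + \<sigma> * s) + of_real (- b * (pi * (r / b + \<sigma> * s)\<^sup>2)))"
      unfolding f_def exp_add exp_of_real by simp
    also have "\<dots> = K * (std_normal_density s * iexp ((2 * pi * y * \<sigma>) * s))"
      unfolding e exp_add by (simp add: K_def std_normal_density_def cis_conv_exp flip: exp_of_real)
    finally show ?thesis .
  qed
  have dens: "integrable lborel (\<lambda>s. std_normal_density s * iexp (t * s))"
    "(LINT s|lborel. std_normal_density s * iexp (t * s)) = of_real (exp (- (t\<^sup>2) / 2))" for t :: real
  proof -
    have "integrable lborel (\<lambda>s. complex_of_real (std_normal_density s))"
      using integrable_std_normal_moment[of 0] by simp
    then show "integrable lborel (\<lambda>s. std_normal_density s * iexp (t * s))"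
      by (rule Bochner_Integration.integrable_bound) (auto simp: norm_mult)
    have "char std_normal_distribution t = (LINT s|lborel. std_normal_density s *\<^sub>R iexp (t * s))"
      unfolding char_def by (subst integral_density) auto
    then show "(LINT s|lborel. std_normal_density s * iexp (t * s)) = of_real (exp (- (t\<^sup>2) / 2))"
      by (simp add: char_std_normal_distribution scaleR_conv_of_real)
  qed
  have "integrable lborel (\<lambda>s. f (r / b + \<sigma> * s))"
    unfolding fs by (rule integrable_mult_right[OF dens(1)])
  then have "integrable lborel f"
    using \<sigma> by (subst (asm) lborel_integrable_real_affine_iff) auto
  then show "integrable lborel (\<lambda>t::real. exp (2 * pi * c * t) * exp (- b * (pi * t\<^sup>2)))" by (simp add: f_def)
  have "(LINT t|lborel. f t) = \<sigma> *\<^sub>R (LINT s|lborel. f (r / b + \<sigma> * s))"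
    using \<sigma> lborel_integral_real_affine[of \<sigma> f "r / b"] by simp
  also have "\<dots> = \<sigma> * (K * exp (- ((2 * pi * y * \<sigma>)\<^sup>2) / 2))"
    unfolding fs integral_mult_right_zero dens(2) by (simp add: scaleR_conv_of_real)
  also have "\<dots> = (\<sigma> * sqrt (2 * pi)) * exp (of_real (pi * r\<^sup>2 / b) + \<i> * of_real (2 * pi * y * r / b) + of_real (- ((2 * pi * y * \<sigma>)\<^sup>2) / 2))"
    unfolding exp_add K_def by (simp add: cis_conv_exp flip: exp_of_real)
  also have "\<sigma> * sqrt (2 * pi) = 1 / sqrt b" using b by (simp add: \<sigma>_def real_sqrt_mult)
  also have "(2 * pi * y * \<sigma>)\<^sup>2 = 2 * (pi * y\<^sup>2 / b)"
    unfolding power_mult_distrib \<sigma>(2) using b by (simp add: power2_eq_square)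
  also have "of_real (pi * r\<^sup>2 / b) + \<i> * of_real (2 * pi * y * r / b) + of_real (- (2 * (pi * y\<^sup>2 / b)) / 2) = pi * c\<^sup>2 / b"
    using b unfolding c by (simp add: power2_eq_square add_divide_distrib diff_divide_distrib algebra_simps)
  finally have "(LINT t|lborel. f t) = complex_of_real (1 / sqrt b) * exp (pi * c\<^sup>2 / b)" .
  then show "(LINT t|lborel. exp (2 * pi * c * t) * exp (- b * (pi * t\<^sup>2))) = exp (pi * c\<^sup>2 / b) / csqrt b"
    using b by (simp add: f_def csqrt_of_real_nonneg)
qed

text \<open>
  Both sides are holomorphic in \<open>b\<close>, so it suffices to know the formula for \<open>b > 0\<close>, where it is the
  characteristic function of the normal distribution.
\<close>

lemma
  fixes b c :: complex
  assumes b: "Re b > 0"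
  shows integrable_gaussian_complex: "integrable lborel (\<lambda>t::real. exp (2 * pi * c * t) * exp (- b * (pi * t\<^sup>2)))"
    and integral_gaussian_complex: "(LINT t|lborel. exp (2 * pi * c * t) * exp (- b * (pi * t\<^sup>2))) = exp (pi * c\<^sup>2 / b) / csqrt b"
proof -
  have int: "integrable lborel (\<lambda>t::real. norm (exp (2 * pi * c * t)) * exp (- s * (pi * t\<^sup>2)))" if "s > 0" for s :: real
  proof -
    have "norm (exp (2 * pi * c * t)) * exp (- s * (pi * t\<^sup>2)) = norm (exp (2 * pi * c * t) * complex_of_real (exp (- s * (pi * t\<^sup>2))))" for t
      by (simp add: norm_mult)
    then show ?thesis using integrable_norm[OF integrable_gaussian_real[OF that, of c]] by simp
  qed
  note D = integrable_exp_mult[where h="\<lambda>t. exp (2 * pi * c * t)" and \<phi>="\<lambda>t. pi * t\<^sup>2" and M=lborel, OF _ _ _ int]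
     holomorphic_exp_integral[where h="\<lambda>t. exp (2 * pi * c * t)" and \<phi>="\<lambda>t. pi * t\<^sup>2" and M=lborel, OF _ _ _ int]
  show "integrable lborel (\<lambda>t::real. exp (2 * pi * c * t) * exp (- b * (pi * t\<^sup>2)))"
    using D(1) b by simp
  show "(LINT t|lborel. exp (2 * pi * c * t) * exp (- b * (pi * t\<^sup>2))) = exp (pi * c\<^sup>2 / b) / csqrt b"
  proof (rule right_half_plane_identity[where z=b])
    show "(\<lambda>b. LINT t|lborel. exp (2 * pi * c * t) * exp (- b * (pi * t\<^sup>2))) holomorphic_on {z. Re z > 0}"
      by (rule D(2)) auto
    show "(\<lambda>b. exp (pi * c\<^sup>2 / b) / csqrt b) holomorphic_on {z. Re z > 0}"
      by (intro holomorphic_intros) (auto simp: complex_nonpos_Reals_iff)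
    fix x :: real assume x: "x > 0"
    show "(LINT t|lborel. exp (2 * pi * c * t) * exp (- complex_of_real x * (pi * t\<^sup>2))) = exp (pi * c\<^sup>2 / complex_of_real x) / csqrt x"
    proof -
      have "exp (- complex_of_real x * (pi * t\<^sup>2)) = of_real (exp (- x * (pi * t\<^sup>2)))" for t :: real
        by (simp flip: exp_of_real)
      then show ?thesis using integral_gaussian_real[OF x, of c] by simp
    qed
  qed fact
qed

text \<open>
  The linear part is written with two real vectors because it comes from a modulation (\<open>r\<close>, scaled
  by the complex factor \<open>c\<close>) and from a character (\<open>y\<close>, scaled by \<open>\<i>\<close>).
\<close>

lemma
  fixes b c d :: complex and r y :: "'a::euclidean_space"
  assumes b: "Re b > 0"
  shows integrable_gaussian: "integrable lborel (\<lambda>z. exp (2 * pi * (c * (r \<bullet> z) + d * (y \<bullet> z))) * exp (- b * (pi * (norm z)\<^sup>2)))"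
    and integral_gaussian: "(LINT z|lborel. exp (2 * pi * (c * (r \<bullet> z) + d * (y \<bullet> z))) * exp (- b * (pi * (norm z)\<^sup>2)))
       = exp (pi * (c\<^sup>2 * (norm r)\<^sup>2 + d\<^sup>2 * (norm y)\<^sup>2 + 2 * c * d * (r \<bullet> y)) / b) / csqrt b ^ DIM('a)"
proof -
  define f where "f j t = exp (2 * pi * (c * (r \<bullet> j) + d * (y \<bullet> j)) * complex_of_real t) * exp (- b * (pi * t\<^sup>2))" for j :: 'a and t
  have eq: "exp (2 * pi * (c * (r \<bullet> z) + d * (y \<bullet> z))) * exp (- b * (pi * (norm z)\<^sup>2)) = (\<Prod>j\<in>Basis. f j (z \<bullet> j))" for z
  proof -
    have 1: "2 * pi * (c * (r \<bullet> z) + d * (y \<bullet> z)) = (\<Sum>j\<in>Basis. 2 * pi * (c * (r \<bullet> j) + d * (y \<bullet> j)) * complex_of_real (z \<bullet> j))"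
      unfolding euclidean_inner[of r z] euclidean_inner[of y z]
      by (simp add: sum_distrib_left sum.distrib algebra_simps)
    have 2: "- b * (pi * (norm z)\<^sup>2) = (\<Sum>j\<in>Basis. - b * (pi * (complex_of_real (z \<bullet> j))\<^sup>2))"
      unfolding euclidean_inner[of z z] power2_norm_eq_inner of_real_power[symmetric]
      by (simp add: sum_distrib_left sum_negf power2_eq_square)
    show ?thesis unfolding 1 2 f_def prod.distrib exp_sum[OF finite_Basis] by simp
  qed
  note I = integrable_gaussian_complex[OF b, of "c * (r \<bullet> j) + d * (y \<bullet> j)" for j, folded f_def]
  show "integrable lborel (\<lambda>z. exp (2 * pi * (c * (r \<bullet> z) + d * (y \<bullet> z))) * exp (- b * (pi * (norm z)\<^sup>2)))"
    unfolding eq by (rule integrable_lborel_prod) (rule I)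
  have "(LINT z|lborel. exp (2 * pi * (c * (r \<bullet> z) + d * (y \<bullet> z))) * exp (- b * (pi * (norm z)\<^sup>2)))
     = (\<Prod>j\<in>Basis. (LINT t|lborel. f j t))"
    unfolding eq by (rule integral_lborel_prod) (rule I)
  also have "\<dots> = (\<Prod>j\<in>Basis. exp (pi * (c * (r \<bullet> j) + d * (y \<bullet> j))\<^sup>2 / b) / csqrt b)"
    unfolding f_def by (intro prod.cong refl integral_gaussian_complex b)
  also have "\<dots> = exp (\<Sum>j\<in>Basis. pi * (c * (r \<bullet> j) + d * (y \<bullet> j))\<^sup>2 / b) / csqrt b ^ DIM('a)"
    by (simp add: prod_dividef exp_sum)
  also have "(\<Sum>j\<in>Basis. pi * (c * (r \<bullet> j) + d * (y \<bullet> j))\<^sup>2 / b)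
      = pi * (c\<^sup>2 * (norm r)\<^sup>2 + d\<^sup>2 * (norm y)\<^sup>2 + 2 * c * d * (r \<bullet> y)) / b"
    unfolding power2_norm_eq_inner euclidean_inner[of r r] euclidean_inner[of y y] euclidean_inner[of r y]
    by (simp add: sum_distrib_left sum_divide_distrib sum.distrib add_divide_distrib algebra_simps power2_eq_square)
  finally show "(LINT z|lborel. exp (2 * pi * (c * (r \<bullet> z) + d * (y \<bullet> z))) * exp (- b * (pi * (norm z)\<^sup>2)))
       = exp (pi * (c\<^sup>2 * (norm r)\<^sup>2 + d\<^sup>2 * (norm y)\<^sup>2 + 2 * c * d * (r \<bullet> y)) / b) / csqrt b ^ DIM('a)" .
qed

lemma
  fixes \<beta> :: real
  assumes "\<beta> > 0"
  shows integrable_gaussian_norm: "integrable lborel (\<lambda>z::'a::euclidean_space. exp (- \<beta> * (norm z)\<^sup>2))"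
    and integral_gaussian_norm: "(LINT z::'a|lborel. exp (- \<beta> * (norm z)\<^sup>2)) = (pi / \<beta>) powr (DIM('a) / 2)"
proof -
  have b: "Re (of_real (\<beta> / pi)) > 0" using assms by simp
  have I: "integrable lborel (\<lambda>z::'a. complex_of_real (exp (- \<beta> * (norm z)\<^sup>2)))"
    using integrable_gaussian[OF b, of 0 "0::'a" 0 0] assms by (simp flip: exp_of_real)
  show "integrable lborel (\<lambda>z::'a. exp (- \<beta> * (norm z)\<^sup>2))"
    using integrable_Re[OF I] by simp
  have "complex_of_real (LINT z::'a|lborel. exp (- \<beta> * (norm z)\<^sup>2)) = (LINT z::'a|lborel. complex_of_real (exp (- \<beta> * (norm z)\<^sup>2)))"
    by simp
  also have "\<dots> = 1 / csqrt (of_real (\<beta> / pi)) ^ DIM('a)"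
    using integral_gaussian[OF b, of 0 "0::'a" 0 0] assms by (simp flip: exp_of_real)
  also have "\<dots> = complex_of_real (1 / sqrt (\<beta> / pi) ^ DIM('a))"
    using assms by (subst csqrt_of_real_nonneg) auto
  also have "1 / sqrt (\<beta> / pi) ^ DIM('a) = (pi / \<beta>) powr (DIM('a) / 2)"
  proof -
    have "(pi / \<beta>) powr (DIM('a) / 2) = ((pi / \<beta>) powr (1 / 2)) powr DIM('a)"
      by (simp add: powr_powr)
    also have "\<dots> = sqrt (pi / \<beta>) ^ DIM('a)"
      using assms by (simp add: powr_realpow powr_half_sqrt)
    finally show ?thesis
      by (simp add: real_sqrt_divide power_divide)
  qed
  finally show "(LINT z::'a|lborel. exp (- \<beta> * (norm z)\<^sup>2)) = (pi / \<beta>) powr (DIM('a) / 2)"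
    by (simp only: of_real_eq_iff)
qed

section \<open>Riesz means\<close>

text \<open>
  Without the normalizing factor \<open>u powr (- \<beta>)\<close> the Riesz mean is, as a function of \<open>u\<close>, the
  convolution of \<open>u\<^sub>+ powr \<beta>\<close> with the image of \<open>F z dz\<close> under \<open>z \<mapsto> (norm z)\<^sup>2\<close>.
\<close>

definition riesz_mean :: "real \<Rightarrow> real \<Rightarrow> ('v::euclidean_space \<Rightarrow> complex) \<Rightarrow> complex" where
  "riesz_mean \<beta> u F = (LINT z|lborel. of_real (max 0 (u - (norm z)\<^sup>2) powr \<beta>) * F z)"

definition bochner_riesz :: "real \<Rightarrow> real \<Rightarrow> ('v::euclidean_space \<Rightarrow> complex) \<Rightarrow> complex" where
  "bochner_riesz \<beta> R F = (LINT z|lborel. of_real (max 0 (1 - (norm z)\<^sup>2 / R\<^sup>2) powr \<beta>) * F z)"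

lemma
  fixes f :: "'v::euclidean_space \<Rightarrow> 'b::{banach, second_countable_topology}" and c :: real
  assumes "c \<noteq> 0" and [measurable]: "f \<in> borel_measurable borel"
  shows integrable_lborel_scaleR: "integrable lborel (\<lambda>z. f (c *\<^sub>R z)) \<longleftrightarrow> integrable lborel f"
    and integral_lborel_scaleR: "(LINT z|lborel. f z) = \<bar>c\<bar> ^ DIM('v) *\<^sub>R (LINT z|lborel. f (c *\<^sub>R z))"
proof -
  have eq: "lborel = density (distr lborel borel (\<lambda>x::'v. c *\<^sub>R x)) (\<lambda>_. ennreal (\<bar>c\<bar> ^ DIM('v)))"
    using lborel_affine[OF assms(1), of "0::'v"] by (simp add: ennreal_power)
  have "integrable lborel f \<longleftrightarrow> integrable (density (distr lborel borel (\<lambda>x::'v. c *\<^sub>R x)) (\<lambda>_. ennreal (\<bar>c\<bar> ^ DIM('v)))) f"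
    by (subst eq) simp
  also have "\<dots> \<longleftrightarrow> integrable lborel (\<lambda>z. \<bar>c\<bar> ^ DIM('v) *\<^sub>R f (c *\<^sub>R z))"
    by (subst integrable_density) (simp_all add: integrable_distr_eq)
  also have "\<dots> \<longleftrightarrow> integrable lborel (\<lambda>z. f (c *\<^sub>R z))"
  proof
    assume "integrable lborel (\<lambda>z. \<bar>c\<bar> ^ DIM('v) *\<^sub>R f (c *\<^sub>R z))"
    then have "integrable lborel (\<lambda>z. (1 / \<bar>c\<bar> ^ DIM('v)) *\<^sub>R \<bar>c\<bar> ^ DIM('v) *\<^sub>R f (c *\<^sub>R z))"
      by (rule integrable_scaleR_right)
    then show "integrable lborel (\<lambda>z. f (c *\<^sub>R z))" using assms(1) by simp
  qed simp
  finally show "integrable lborel (\<lambda>z. f (c *\<^sub>R z)) \<longleftrightarrow> integrable lborel f" by simp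
  have "(LINT z|lborel. f z) = (LINT z|density (distr lborel borel (\<lambda>x::'v. c *\<^sub>R x)) (\<lambda>_. ennreal (\<bar>c\<bar> ^ DIM('v))). f z)"
    by (subst eq) simp
  also have "\<dots> = (LINT z|lborel. \<bar>c\<bar> ^ DIM('v) *\<^sub>R f (c *\<^sub>R z))"
    by (subst integral_density) (simp_all add: integral_distr)
  finally show "(LINT z|lborel. f z) = \<bar>c\<bar> ^ DIM('v) *\<^sub>R (LINT z|lborel. f (c *\<^sub>R z))"
    by simp
qed

lemma max_0_mult: "(k::real) \<ge> 0 \<Longrightarrow> max 0 (k * x) = k * max 0 x"
  by (cases "k = 0") (auto simp: max_def zero_le_mult_iff mult_le_0_iff)

lemma
  fixes \<alpha> q :: real and s :: complex
  assumes "\<alpha> > -1" "q \<ge> 0" "Re s > 0"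
  shows integrable_shifted_powr_exp: "integrable lborel (\<lambda>u. of_real (indicator {0<..} u * max 0 (u - q) powr \<alpha>) * exp (- s * of_real u))" (is ?I)
    and integral_shifted_powr_exp: "(LINT u|lborel. of_real (indicator {0<..} u * max 0 (u - q) powr \<alpha>) * exp (- s * of_real u))
      = of_real (Gamma (\<alpha> + 1)) * s powr (- of_real \<alpha> - 1) * exp (- s * of_real q)" (is ?E)
proof -
  let ?f = "\<lambda>u::real. of_real (indicator {0<..} u * max 0 (u - q) powr \<alpha>) * exp (- s * of_real u)"
  have eq: "?f (q + 1 * w) = exp (- s * of_real q) * (of_real (indicator {0<..} w * w powr \<alpha>) * exp (- s * of_real w))" for w
    using assms(2) by (auto simp: indicator_def max_def ring_distribs simp flip: exp_add)
  have "integrable lborel (\<lambda>w. ?f (q + 1 * w))"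
    unfolding eq by (intro integrable_mult_right integrable_powr_exp_complex assms)
  then show ?I by (subst (asm) lborel_integrable_real_affine_iff) auto
  have "(LINT u|lborel. ?f u) = (LINT w|lborel. ?f (q + 1 * w))"
    using lborel_integral_real_affine[of 1 ?f q] by simp
  also have "\<dots> = exp (- s * of_real q) * (of_real (Gamma (\<alpha> + 1)) * s powr (- of_real \<alpha> - 1))"
    unfolding eq integral_mult_right_zero using assms by (subst integral_powr_exp_complex) auto
  finally show ?E by simp
qed

text \<open>
  The Laplace transform turns the convolution into a product: by Fubini the integral over \<open>u\<close> can be
  done first, and it is a shifted Gamma integral.
\<close>

lemma
  fixes h :: "'v::euclidean_space \<Rightarrow> complex" and s :: complex
  assumes \<alpha>: "\<alpha> > -1" and h [measurable]: "h \<in> borel_measurable borel" and s: "Re s > 0"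
    and int: "\<And>t::real. t > 0 \<Longrightarrow> integrable lborel (\<lambda>z. norm (h z) * exp (- t * (norm z)\<^sup>2))"
  shows integrable_riesz_kernel:
      "integrable (lborel \<Otimes>\<^sub>M lborel) (\<lambda>(z, u). h z * (of_real (indicator {0<..} u * max 0 (u - (norm z)\<^sup>2) powr \<alpha>) * exp (- s * of_real u)))" (is ?A)
    and integrable_laplace_riesz_mean:
      "integrable lborel (\<lambda>u. of_real (indicator {0<..} u) * riesz_mean \<alpha> u h * exp (- s * of_real u))" (is ?B)
    and laplace_riesz_mean:
      "(LINT u|lborel. of_real (indicator {0<..} u) * riesz_mean \<alpha> u h * exp (- s * of_real u))
        = of_real (Gamma (\<alpha> + 1)) * s powr (- of_real \<alpha> - 1) * (LINT z|lborel. h z * exp (- s * of_real ((norm z)\<^sup>2)))" (is ?C)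
proof -
  define K where "K z u = complex_of_real (indicator {0<..} u * max 0 (u - (norm z)\<^sup>2) powr \<alpha>) * exp (- s * of_real u)" for z :: 'v and u
  have [measurable]: "case_prod K \<in> borel_measurable (lborel \<Otimes>\<^sub>M lborel)"
    unfolding K_def by measurable
  have KI: "integrable lborel (K z)"
    "(LINT u|lborel. K z u) = of_real (Gamma (\<alpha> + 1)) * s powr (- of_real \<alpha> - 1) * exp (- s * of_real ((norm z)\<^sup>2))" for z
    unfolding K_def
    using integrable_shifted_powr_exp[OF \<alpha> _ s, of "(norm z)\<^sup>2"] integral_shifted_powr_exp[OF \<alpha> _ s, of "(norm z)\<^sup>2"] by simp_all
  have Kn: "(LINT u|lborel. norm (K z u)) = Gamma (\<alpha> + 1) * Re s powr (- \<alpha> - 1) * exp (- Re s * (norm z)\<^sup>2)" for z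
  proof -
    have "complex_of_real (norm (K z u)) = of_real (indicator {0<..} u * max 0 (u - (norm z)\<^sup>2) powr \<alpha>) * exp (- of_real (Re s) * of_real u)" for u
      by (simp add: K_def norm_mult flip: exp_of_real)
    then have "complex_of_real (LINT u|lborel. norm (K z u)) = (LINT u|lborel. of_real (indicator {0<..} u * max 0 (u - (norm z)\<^sup>2) powr \<alpha>) * exp (- of_real (Re s) * of_real u))"
      unfolding integral_complex_of_real[symmetric] by presburger
    also have "\<dots> = of_real (Gamma (\<alpha> + 1)) * of_real (Re s) powr (- of_real \<alpha> - 1) * exp (- of_real (Re s) * of_real ((norm z)\<^sup>2))"
      using \<alpha> s by (intro integral_shifted_powr_exp) auto
    also have "\<dots> = of_real (Gamma (\<alpha> + 1) * Re s powr (- \<alpha> - 1) * exp (- Re s * (norm z)\<^sup>2))"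
      using s powr_of_real[of "Re s" "- \<alpha> - 1"] by (simp flip: exp_of_real)
    finally show ?thesis by (simp only: of_real_eq_iff)
  qed
  have P: "integrable (lborel \<Otimes>\<^sub>M lborel) (\<lambda>(z, u). h z * K z u)"
  proof (rule lborel_pair.Fubini_integrable)
    show "(\<lambda>(z, u). h z * K z u) \<in> borel_measurable (lborel \<Otimes>\<^sub>M lborel)" by measurable
    show "integrable lborel (\<lambda>z. LINT u|lborel. norm (case (z, u) of (z, u) \<Rightarrow> h z * K z u))"
      using integrable_mult_right[OF int[OF s], of "Gamma (\<alpha> + 1) * Re s powr (- \<alpha> - 1)"]
      by (simp add: norm_mult Kn mult_ac)
    show "AE z in lborel. integrable lborel (\<lambda>u. case (z, u) of (z, u) \<Rightarrow> h z * K z u)"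
      by (auto intro!: integrable_mult_right KI)
  qed
  then show ?A by (simp add: K_def)
  have sec: "(LINT z|lborel. h z * K z u) = of_real (indicator {0<..} u) * riesz_mean \<alpha> u h * exp (- s * of_real u)" for u
  proof -
    have "(LINT z|lborel. h z * K z u) = (LINT z|lborel. (of_real (indicator {0<..} u) * exp (- s * of_real u)) * (of_real (max 0 (u - (norm z)\<^sup>2) powr \<alpha>) * h z))"
      by (simp add: K_def mult_ac)
    also have "\<dots> = (of_real (indicator {0<..} u) * exp (- s * of_real u)) * riesz_mean \<alpha> u h"
      unfolding riesz_mean_def by (rule integral_mult_right_zero)
    finally show ?thesis by simp
  qed
  show ?B
    using lborel_pair.integrable_snd[OF P] by (simp add: sec)
  have "(LINT u|lborel. of_real (indicator {0<..} u) * riesz_mean \<alpha> u h * exp (- s * of_real u))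
      = (LINT z|lborel. (LINT u|lborel. h z * K z u))"
    unfolding sec[symmetric] by (rule lborel_pair.Fubini_integral[OF P])
  also have "\<dots> = (LINT z|lborel. (of_real (Gamma (\<alpha> + 1)) * s powr (- of_real \<alpha> - 1)) * (h z * exp (- s * of_real ((norm z)\<^sup>2))))"
    by (simp add: KI mult_ac)
  finally show ?C by simp
qed

text \<open>
  For \<open>\<alpha> < 0\<close> the weight is singular on a sphere.  Integrating it first over \<open>u\<close> against \<open>exp (- u)\<close>
  gives a Gaussian, so it is integrable for almost every \<open>u\<close>; all \<open>u\<close> are equivalent by scaling.
\<close>

lemma integrable_riesz_weight:
  fixes \<alpha> u :: real
  assumes \<alpha>: "\<alpha> > -1" and u: "u > 0"
  shows "integrable lborel (\<lambda>z::'v::euclidean_space. max 0 (u - (norm z)\<^sup>2) powr \<alpha>)"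
proof -
  have "integrable (lborel \<Otimes>\<^sub>M lborel) (\<lambda>(z::'v, u). 1 * (complex_of_real (indicator {0<..} u * max 0 (u - (norm z)\<^sup>2) powr \<alpha>) * exp (- 1 * of_real u)))"
    using integrable_gaussian_norm by (intro integrable_riesz_kernel[OF \<alpha>, where s=1]) auto
  then have AEI: "AE u in lborel. integrable lborel (\<lambda>z::'v. 1 * (complex_of_real (indicator {0<..} u * max 0 (u - (norm z)\<^sup>2) powr \<alpha>) * exp (- 1 * of_real u)))"
    by (rule lborel_pair.AE_integrable_snd)
  have "\<exists>w>0. integrable lborel (\<lambda>z::'v. 1 * (complex_of_real (indicator {0<..} w * max 0 (w - (norm z)\<^sup>2) powr \<alpha>) * exp (- 1 * of_real w)))"
  proof (rule ccontr)
    assume no: "\<not> (\<exists>w>0. integrable lborel (\<lambda>z::'v. 1 * (complex_of_real (indicator {0<..} w * max 0 (w - (norm z)\<^sup>2) powr \<alpha>) * exp (- 1 * of_real w))))"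
    have "AE u in lborel. \<not> (0 < u \<and> u < (1::real))"
      by (rule eventually_mono[OF AEI]) (use no in blast)
    then have "emeasure lborel {0<..<1::real} = 0"
      by (subst (asm) AE_iff_measurable[where N="{0<..<1}"]) auto
    then show False by simp
  qed
  then obtain w where w: "w > 0" "integrable lborel (\<lambda>z::'v. 1 * (complex_of_real (indicator {0<..} w * max 0 (w - (norm z)\<^sup>2) powr \<alpha>) * exp (- 1 * of_real w)))"
    by blast
  have wi: "integrable lborel (\<lambda>z::'v. max 0 (w - (norm z)\<^sup>2) powr \<alpha>)"
  proof -
    have "integrable lborel (\<lambda>z::'v. norm (1 * (complex_of_real (indicator {0<..} w * max 0 (w - (norm z)\<^sup>2) powr \<alpha>) * exp (- 1 * of_real w))))"
      using w(2) by (rule integrable_norm)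
    moreover have "norm (1 * (complex_of_real (indicator {0<..} w * max 0 (w - (norm z)\<^sup>2) powr \<alpha>) * exp (- 1 * of_real w)))
       = exp (- w) * max 0 (w - (norm z)\<^sup>2) powr \<alpha>" for z :: 'v
      using w(1) by (simp add: norm_mult)
    ultimately show ?thesis by simp
  qed
  define c where "c = sqrt (u / w)"
  have c: "c > 0" "c\<^sup>2 = u / w" using u w by (auto simp: c_def)
  have "max 0 (u - (norm (c *\<^sub>R z))\<^sup>2) powr \<alpha> = (u / w) powr \<alpha> * max 0 (w - (norm z)\<^sup>2) powr \<alpha>" for z :: 'v
  proof -
    have "max 0 (u - (norm (c *\<^sub>R z))\<^sup>2) = (u / w) * max 0 (w - (norm z)\<^sup>2)"
    proof -
      have "u - (norm (c *\<^sub>R z))\<^sup>2 = (u / w) * (w - (norm z)\<^sup>2)"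
        using w by (simp add: power_mult_distrib c(2) right_diff_distrib)
      then show ?thesis using u w by (simp only: max_0_mult divide_nonneg_nonneg less_imp_le)
    qed
    then show ?thesis by (simp only: powr_mult)
  qed
  then have "integrable lborel (\<lambda>z::'v. max 0 (u - (norm (c *\<^sub>R z))\<^sup>2) powr \<alpha>)"
    using wi by simp
  then show ?thesis
    by (subst (asm) integrable_lborel_scaleR) (use c in auto)
qed

lemma integral_truncated_powr:
  fixes a w q \<alpha> :: real
  assumes "\<alpha> > -1" "a \<le> w"
  shows "integrable lborel (\<lambda>t. indicator {a..w} t * max 0 (t - q) powr \<alpha>)"
    and "(LINT t|lborel. indicator {a..w} t * max 0 (t - q) powr \<alpha>) = (max 0 (w - q) powr (\<alpha> + 1) - max 0 (a - q) powr (\<alpha> + 1)) / (\<alpha> + 1)"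
proof -
  let ?P = "\<lambda>t. max 0 (t - q) powr (\<alpha> + 1) / (\<alpha> + 1)"
  have "((\<lambda>t. max 0 (t - q) powr \<alpha>) has_integral (?P w - ?P a)) {a..w}"
  proof (rule fundamental_theorem_of_calculus_interior_strong[of "{q}"])
    show "continuous_on {a..w} ?P"
      using assms by (intro continuous_intros continuous_on_powr') auto
    fix t assume t: "t \<in> {a<..<w} - {q}"
    show "(?P has_vector_derivative max 0 (t - q) powr \<alpha>) (at t)"
    proof (cases "t > q")
      case True
      have "((\<lambda>t. (t - q) powr (\<alpha> + 1) / (\<alpha> + 1)) has_real_derivative (t - q) powr \<alpha>) (at t)"
        using True assms by (auto intro!: derivative_eq_intros)
      then have "(?P has_real_derivative (t - q) powr \<alpha>) (at t)"
        by (rule has_field_derivative_transform_within_open[of _ _ _ "{q<..}"]) (use True in auto)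
      then show ?thesis using True by (simp add: has_real_derivative_iff_has_vector_derivative)
    next
      case False
      then have "t < q" using t by auto
      have "(?P has_real_derivative 0) (at t)"
        by (rule has_field_derivative_transform_within_open[of "\<lambda>_. 0" _ _ "{..<q}"]) (use \<open>t < q\<close> in auto)
      then show ?thesis using \<open>t < q\<close> by (simp add: has_real_derivative_iff_has_vector_derivative)
    qed
  qed (use assms in auto)
  then have "((\<lambda>t. indicator {a..w} t * max 0 (t - q) powr \<alpha>) has_integral (?P w - ?P a)) UNIV"
    by (subst (asm) has_integral_restrict_UNIV[symmetric], elim has_integral_eq[rotated]) (auto simp: indicator_def)
  then have nn: "(\<integral>\<^sup>+t. indicator {a..w} t * max 0 (t - q) powr \<alpha> \<partial>lborel) = ennreal (?P w - ?P a)"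
    by (intro nn_integral_has_integral_lborel) auto
  have pos: "0 \<le> ?P w - ?P a"
    using assms by (auto simp: divide_right_mono powr_mono2)
  show "integrable lborel (\<lambda>t. indicator {a..w} t * max 0 (t - q) powr \<alpha>)"
    using nn by (auto intro!: integrableI_nonneg)
  show "(LINT t|lborel. indicator {a..w} t * max 0 (t - q) powr \<alpha>) = (max 0 (w - q) powr (\<alpha> + 1) - max 0 (a - q) powr (\<alpha> + 1)) / (\<alpha> + 1)"
    using nn pos by (subst integral_eq_nn_integral) (auto simp: diff_divide_distrib)
qed

locale bounded_continuous_fun =
  fixes F :: "'v::euclidean_space \<Rightarrow> complex" and C :: real
  assumes cont: "continuous_on UNIV F" and bound: "\<And>z. norm (F z) \<le> C"
begin

lemma F_measurable [measurable]: "F \<in> borel_measurable borel"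
  using cont by (rule borel_measurable_continuous_onI)

lemma C_nonneg: "C \<ge> 0"
  using bound[of 0] norm_ge_zero order_trans by blast

lemma integrable_riesz:
  assumes "\<beta> > -1" "u > 0"
  shows "integrable lborel (\<lambda>z. of_real (max 0 (u - (norm z)\<^sup>2) powr \<beta>) * F z)"
proof (rule Bochner_Integration.integrable_bound)
  show "integrable lborel (\<lambda>z::'v. C * max 0 (u - (norm z)\<^sup>2) powr \<beta>)"
    using integrable_riesz_weight[where 'v='v, OF assms] by simp
  show "AE z in lborel. norm (of_real (max 0 (u - (norm z)\<^sup>2) powr \<beta>) * F z) \<le> norm (C * max 0 (u - (norm z)\<^sup>2) powr \<beta>)"
    using bound C_nonneg by (intro AE_I2) (auto simp: norm_mult mult.commute[of _ "norm (F _)"] intro: mult_right_mono)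
qed measurable

lemma riesz_mean_scale:
  assumes "w > 0"
  shows "riesz_mean \<beta> w F = of_real (sqrt w ^ DIM('v) * w powr \<beta>) * (LINT z|lborel. of_real (max 0 (1 - (norm z)\<^sup>2) powr \<beta>) * F (sqrt w *\<^sub>R z))"
proof -
  have *: "max 0 (w - (norm (sqrt w *\<^sub>R z))\<^sup>2) powr \<beta> = w powr \<beta> * max 0 (1 - (norm z)\<^sup>2) powr \<beta>" for z :: 'v
  proof -
    have "w - (norm (sqrt w *\<^sub>R z))\<^sup>2 = w * (1 - (norm z)\<^sup>2)"
      using assms by (simp add: power_mult_distrib algebra_simps)
    then have "max 0 (w - (norm (sqrt w *\<^sub>R z))\<^sup>2) = w * max 0 (1 - (norm z)\<^sup>2)"
      using assms by (simp only: max_0_mult less_imp_le)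
    then show ?thesis using assms by (simp add: powr_mult)
  qed
  show ?thesis
    unfolding riesz_mean_def
    using assms by (subst integral_lborel_scaleR[where c="sqrt w"]) (simp_all add: * scaleR_conv_of_real mult_ac del: norm_scaleR)
qed

text \<open>
  The scaling \<open>z \<mapsto> sqrt w *\<^sub>R z\<close> moves the parameter from the singular weight into the continuous
  function \<open>F\<close>, after which dominated convergence applies.
\<close>

lemma continuous_on_riesz_mean:
  assumes "\<beta> > -1"
  shows "continuous_on {0<..} (\<lambda>w. riesz_mean \<beta> w F)"
proof -
  have "continuous_on {0<..} (\<lambda>w. LINT z|lborel. of_real (max 0 (1 - (norm z)\<^sup>2) powr \<beta>) * F (sqrt w *\<^sub>R z))"
  proof (rule continuous_on_sequentiallyI)
    fix u :: "nat \<Rightarrow> real" and a assume u: "\<forall>n. u n \<in> {0<..}" "u \<longlonglongrightarrow> a"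
    show "(\<lambda>n. LINT z|lborel. of_real (max 0 (1 - (norm z)\<^sup>2) powr \<beta>) * F (sqrt (u n) *\<^sub>R z))
        \<longlonglongrightarrow> (LINT z|lborel. of_real (max 0 (1 - (norm z)\<^sup>2) powr \<beta>) * F (sqrt a *\<^sub>R z))"
    proof (rule integral_dominated_convergence)
      show "integrable lborel (\<lambda>z::'v. C * max 0 (1 - (norm z)\<^sup>2) powr \<beta>)"
        using integrable_riesz_weight[where 'v='v, OF assms, of 1] by simp
      show "AE z in lborel. norm (of_real (max 0 (1 - (norm z)\<^sup>2) powr \<beta>) * F (sqrt (u n) *\<^sub>R z)) \<le> C * max 0 (1 - (norm z)\<^sup>2) powr \<beta>" for n
        using bound by (intro AE_I2) (auto simp: norm_mult mult.commute[of _ "norm (F _)"] intro: mult_right_mono)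
      show "AE z in lborel. (\<lambda>n. of_real (max 0 (1 - (norm z)\<^sup>2) powr \<beta>) * F (sqrt (u n) *\<^sub>R z))
          \<longlonglongrightarrow> of_real (max 0 (1 - (norm z)\<^sup>2) powr \<beta>) * F (sqrt a *\<^sub>R z)"
      proof (intro AE_I2 tendsto_mult_left)
        fix z :: 'v
        have "isCont F (sqrt a *\<^sub>R z)" using cont by (simp add: continuous_on_eq_continuous_at)
        moreover have "(\<lambda>n. sqrt (u n) *\<^sub>R z) \<longlonglongrightarrow> sqrt a *\<^sub>R z"
          by (intro tendsto_intros u(2))
        ultimately show "(\<lambda>n. F (sqrt (u n) *\<^sub>R z)) \<longlonglongrightarrow> F (sqrt a *\<^sub>R z)"
          by (rule isCont_tendsto_compose)
      qed
    qed measurable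
  qed
  then have "continuous_on {0<..} (\<lambda>w. of_real (sqrt w ^ DIM('v) * w powr \<beta>) * (LINT z|lborel. of_real (max 0 (1 - (norm z)\<^sup>2) powr \<beta>) * F (sqrt w *\<^sub>R z)))"
    by (intro continuous_intros) auto
  then show ?thesis
    by (rule continuous_on_cong[THEN iffD1, rotated -1]) (auto simp: riesz_mean_scale)
qed

text \<open>
  For \<open>\<alpha> < 0\<close> the derivative cannot be taken under the integral sign.  The integrated identity
  follows from Fubini, and the fundamental theorem of calculus then gives the derivative at every
  point because the mean of order \<open>\<alpha>\<close> is continuous.
\<close>

lemma riesz_mean_increment:
  assumes \<alpha>: "\<alpha> > -1" and a: "0 < a" "a \<le> w"
  shows "riesz_mean (\<alpha> + 1) w F - riesz_mean (\<alpha> + 1) a F = (\<alpha> + 1) * integral {a..w} (\<lambda>t. riesz_mean \<alpha> t F)"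
proof -
  let ?k = "\<lambda>z t. indicator {a..w} t * max 0 (t - (norm (z::'v))\<^sup>2) powr \<alpha> :: real"
  let ?d = "\<lambda>z::'v. (max 0 (w - (norm z)\<^sup>2) powr (\<alpha> + 1) - max 0 (a - (norm z)\<^sup>2) powr (\<alpha> + 1)) / (\<alpha> + 1)"
  have w: "w > 0" using a by simp
  have wt: "integrable lborel ?d"
    using integrable_riesz_weight[of "\<alpha> + 1"] \<alpha> a w by (intro integrable_divide Bochner_Integration.integrable_diff) auto
  have P: "integrable (lborel \<Otimes>\<^sub>M lborel) (\<lambda>(z, t). F z * of_real (?k z t))"
  proof (rule lborel_pair.Fubini_integrable)
    have "(LINT t|lborel. norm (F z * of_real (?k z t))) = norm (F z) * ?d z" for z
    proof -
      have "(LINT t|lborel. norm (F z * of_real (?k z t))) = (LINT t|lborel. norm (F z) * ?k z t)"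
        by (intro Bochner_Integration.integral_cong) (auto simp: norm_mult abs_mult)
      then show ?thesis using integral_truncated_powr(2)[OF \<alpha> a(2)] by simp
    qed
    moreover have "integrable lborel (\<lambda>z. norm (F z) * ?d z)"
    proof (rule Bochner_Integration.integrable_bound)
      show "integrable lborel (\<lambda>z. C * ?d z)" using wt by (rule integrable_mult_right)
      show "AE z in lborel. norm (norm (F z) * ?d z) \<le> norm (C * ?d z)"
        using bound C_nonneg unfolding real_norm_def abs_mult by (intro AE_I2 mult_right_mono) auto
    qed measurable
    ultimately show "integrable lborel (\<lambda>z. LINT t|lborel. norm (case (z, t) of (z, t) \<Rightarrow> F z * of_real (?k z t)))"
      by simp
    show "AE z in lborel. integrable lborel (\<lambda>t. case (z, t) of (z, t) \<Rightarrow> F z * of_real (?k z t))"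
      unfolding prod.case
      by (rule AE_I2, rule integrable_mult_right, rule integrable_of_real, rule integral_truncated_powr(1)[OF \<alpha> a(2)])
  qed measurable
  have "continuous_on {a..w} (\<lambda>t. riesz_mean \<alpha> t F)"
    by (rule continuous_on_subset[OF continuous_on_riesz_mean[OF \<alpha>]]) (use a in auto)
  then have "set_integrable lborel {a..w} (\<lambda>t. riesz_mean \<alpha> t F)"
    by (rule borel_integrable_atLeastAtMost')
  then have "integral {a..w} (\<lambda>t. riesz_mean \<alpha> t F) = (LINT t:{a..w}|lborel. riesz_mean \<alpha> t F)"
    by (simp add: set_borel_integral_eq_integral)
  also have "\<dots> = (LINT t|lborel. (LINT z|lborel. F z * of_real (?k z t)))"
  proof -
    have "(LINT z|lborel. F z * of_real (?k z t)) = indicator {a..w} t *\<^sub>R riesz_mean \<alpha> t F" for t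
    proof -
      have "(LINT z|lborel. F z * of_real (?k z t)) = (LINT z|lborel. of_real (indicator {a..w} t) * (of_real (max 0 (t - (norm z)\<^sup>2) powr \<alpha>) * F z))"
        by (simp add: mult_ac)
      then show ?thesis by (simp add: riesz_mean_def scaleR_conv_of_real)
    qed
    then show ?thesis by (simp add: set_lebesgue_integral_def)
  qed
  also have "\<dots> = (LINT z|lborel. (LINT t|lborel. F z * of_real (?k z t)))"
    by (rule lborel_pair.Fubini_integral[OF P])
  also have "\<dots> = (LINT z|lborel. F z * of_real (?d z))"
    using integral_truncated_powr(2)[OF \<alpha> a(2)] by (simp only: integral_mult_right_zero integral_complex_of_real)
  also have "\<dots> = (LINT z|lborel. (of_real (max 0 (w - (norm z)\<^sup>2) powr (\<alpha> + 1)) * F z - of_real (max 0 (a - (norm z)\<^sup>2) powr (\<alpha> + 1)) * F z) / of_real (\<alpha> + 1))"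
    by (intro Bochner_Integration.integral_cong) (simp_all add: diff_divide_distrib right_diff_distrib mult.commute)
  also have "\<dots> = (riesz_mean (\<alpha> + 1) w F - riesz_mean (\<alpha> + 1) a F) / of_real (\<alpha> + 1)"
    using integrable_riesz[of "\<alpha> + 1"] \<alpha> a w unfolding riesz_mean_def by (simp add: Bochner_Integration.integral_diff)
  finally have "integral {a..w} (\<lambda>t. riesz_mean \<alpha> t F) = (riesz_mean (\<alpha> + 1) w F - riesz_mean (\<alpha> + 1) a F) / of_real (\<alpha> + 1)" .
  moreover have "complex_of_real (\<alpha> + 1) \<noteq> 0" using \<alpha> unfolding of_real_eq_0_iff by simp
  ultimately show ?thesis by simp
qed

lemma has_vector_derivative_riesz_mean:
  assumes \<alpha>: "\<alpha> > -1" and u: "u > 0"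
  shows "((\<lambda>w. riesz_mean (\<alpha> + 1) w F) has_vector_derivative of_real (\<alpha> + 1) * riesz_mean \<alpha> u F) (at u)"
proof -
  let ?a = "u / 2" and ?b = "2 * u"
  have "continuous_on {?a..?b} (\<lambda>t. riesz_mean \<alpha> t F)"
    by (rule continuous_on_subset[OF continuous_on_riesz_mean[OF \<alpha>]]) (use u in auto)
  then have "((\<lambda>w. integral {?a..w} (\<lambda>t. riesz_mean \<alpha> t F)) has_vector_derivative riesz_mean \<alpha> u F) (at u within {?a..?b})"
    by (rule integral_has_vector_derivative) (use u in auto)
  then have "((\<lambda>w. integral {?a..w} (\<lambda>t. riesz_mean \<alpha> t F)) has_vector_derivative riesz_mean \<alpha> u F) (at u)"
    using u by (subst (asm) at_within_interior) auto
  then have "((\<lambda>w. riesz_mean (\<alpha> + 1) ?a F + (\<alpha> + 1) * integral {?a..w} (\<lambda>t. riesz_mean \<alpha> t F)) has_vector_derivative 0 + (\<alpha> + 1) * riesz_mean \<alpha> u F) (at u)"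
    by (intro derivative_intros)
  then have "((\<lambda>w. riesz_mean (\<alpha> + 1) ?a F + (\<alpha> + 1) * integral {?a..w} (\<lambda>t. riesz_mean \<alpha> t F)) has_vector_derivative (\<alpha> + 1) * riesz_mean \<alpha> u F) (at u)"
    by simp
  then show ?thesis
  proof (rule has_vector_derivative_transform_within_open[of _ _ _ "{?a<..}"])
    fix w assume "w \<in> {?a<..}"
    then show "riesz_mean (\<alpha> + 1) ?a F + (\<alpha> + 1) * integral {?a..w} (\<lambda>t. riesz_mean \<alpha> t F) = riesz_mean (\<alpha> + 1) w F"
      using riesz_mean_increment[OF \<alpha>, of ?a w] u by (simp add: diff_eq_eq add.commute)
  qed (use u in auto)
qed

text \<open>
  With \<open>E\<close> the mean of order \<open>\<alpha> + 1\<close>, the derivative of \<open>u powr (- \<alpha> - 1) * E u\<close> is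
  \<open>u powr (- \<alpha> - 2) * (u * E' u - (\<alpha> + 1) * E u)\<close>.  This identity is the reason why the derivative
  of the Bochner-Riesz mean has order \<open>\<alpha>\<close> and carries the factor \<open>(norm z)\<^sup>2\<close>.
\<close>

lemma riesz_mean_quadratic:
  assumes \<alpha>: "\<alpha> > -1" and u: "u > 0"
  shows "riesz_mean \<alpha> u (\<lambda>z. (norm z)\<^sup>2 * F z) = u * riesz_mean \<alpha> u F - riesz_mean (\<alpha> + 1) u F"
proof -
  have "of_real (max 0 (u - (norm z)\<^sup>2) powr \<alpha>) * ((norm z)\<^sup>2 * F z)
     = u * (of_real (max 0 (u - (norm z)\<^sup>2) powr \<alpha>) * F z) - of_real (max 0 (u - (norm z)\<^sup>2) powr (\<alpha> + 1)) * F z" for z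
  proof (cases "u > (norm z)\<^sup>2")
    case True
    then have "max 0 (u - (norm z)\<^sup>2) powr (\<alpha> + 1) = max 0 (u - (norm z)\<^sup>2) powr \<alpha> * (u - (norm z)\<^sup>2)"
      by (simp add: powr_add)
    then have *: "complex_of_real (max 0 (u - (norm z)\<^sup>2) powr (\<alpha> + 1)) = of_real (max 0 (u - (norm z)\<^sup>2) powr \<alpha>) * (of_real u - (of_real (norm z))\<^sup>2)"
      by simp
    show ?thesis unfolding * by (simp add: algebra_simps)
  qed simp
  then show ?thesis
    using integrable_riesz[OF \<alpha> u] integrable_riesz[of "\<alpha> + 1", OF _ u] \<alpha>
    unfolding riesz_mean_def by simp
qed

lemma bochner_riesz_weight:
  assumes "R > 0"
  shows "max 0 (1 - (norm (z::'v))\<^sup>2 / R\<^sup>2) powr \<beta> = R powr (- 2 * \<beta>) * max 0 (R\<^sup>2 - (norm z)\<^sup>2) powr \<beta>"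
proof -
  have "1 - (norm z)\<^sup>2 / R\<^sup>2 = (1 / R\<^sup>2) * (R\<^sup>2 - (norm z)\<^sup>2)"
    using assms by (simp add: diff_divide_distrib)
  then have "max 0 (1 - (norm z)\<^sup>2 / R\<^sup>2) = (1 / R\<^sup>2) * max 0 (R\<^sup>2 - (norm z)\<^sup>2)"
    using max_0_mult[of "1 / R\<^sup>2"] by simp
  then have "max 0 (1 - (norm z)\<^sup>2 / R\<^sup>2) powr \<beta> = (1 / R\<^sup>2) powr \<beta> * max 0 (R\<^sup>2 - (norm z)\<^sup>2) powr \<beta>"
    by (simp only: powr_mult)
  also have "1 / R\<^sup>2 = R powr - 2" using assms by (simp add: powr_minus powr_realpow divide_inverse flip: powr_numeral)
  also have "(R powr - 2) powr \<beta> = R powr (- 2 * \<beta>)" by (simp add: powr_powr)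
  finally show ?thesis .
qed

lemma bochner_riesz_eq:
  assumes "R > 0"
  shows "bochner_riesz \<beta> R F = of_real (R powr (- 2 * \<beta>)) * riesz_mean \<beta> (R\<^sup>2) F"
  unfolding bochner_riesz_def riesz_mean_def by (simp add: bochner_riesz_weight[OF assms] mult.assoc)

lemma integrable_bochner_riesz:
  assumes "\<beta> > -1" "R > 0"
  shows "integrable lborel (\<lambda>z. of_real (max 0 (1 - (norm z)\<^sup>2 / R\<^sup>2) powr \<beta>) * F z)"
  using integrable_mult_right[OF integrable_riesz[OF assms(1), of "R\<^sup>2"], of "of_real (R powr (- 2 * \<beta>))"] assms(2)
  by (simp add: bochner_riesz_weight mult.assoc)

lemma has_vector_derivative_bochner_riesz:
  assumes \<alpha>: "\<alpha> > -1" and R: "R > 0"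
  shows "((\<lambda>R. bochner_riesz (\<alpha> + 1) R F) has_vector_derivative
     of_real (2 * (\<alpha> + 1) * R powr (- 2 * \<alpha> - 3)) * riesz_mean \<alpha> (R\<^sup>2) (\<lambda>z. (norm z)\<^sup>2 * F z)) (at R)"
proof -
  have R2: "R\<^sup>2 > 0" using R by simp
  have d1: "((\<lambda>R. R\<^sup>2) has_vector_derivative 2 * R) (at R)"
    by (rule has_real_derivative_iff_has_vector_derivative[THEN iffD1]) (auto intro!: derivative_eq_intros)
  have d2: "((\<lambda>R. riesz_mean (\<alpha> + 1) (R\<^sup>2) F) has_vector_derivative (2 * R) *\<^sub>R ((\<alpha> + 1) * riesz_mean \<alpha> (R\<^sup>2) F)) (at R)"
    using vector_diff_chain_at[OF d1 has_vector_derivative_riesz_mean[OF \<alpha> R2]] by (simp add: o_def)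
  have d3: "((\<lambda>R. R powr (- 2 * (\<alpha> + 1))) has_real_derivative - 2 * (\<alpha> + 1) * R powr (- 2 * \<alpha> - 3)) (at R)"
  proof -
    have "((\<lambda>R. R powr (- 2 * (\<alpha> + 1))) has_real_derivative - 2 * (\<alpha> + 1) * R powr (- 2 * (\<alpha> + 1) - 1)) (at R)"
      using R by (intro has_real_derivative_powr)
    moreover have "- 2 * (\<alpha> + 1) - 1 = - 2 * \<alpha> - 3" by simp
    ultimately show ?thesis by (simp only:)
  qed
  have "((\<lambda>R. complex_of_real (R powr (- 2 * (\<alpha> + 1))) * riesz_mean (\<alpha> + 1) (R\<^sup>2) F) has_vector_derivative
      of_real (R powr (- 2 * (\<alpha> + 1))) * ((2 * R) *\<^sub>R ((\<alpha> + 1) * riesz_mean \<alpha> (R\<^sup>2) F))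
      + of_real (- 2 * (\<alpha> + 1) * R powr (- 2 * \<alpha> - 3)) * riesz_mean (\<alpha> + 1) (R\<^sup>2) F) (at R)"
    by (intro has_vector_derivative_mult d2 has_vector_derivative_of_real)
       (use d3 in \<open>simp add: has_real_derivative_iff_has_vector_derivative\<close>)
  also have "of_real (R powr (- 2 * (\<alpha> + 1))) * ((2 * R) *\<^sub>R ((\<alpha> + 1) * riesz_mean \<alpha> (R\<^sup>2) F))
      + of_real (- 2 * (\<alpha> + 1) * R powr (- 2 * \<alpha> - 3)) * riesz_mean (\<alpha> + 1) (R\<^sup>2) F
    = of_real (2 * (\<alpha> + 1) * R powr (- 2 * \<alpha> - 3)) * riesz_mean \<alpha> (R\<^sup>2) (\<lambda>z. (norm z)\<^sup>2 * F z)"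
  proof -
    have "R powr (- 2 * (\<alpha> + 1)) = R powr (- 2 * \<alpha> - 3) * R powr 1"
      by (subst powr_add[symmetric]) (simp add: algebra_simps)
    then have "R powr (- 2 * (\<alpha> + 1)) = R powr (- 2 * \<alpha> - 3) * R" using R by simp
    then show ?thesis
      unfolding riesz_mean_quadratic[OF \<alpha> R2]
      by (simp only:) (simp add: scaleR_conv_of_real power2_eq_square algebra_simps)
  qed
  finally show ?thesis
    by (rule has_vector_derivative_transform_within_open[of _ _ _ "{0<..}"]) (use R in \<open>auto simp: bochner_riesz_eq\<close>)
qed

end

text \<open>
  The half-line is exhausted by the compact intervals \<open>[1 / (k + 1), k + 1]\<close>, whose images under
  squaring exhaust it as well.
\<close>

lemma nn_integral_square_substitution:
  fixes f :: "real \<Rightarrow> real"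
  assumes [measurable]: "f \<in> borel_measurable borel"
  shows "(\<integral>\<^sup>+R\<in>{0<..}. ennreal (f (R\<^sup>2) * (2 * R)) \<partial>lborel) = (\<integral>\<^sup>+u\<in>{0<..}. ennreal (f u) \<partial>lborel)"
proof -
  define A where "A k = {(1 / (real k + 1))..(real k + 1)}" for k
  define B where "B k = {(1 / (real k + 1))\<^sup>2..(real k + 1)\<^sup>2}" for k
  have incA: "incseq A" unfolding A_def incseq_def by (auto simp: frac_le intro: order_trans)
  have "B i \<subseteq> B j" if "i \<le> j" for i j
  proof -
    have "(1 / (real j + 1))\<^sup>2 \<le> (1 / (real i + 1))\<^sup>2" "(real i + 1)\<^sup>2 \<le> (real j + 1)\<^sup>2"
      using that by (auto intro!: power_mono simp: frac_le)
    then show ?thesis by (auto simp: B_def)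
  qed
  then have incB: "incseq B" by (auto simp: incseq_def)
  have bound: "\<exists>k. 1 / (real k + 1) \<le> x \<and> x \<le> real k + 1" if x: "x > 0" for x :: real
  proof -
    obtain k where k: "real k > max x (1 / x)" using reals_Archimedean2 by blast
    then have "1 / x \<le> real k + 1" by simp
    then have "1 / (real k + 1) \<le> x" using x by (simp add: field_simps)
    then show ?thesis using k by (intro exI[of _ k]) auto
  qed
  have unA: "(\<Union>k. A k) = {0<..}"
  proof (intro equalityI subsetI)
    fix x :: real assume "x \<in> {0<..}"
    then show "x \<in> (\<Union>k. A k)" using bound[of x] by (auto simp: A_def)
  next
    fix x assume "x \<in> (\<Union>k. A k)"
    then obtain k where k: "1 / (real k + 1) \<le> x" by (auto simp: A_def)
    have "0 < 1 / (real k + 1)" by simp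
    then show "x \<in> {0<..}" using k by (metis greaterThan_iff less_le_trans)
  qed
  have unB: "(\<Union>k. B k) = {0<..}"
  proof (intro equalityI subsetI)
    fix x :: real assume x: "x \<in> {0<..}"
    then obtain k where k: "1 / (real k + 1) \<le> sqrt x" "sqrt x \<le> real k + 1" using bound[of "sqrt x"] by auto
    have "(1 / (real k + 1))\<^sup>2 \<le> (sqrt x)\<^sup>2" "(sqrt x)\<^sup>2 \<le> (real k + 1)\<^sup>2"
      using k x by (intro power_mono; simp)+
    then show "x \<in> (\<Union>k. B k)" using x by (auto simp: B_def)
  next
    fix x assume "x \<in> (\<Union>k. B k)"
    then obtain k where k: "(1 / (real k + 1))\<^sup>2 \<le> x" by (auto simp: B_def)
    have "0 < (1 / (real k + 1))\<^sup>2" by simp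
    then show "x \<in> {0<..}" using k by (metis greaterThan_iff less_le_trans)
  qed
  have [measurable]: "A k \<in> sets borel" "B k \<in> sets borel" for k by (auto simp: A_def B_def)
  have lim: "(\<integral>\<^sup>+x\<in>{0<..}. g x \<partial>lborel) = (SUP k. \<integral>\<^sup>+x. g x * indicator (X k) x \<partial>lborel)"
    if [measurable]: "g \<in> borel_measurable borel" "\<And>k. X k \<in> sets borel" and X: "incseq X" "(\<Union>k. X k) = {0<..}"
    for g :: "real \<Rightarrow> ennreal" and X :: "nat \<Rightarrow> real set"
  proof -
    have "(\<integral>\<^sup>+x\<in>{0<..}. g x \<partial>lborel) = (\<integral>\<^sup>+x. (SUP k. g x * indicator (X k) x) \<partial>lborel)"
    proof (intro nn_integral_cong)
      fix x
      show "g x * indicator {0<..} x = (SUP k. g x * indicator (X k) x)"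
      proof (cases "x \<in> {0<..}")
        case True
        then obtain j where j: "x \<in> X j" using X by blast
        have "(SUP k. g x * indicator (X k) x) = g x"
        proof (rule SUP_eqI)
          show "g x * indicator (X k) x \<le> g x" for k by (auto split: split_indicator)
          fix y assume "\<And>k. k \<in> UNIV \<Longrightarrow> g x * indicator (X k) x \<le> y"
          from this[of j] j show "g x \<le> y" by simp
        qed
        then show ?thesis using True by simp
      next
        case False
        then have "x \<notin> X k" for k using X by blast
        then show ?thesis using False by simp
      qed
    qed
    also have "\<dots> = (SUP k. \<integral>\<^sup>+x. g x * indicator (X k) x \<partial>lborel)"
    proof (rule nn_integral_monotone_convergence_SUP)
      show "incseq (\<lambda>k x. g x * indicator (X k) x)"
        using X(1) by (auto simp: incseq_def le_fun_def split: split_indicator)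
    qed measurable
    finally show ?thesis .
  qed
  have step: "(\<integral>\<^sup>+x. f x * indicator (B k) x \<partial>lborel) = (\<integral>\<^sup>+x. f (x\<^sup>2) * (2 * x) * indicator (A k) x \<partial>lborel)" for k
    unfolding A_def B_def
  proof (rule nn_integral_substitution)
    show "1 / (real k + 1) \<le> real k + 1"
      by (rule order_trans[of _ 1]) auto
    show "set_borel_measurable borel {(1 / (real k + 1))\<^sup>2..(real k + 1)\<^sup>2} f"
      unfolding set_borel_measurable_def by measurable
    fix x assume "x \<in> {1 / (real k + 1)..real k + 1}"
    moreover have "0 \<le> 1 / (real k + 1)" by simp
    ultimately have "0 \<le> x" by (meson atLeastAtMost_iff order_trans)
    then show "0 \<le> 2 * x" by simp
  qed (auto intro!: derivative_eq_intros continuous_intros)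
  have "(\<integral>\<^sup>+R\<in>{0<..}. ennreal (f (R\<^sup>2) * (2 * R)) \<partial>lborel) = (SUP k. \<integral>\<^sup>+x. ennreal (f (x\<^sup>2) * (2 * x)) * indicator (A k) x \<partial>lborel)"
    by (rule lim) (use incA unA in auto)
  also have "\<dots> = (SUP k. \<integral>\<^sup>+x. ennreal (f x) * indicator (B k) x \<partial>lborel)"
    using step by (simp add: nn_integral_set_ennreal)
  also have "\<dots> = (\<integral>\<^sup>+u\<in>{0<..}. ennreal (f u) \<partial>lborel)"
    by (rule lim[symmetric]) (use incB unB in auto)
  finally show ?thesis .
qed

section \<open>Bessel's inequality for the Laplace transform\<close>

lemma sum_inverse_quadratic_bound:
  obtains T :: real where "T > 0"
    "\<And>k S. finite S \<Longrightarrow> (\<Sum>l\<in>S. 1 / (4 + (real k - real l)\<^sup>2)) \<le> T"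
proof -
  define g where "g m = 2 * inverse ((real m + 1)\<^sup>2)" for m :: nat
  have sum_g: "summable g"
    unfolding g_def using inverse_power_summable[of 2, where 'a=real] summable_iff_shift[of "\<lambda>m. inverse ((real m)\<^sup>2)" 1]
    by (intro summable_mult) (simp add: add.commute)
  have g_nonneg: "g m \<ge> 0" for m by (simp add: g_def)
  have le: "1 / (4 + (real m)\<^sup>2) \<le> g m" for m
  proof -
    have "(real m + 1)\<^sup>2 \<le> 2 * (4 + (real m)\<^sup>2)"
      using zero_le_power2[of "real m - 1"] by (simp add: power2_eq_square algebra_simps)
    then show ?thesis
      unfolding g_def by (simp add: field_simps add_pos_nonneg)
  qed
  have side: "(\<Sum>l\<in>S. g (\<phi> l)) \<le> suminf g" if "finite S" "inj_on \<phi> S" for S and \<phi> :: "nat \<Rightarrow> nat"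
  proof -
    have "(\<Sum>l\<in>S. g (\<phi> l)) = (\<Sum>m\<in>\<phi> ` S. g m)" using that by (simp add: sum.reindex)
    also have "\<dots> \<le> suminf g" using that g_nonneg by (intro sum_le_suminf sum_g) auto
    finally show ?thesis .
  qed
  have "(\<Sum>l\<in>S. 1 / (4 + (real k - real l)\<^sup>2)) \<le> 2 * suminf g" if S: "finite S" for k S
  proof -
    let ?A = "{l \<in> S. l \<le> k}" and ?B = "{l \<in> S. \<not> l \<le> k}"
    have "(\<Sum>l\<in>S. 1 / (4 + (real k - real l)\<^sup>2)) = (\<Sum>l\<in>?A. 1 / (4 + (real k - real l)\<^sup>2)) + (\<Sum>l\<in>?B. 1 / (4 + (real k - real l)\<^sup>2))"
      using S by (subst sum.union_disjoint[symmetric]) (auto intro!: sum.cong)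
    also have "\<dots> \<le> (\<Sum>l\<in>?A. g (k - l)) + (\<Sum>l\<in>?B. g (l - k))"
    proof (intro add_mono sum_mono)
      fix l assume "l \<in> ?A"
      then show "1 / (4 + (real k - real l)\<^sup>2) \<le> g (k - l)" using le[of "k - l"] by (simp add: of_nat_diff)
    next
      fix l assume "l \<in> ?B"
      then show "1 / (4 + (real k - real l)\<^sup>2) \<le> g (l - k)"
        using le[of "l - k"] by (simp add: of_nat_diff power2_commute)
    qed
    also have "\<dots> \<le> suminf g + suminf g"
      using S by (intro add_mono side) (auto simp: inj_on_def)
    finally show ?thesis by simp
  qed
  moreover have "2 * suminf g > 0"
    using suminf_pos[OF sum_g] by (simp add: g_def)
  ultimately show ?thesis using that by blast
qed

text \<open>
  Points on the line \<open>Re s = \<sigma>\<close> whose imaginary parts are spaced by \<open>\<sigma>\<close> itself, so that the estimates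
  for different \<open>\<sigma>\<close> differ by a scaling only.
\<close>

definition freq :: "real \<Rightarrow> nat \<Rightarrow> complex" where
  "freq \<sigma> k = of_real \<sigma> * (1 + \<i> * of_nat k)"

lemma Re_freq [simp]: "Re (freq \<sigma> k) = \<sigma>" and Im_freq [simp]: "Im (freq \<sigma> k) = \<sigma> * k"
  by (simp_all add: freq_def)

text \<open>
  The inner product of two of the exponentials for the weight \<open>u powr s\<close> is a Gamma integral; as
  \<open>s + 1 \<ge> 2\<close> it decays at least quadratically in \<open>k - l\<close>.
\<close>

lemma gram_bound:
  fixes s \<sigma> :: real
  assumes s: "s \<ge> 1" and \<sigma>: "\<sigma> > 0"
  shows "norm (LINT u|lborel. of_real (indicator {0<..} u * u powr s) * exp (- (freq \<sigma> k + cnj (freq \<sigma> l)) * of_real u))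
    \<le> Gamma (s + 1) * \<sigma> powr (- s - 1) * (1 / (4 + (real k - real l)\<^sup>2))"
proof -
  let ?z = "freq \<sigma> k + cnj (freq \<sigma> l)"
  define m where "m = sqrt (4 + (real k - real l)\<^sup>2)"
  have m: "m \<ge> 1" "m\<^sup>2 = 4 + (real k - real l)\<^sup>2"
    unfolding m_def by (auto intro!: real_le_rsqrt simp: add_increasing2)
  have nz: "norm ?z = \<sigma> * m"
  proof -
    have "norm ?z = sqrt ((2 * \<sigma>)\<^sup>2 + (\<sigma> * (real k - real l))\<^sup>2)"
      by (simp add: cmod_def algebra_simps)
    also have "(2 * \<sigma>)\<^sup>2 + (\<sigma> * (real k - real l))\<^sup>2 = \<sigma>\<^sup>2 * (4 + (real k - real l)\<^sup>2)"
      by (simp only: power_mult_distrib distrib_left) simp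
    also have "sqrt \<dots> = \<sigma> * m" using \<sigma> by (simp add: real_sqrt_mult m_def)
    finally show ?thesis .
  qed
  have "(LINT u|lborel. of_real (indicator {0<..} u * u powr s) * exp (- ?z * of_real u))
      = of_real (Gamma (s + 1)) * ?z powr (- of_real s - 1)"
    using s \<sigma> by (intro integral_powr_exp_complex) auto
  also have "norm \<dots> = Gamma (s + 1) * (\<sigma> * m) powr (- s - 1)"
    using s norm_powr_real_powr'[of "- of_real s - 1" ?z] nz by (simp add: norm_mult Gamma_real_nonneg)
  also have "\<dots> = Gamma (s + 1) * \<sigma> powr (- s - 1) * m powr (- s - 1)"
    by (simp add: powr_mult)
  also have "\<dots> \<le> Gamma (s + 1) * \<sigma> powr (- s - 1) * m powr (- 2)"
    using m s by (intro mult_left_mono powr_mono) (auto simp: Gamma_real_nonneg)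
  also have "m powr (- 2) = 1 / m\<^sup>2" using m by (simp add: powr_minus divide_inverse)
  finally show ?thesis using m(2) by simp
qed

lemma ennreal_lincomb:
  "a \<ge> 0 \<Longrightarrow> b \<ge> 0 \<Longrightarrow> x \<ge> 0 \<Longrightarrow> y \<ge> 0 \<Longrightarrow> ennreal (a * x + b * y) = ennreal a * ennreal x + ennreal b * ennreal y"
  by (simp add: ennreal_mult)

text \<open>
  Let \<open>a k\<close> be the Laplace transform at \<open>freq \<sigma> k\<close> and \<open>\<psi>\<close> the combination of the exponentials with
  coefficients \<open>cnj (a k)\<close>.  Then \<open>A = \<Sum>k. \<bar>a k\<bar>\<^sup>2\<close> is the integral of \<open>H * \<psi>\<close>, while the weighted
  square integral of \<open>\<psi>\<close> is at most a multiple \<open>t * A\<close> because the Gram matrix has bounded row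
  sums.
\<close>

lemma laplace_bessel:
  fixes s :: real
  assumes s: "s \<ge> 1"
  obtains K where "K > 0"
    "\<And>(H::real \<Rightarrow> complex) \<sigma> S. H \<in> borel_measurable borel \<Longrightarrow> \<sigma> > 0 \<Longrightarrow> finite S \<Longrightarrow>
      (\<And>k. k \<in> S \<Longrightarrow> integrable lborel (\<lambda>u. of_real (indicator {0<..} u) * H u * exp (- freq \<sigma> k * of_real u))) \<Longrightarrow>
      ennreal (\<Sum>k\<in>S. (norm (LINT u|lborel. of_real (indicator {0<..} u) * H u * exp (- freq \<sigma> k * of_real u)))\<^sup>2)
      \<le> ennreal (K * \<sigma> powr (- s - 1)) * (\<integral>\<^sup>+u\<in>{0<..}. ennreal (u powr (- s) * (norm (H u))\<^sup>2) \<partial>lborel)"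
proof -
  obtain T :: real where T: "T > 0" "\<And>k S. finite S \<Longrightarrow> (\<Sum>l\<in>S. 1 / (4 + (real k - real l)\<^sup>2)) \<le> T"
    using sum_inverse_quadratic_bound by blast
  have G: "Gamma (s + 1) > 0" using s by simp
  show ?thesis
  proof
    show "Gamma (s + 1) * T > 0" using G T by simp
    fix H :: "real \<Rightarrow> complex" and \<sigma> :: real and S :: "nat set"
    assume H [measurable]: "H \<in> borel_measurable borel" and \<sigma>: "\<sigma> > 0" and S: "finite S"
      and int: "\<And>k. k \<in> S \<Longrightarrow> integrable lborel (\<lambda>u. of_real (indicator {0<..} u) * H u * exp (- freq \<sigma> k * of_real u))"
    define a where "a k = (LINT u|lborel. of_real (indicator {0<..} u) * H u * exp (- freq \<sigma> k * of_real u))" for k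
    define A where "A = (\<Sum>k\<in>S. (norm (a k))\<^sup>2)"
    define \<psi> where "\<psi> u = (\<Sum>k\<in>S. cnj (a k) * exp (- freq \<sigma> k * of_real u))" for u :: real
    define t where "t = Gamma (s + 1) * T * \<sigma> powr (- s - 1)"
    define b where "b k l = 1 / (4 + (real k - real l)\<^sup>2)" for k l :: nat
    define X where "X = (\<integral>\<^sup>+u\<in>{0<..}. ennreal (u powr (- s) * (norm (H u))\<^sup>2) \<partial>lborel)"
    have t: "t > 0" using G T \<sigma> by (simp add: t_def)
    have A: "A \<ge> 0" by (simp add: A_def sum_nonneg)
    have [measurable]: "\<psi> \<in> borel_measurable borel" unfolding \<psi>_def by measurable
    have int\<psi>: "integrable lborel (\<lambda>u. of_real (indicator {0<..} u) * H u * \<psi> u)"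
      and A_eq: "(LINT u|lborel. of_real (indicator {0<..} u) * H u * \<psi> u) = of_real A"
    proof -
      have eq: "of_real (indicator {0<..} u) * H u * \<psi> u = (\<Sum>k\<in>S. cnj (a k) * (of_real (indicator {0<..} u) * H u * exp (- freq \<sigma> k * of_real u)))" for u
        by (simp add: \<psi>_def sum_distrib_left mult_ac)
      show "integrable lborel (\<lambda>u. of_real (indicator {0<..} u) * H u * \<psi> u)"
        unfolding eq by (intro Bochner_Integration.integrable_sum integrable_mult_right int)
      have "(LINT u|lborel. of_real (indicator {0<..} u) * H u * \<psi> u) = (\<Sum>k\<in>S. cnj (a k) * a k)"
        unfolding eq a_def
        by (subst Bochner_Integration.integral_sum)
           (rule integrable_mult_right[OF int], assumption, simp only: integral_mult_right_zero)
      also have "\<dots> = of_real A"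
        by (simp only: A_def of_real_sum complex_norm_square mult.commute[of "cnj _"])
      finally show "(LINT u|lborel. of_real (indicator {0<..} u) * H u * \<psi> u) = of_real A" .
    qed
    have Y: "(\<integral>\<^sup>+u. ennreal (indicator {0<..} u * u powr s * (norm (\<psi> u))\<^sup>2) \<partial>lborel) \<le> ennreal (t * A)"
    proof -
      let ?e = "\<lambda>k l u. of_real (indicator {0<..} u * u powr s) * exp (- (freq \<sigma> k + cnj (freq \<sigma> l)) * of_real u)"
      have eq: "complex_of_real (indicator {0<..} u * u powr s * (norm (\<psi> u))\<^sup>2) = (\<Sum>k\<in>S. \<Sum>l\<in>S. (cnj (a k) * a l) * ?e k l u)" for u
      proof -
        have "complex_of_real (indicator {0<..} u * u powr s * (norm (\<psi> u))\<^sup>2) = of_real (indicator {0<..} u * u powr s) * (\<psi> u * cnj (\<psi> u))"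
          by (simp only: complex_norm_square of_real_mult)
        also have "\<psi> u * cnj (\<psi> u) = (\<Sum>k\<in>S. \<Sum>l\<in>S. (cnj (a k) * exp (- freq \<sigma> k * of_real u)) * (a l * exp (- cnj (freq \<sigma> l) * of_real u)))"
          unfolding \<psi>_def by (simp add: sum_product exp_cnj)
        also have "\<dots> = (\<Sum>k\<in>S. \<Sum>l\<in>S. (cnj (a k) * a l) * exp (- (freq \<sigma> k + cnj (freq \<sigma> l)) * of_real u))"
          by (intro sum.cong refl) (simp add: ring_distribs exp_diff exp_minus exp_add field_simps)
        finally show ?thesis by (simp add: sum_distrib_left mult_ac)
      qed
      have ei: "integrable lborel (?e k l)" for k l
        using s \<sigma> by (intro integrable_powr_exp_complex) auto
      have I: "integrable lborel (\<lambda>u. complex_of_real (indicator {0<..} u * u powr s * (norm (\<psi> u))\<^sup>2))"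
        unfolding eq by (intro Bochner_Integration.integrable_sum integrable_mult_right ei)
      then have I': "integrable lborel (\<lambda>u. indicator {0<..} u * u powr s * (norm (\<psi> u))\<^sup>2)"
        using integrable_Re[OF I] by simp
      have "complex_of_real (LINT u|lborel. indicator {0<..} u * u powr s * (norm (\<psi> u))\<^sup>2)
         = (\<Sum>k\<in>S. \<Sum>l\<in>S. (cnj (a k) * a l) * (LINT u|lborel. ?e k l u))"
        unfolding integral_complex_of_real[symmetric] eq
        using ei by (simp add: Bochner_Integration.integral_sum Bochner_Integration.integrable_sum)
      also have "norm \<dots> \<le> (\<Sum>k\<in>S. \<Sum>l\<in>S. (norm (a k) * norm (a l)) * (Gamma (s + 1) * \<sigma> powr (- s - 1) * b k l))"
        unfolding b_def
        by (intro order_trans[OF norm_sum] sum_mono order_trans[OF norm_sum])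
           (simp only: norm_mult complex_mod_cnj, intro mult_left_mono gram_bound[OF s \<sigma>], simp)
      also have "\<dots> \<le> (\<Sum>k\<in>S. \<Sum>l\<in>S. ((norm (a k))\<^sup>2 + (norm (a l))\<^sup>2) / 2 * (Gamma (s + 1) * \<sigma> powr (- s - 1) * b k l))"
      proof (intro sum_mono mult_right_mono)
        fix k l
        show "norm (a k) * norm (a l) \<le> ((norm (a k))\<^sup>2 + (norm (a l))\<^sup>2) / 2"
          using zero_le_power2[of "norm (a k) - norm (a l)"] by (simp add: power2_diff)
        show "0 \<le> Gamma (s + 1) * \<sigma> powr (- s - 1) * b k l"
          using G by (simp add: b_def)
      qed
      also have "\<dots> = (\<Sum>k\<in>S. \<Sum>l\<in>S. (norm (a k))\<^sup>2 / 2 * (Gamma (s + 1) * \<sigma> powr (- s - 1) * b k l))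
          + (\<Sum>k\<in>S. \<Sum>l\<in>S. (norm (a l))\<^sup>2 / 2 * (Gamma (s + 1) * \<sigma> powr (- s - 1) * b k l))"
        by (simp add: add_divide_distrib distrib_right sum.distrib)
      also have "(\<Sum>k\<in>S. \<Sum>l\<in>S. (norm (a l))\<^sup>2 / 2 * (Gamma (s + 1) * \<sigma> powr (- s - 1) * b k l))
          = (\<Sum>k\<in>S. \<Sum>l\<in>S. (norm (a k))\<^sup>2 / 2 * (Gamma (s + 1) * \<sigma> powr (- s - 1) * b k l))"
        by (subst sum.swap) (simp add: b_def power2_commute)
      also have "(\<Sum>k\<in>S. \<Sum>l\<in>S. (norm (a k))\<^sup>2 / 2 * (Gamma (s + 1) * \<sigma> powr (- s - 1) * b k l))
          + (\<Sum>k\<in>S. \<Sum>l\<in>S. (norm (a k))\<^sup>2 / 2 * (Gamma (s + 1) * \<sigma> powr (- s - 1) * b k l))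
         = (\<Sum>k\<in>S. (norm (a k))\<^sup>2 * (Gamma (s + 1) * \<sigma> powr (- s - 1)) * (\<Sum>l\<in>S. b k l))"
        by (simp add: sum_distrib_left flip: sum.distrib) (simp only: mult_ac)
      also have "\<dots> \<le> (\<Sum>k\<in>S. (norm (a k))\<^sup>2 * (Gamma (s + 1) * \<sigma> powr (- s - 1)) * T)"
        using T(2)[OF S] G unfolding b_def by (intro sum_mono mult_left_mono) auto
      also have "\<dots> = t * A"
        by (simp add: A_def t_def sum_distrib_left mult_ac)
      finally have le: "\<bar>LINT u|lborel. indicator {0<..} u * u powr s * (norm (\<psi> u))\<^sup>2\<bar> \<le> t * A"
        by (simp only: norm_of_real)
      have "(\<integral>\<^sup>+u. ennreal (indicator {0<..} u * u powr s * (norm (\<psi> u))\<^sup>2) \<partial>lborel)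
         = ennreal (LINT u|lborel. indicator {0<..} u * u powr s * (norm (\<psi> u))\<^sup>2)"
        by (rule nn_integral_eq_integral[OF I']) auto
      also have "\<dots> \<le> ennreal (t * A)" using le by (intro ennreal_leI) simp
      finally show ?thesis .
    qed
    \<comment> \<open>The arithmetic-geometric mean inequality with parameter \<open>t\<close> replaces Cauchy-Schwarz: it leaves
      \<open>A / 2\<close> on the right, which is absorbed since \<open>A\<close> is finite.\<close>
    have "ennreal A = ennreal (norm (LINT u|lborel. of_real (indicator {0<..} u) * H u * \<psi> u))"
      using A unfolding A_eq by simp
    also have "\<dots> \<le> (\<integral>\<^sup>+u. norm (of_real (indicator {0<..} u) * H u * \<psi> u) \<partial>lborel)"
      by (rule integral_norm_bound_ennreal[OF int\<psi>])
    also have "\<dots> \<le> (\<integral>\<^sup>+u. ennreal (t / 2) * (ennreal (u powr (- s) * (norm (H u))\<^sup>2) * indicator {0<..} u)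
         + ennreal (1 / (2 * t)) * ennreal (indicator {0<..} u * u powr s * (norm (\<psi> u))\<^sup>2) \<partial>lborel)"
    proof (rule nn_integral_mono)
      fix u :: real
      show "ennreal (norm (of_real (indicator {0<..} u) * H u * \<psi> u))
        \<le> ennreal (t / 2) * (ennreal (u powr (- s) * (norm (H u))\<^sup>2) * indicator {0<..} u)
         + ennreal (1 / (2 * t)) * ennreal (indicator {0<..} u * u powr s * (norm (\<psi> u))\<^sup>2)"
      proof (cases "u > 0")
        case True
        define p where "p = u powr s"
        have p: "p > 0" using True by (simp add: p_def)
        have "2 * (norm (H u) * norm (\<psi> u)) * (t * p) \<le> (t * norm (H u))\<^sup>2 + (p * norm (\<psi> u))\<^sup>2"
          using zero_le_power2[of "t * norm (H u) - p * norm (\<psi> u)"] by (simp add: power2_diff mult_ac)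
        then have "norm (H u) * norm (\<psi> u) \<le> ((t * norm (H u))\<^sup>2 + (p * norm (\<psi> u))\<^sup>2) / (2 * (t * p))"
          using p t by (simp add: field_simps)
        also have "\<dots> = t / 2 * (inverse p * (norm (H u))\<^sup>2) + 1 / (2 * t) * (p * (norm (\<psi> u))\<^sup>2)"
          using p t by (simp add: field_simps power2_eq_square)
        finally have "norm (H u) * norm (\<psi> u) \<le> t / 2 * (u powr (- s) * (norm (H u))\<^sup>2) + 1 / (2 * t) * (u powr s * (norm (\<psi> u))\<^sup>2)"
          by (simp add: p_def powr_minus)
        then have "ennreal (norm (H u) * norm (\<psi> u)) \<le> ennreal (t / 2 * (u powr (- s) * (norm (H u))\<^sup>2) + 1 / (2 * t) * (u powr s * (norm (\<psi> u))\<^sup>2))"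
          by (rule ennreal_leI)
        also have "ennreal (t / 2 * (u powr (- s) * (norm (H u))\<^sup>2) + 1 / (2 * t) * (u powr s * (norm (\<psi> u))\<^sup>2))
           = ennreal (t / 2) * ennreal (u powr (- s) * (norm (H u))\<^sup>2) + ennreal (1 / (2 * t)) * ennreal (u powr s * (norm (\<psi> u))\<^sup>2)"
          by (rule ennreal_lincomb) (use t in auto)
        finally show ?thesis using True by (simp add: norm_mult)
      qed simp
    qed
    also have "\<dots> = ennreal (t / 2) * X + ennreal (1 / (2 * t)) * (\<integral>\<^sup>+u. ennreal (indicator {0<..} u * u powr s * (norm (\<psi> u))\<^sup>2) \<partial>lborel)"
      unfolding X_def by (subst nn_integral_add) (simp_all add: nn_integral_cmult)
    also have "\<dots> \<le> ennreal (t / 2) * X + ennreal (1 / (2 * t)) * ennreal (t * A)"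
      by (intro add_left_mono mult_left_mono Y) auto
    also have "ennreal (1 / (2 * t)) * ennreal (t * A) = ennreal (A / 2)"
      using t by (simp flip: ennreal_mult')
    finally have main: "ennreal A \<le> ennreal (t / 2) * X + ennreal (A / 2)" .
    have "ennreal A \<le> ennreal t * X"
    proof (cases X)
      case (real x)
      then have "ennreal A \<le> ennreal (t / 2 * x + A / 2)"
        using main t A by (simp flip: ennreal_mult ennreal_plus)
      then have "A \<le> t / 2 * x + A / 2" using real t A by (subst (asm) ennreal_le_iff) auto
      then have "A \<le> t * x" by simp
      then show ?thesis using real t by (simp flip: ennreal_mult)
    next
      case top
      then show ?thesis using t by (simp add: ennreal_mult_top)
    qed
    then show "ennreal (\<Sum>k\<in>S. (norm (LINT u|lborel. of_real (indicator {0<..} u) * H u * exp (- freq \<sigma> k * of_real u)))\<^sup>2)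
      \<le> ennreal (Gamma (s + 1) * T * \<sigma> powr (- s - 1)) * (\<integral>\<^sup>+u\<in>{0<..}. ennreal (u powr (- s) * (norm (H u))\<^sup>2) \<partial>lborel)"
      unfolding A_def a_def X_def t_def .
  qed
qed

lemma (in bounded_continuous_fun) integrable_quadratic_gaussian:
  assumes "t > 0"
  shows "integrable lborel (\<lambda>z. norm (of_real ((norm z)\<^sup>2) * F z) * exp (- t * (norm z)\<^sup>2))"
proof (rule Bochner_Integration.integrable_bound)
  show "integrable lborel (\<lambda>z::'v. (2 * C / t) * exp (- (t / 2) * (norm z)\<^sup>2))"
    using assms by (intro integrable_mult_right integrable_gaussian_norm) auto
  show "AE z in lborel. norm (norm (of_real ((norm z)\<^sup>2) * F z) * exp (- t * (norm z)\<^sup>2)) \<le> norm ((2 * C / t) * exp (- (t / 2) * (norm z)\<^sup>2))"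
  proof (rule AE_I2)
    fix z :: 'v
    define q where "q = (norm z)\<^sup>2"
    have q: "q \<ge> 0" by (simp add: q_def)
    have "norm (F z) * (q * exp (- t * q)) \<le> C * ((exp (t / 2 * q) / (t / 2)) * exp (- t * q))"
      using le_exp_scaled(1)[of "t / 2" q] assms q bound C_nonneg by (intro mult_mono) auto
    also have "exp (t / 2 * q) / (t / 2) * exp (- t * q) = 2 / t * exp (- (t / 2) * q)"
      by (simp add: field_simps flip: exp_add)
    finally show "norm (norm (of_real ((norm z)\<^sup>2) * F z) * exp (- t * (norm z)\<^sup>2)) \<le> norm ((2 * C / t) * exp (- (t / 2) * (norm z)\<^sup>2))"
      using C_nonneg assms q by (simp add: norm_mult abs_mult mult_ac flip: q_def)
  qed
qed measurable

text \<open>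
  The factor \<open>\<bar>s\<bar> powr (- 2 * \<alpha> - 2)\<close> is the squared modulus of the Laplace transform of the power
  \<open>\<alpha>\<close>, and \<open>\<sigma> powr (2 * \<alpha> + 4)\<close> is the reciprocal of the size of the Gram matrix for the weight with
  exponent \<open>2 * \<alpha> + 3\<close>.
\<close>

lemma riesz_square_function_lower_bound:
  fixes \<alpha> :: real
  assumes \<alpha>: "\<alpha> > -1"
  obtains \<kappa> where "\<kappa> > 0"
    "\<And>(F :: 'v::euclidean_space \<Rightarrow> complex) C \<sigma> S. bounded_continuous_fun F C \<Longrightarrow> \<sigma> > 0 \<Longrightarrow> finite S \<Longrightarrow>
      ennreal (\<kappa> * \<sigma> powr (2 * \<alpha> + 4) * (\<Sum>k\<in>S. norm (freq \<sigma> k) powr (- 2 * \<alpha> - 2)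
          * (norm (LINT z|lborel. of_real ((norm z)\<^sup>2) * F z * exp (- freq \<sigma> k * of_real ((norm z)\<^sup>2))))\<^sup>2))
      \<le> (\<integral>\<^sup>+R\<in>{0<..}. ennreal ((norm (of_real (2 * (\<alpha> + 1) * R powr (- 2 * \<alpha> - 3))
            * riesz_mean \<alpha> (R\<^sup>2) (\<lambda>z. of_real ((norm z)\<^sup>2) * F z)))\<^sup>2 * R) \<partial>lborel)"
proof -
  define s where "s = 2 * \<alpha> + 3"
  have s: "s \<ge> 1" using \<alpha> by (simp add: s_def)
  obtain K where K: "K > 0"
    "\<And>(H::real \<Rightarrow> complex) \<sigma> S. H \<in> borel_measurable borel \<Longrightarrow> \<sigma> > 0 \<Longrightarrow> finite S \<Longrightarrow>
      (\<And>k. k \<in> S \<Longrightarrow> integrable lborel (\<lambda>u. of_real (indicator {0<..} u) * H u * exp (- freq \<sigma> k * of_real u))) \<Longrightarrow>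
      ennreal (\<Sum>k\<in>S. (norm (LINT u|lborel. of_real (indicator {0<..} u) * H u * exp (- freq \<sigma> k * of_real u)))\<^sup>2)
      \<le> ennreal (K * \<sigma> powr (- s - 1)) * (\<integral>\<^sup>+u\<in>{0<..}. ennreal (u powr (- s) * (norm (H u))\<^sup>2) \<partial>lborel)"
    using laplace_bessel[OF s] by blast
  define G where "G = Gamma (\<alpha> + 1)"
  have G: "G > 0" using \<alpha> by (simp add: G_def)
  define c where "c = 2 * (\<alpha> + 1)\<^sup>2"
  have c: "c > 0" using \<alpha> by (simp add: c_def)
  show ?thesis
  proof
    show "c * G\<^sup>2 / K > 0" using K G c by simp
    fix F :: "'v::euclidean_space \<Rightarrow> complex" and C \<sigma> :: real and S :: "nat set"
    assume F: "bounded_continuous_fun F C" and \<sigma>: "\<sigma> > 0" and S: "finite S"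
    interpret bounded_continuous_fun F C by fact
    define h where "h z = of_real ((norm z)\<^sup>2) * F z" for z :: 'v
    have [measurable]: "h \<in> borel_measurable borel" unfolding h_def by measurable
    have hi: "t > 0 \<Longrightarrow> integrable lborel (\<lambda>z. norm (h z) * exp (- t * (norm z)\<^sup>2))" for t :: real
      unfolding h_def by (rule integrable_quadratic_gaussian)
    define H where "H u = riesz_mean \<alpha> u h" for u
    have [measurable]: "H \<in> borel_measurable borel"
      unfolding H_def riesz_mean_def by measurable
    define X where "X = (\<integral>\<^sup>+u\<in>{0<..}. ennreal (u powr (- s) * (norm (H u))\<^sup>2) \<partial>lborel)"
    let ?W = "\<lambda>k. LINT z|lborel. h z * exp (- freq \<sigma> k * of_real ((norm z)\<^sup>2))"
    define A where "A = (\<Sum>k\<in>S. norm (freq \<sigma> k) powr (- 2 * \<alpha> - 2) * (norm (?W k))\<^sup>2)"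
    have A: "A \<ge> 0" by (simp add: A_def sum_nonneg)
    have "ennreal (\<Sum>k\<in>S. (norm (LINT u|lborel. of_real (indicator {0<..} u) * H u * exp (- freq \<sigma> k * of_real u)))\<^sup>2)
       \<le> ennreal (K * \<sigma> powr (- s - 1)) * X"
      unfolding X_def H_def
      using \<sigma> S \<alpha> hi by (intro K(2) integrable_laplace_riesz_mean) (auto simp flip: H_def)
    also have "(\<Sum>k\<in>S. (norm (LINT u|lborel. of_real (indicator {0<..} u) * H u * exp (- freq \<sigma> k * of_real u)))\<^sup>2) = G\<^sup>2 * A"
      unfolding A_def sum_distrib_left
    proof (rule sum.cong[OF refl])
      fix k assume "k \<in> S"
      have "norm (LINT u|lborel. of_real (indicator {0<..} u) * H u * exp (- freq \<sigma> k * of_real u))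
         = norm (of_real G * freq \<sigma> k powr (- of_real \<alpha> - 1) * ?W k)"
        unfolding H_def G_def using \<sigma> \<alpha> hi by (subst laplace_riesz_mean) auto
      also have "\<dots> = G * norm (freq \<sigma> k) powr (- \<alpha> - 1) * norm (?W k)"
        using G norm_powr_real_powr'[of "- of_real \<alpha> - 1" "freq \<sigma> k"] by (simp add: norm_mult)
      finally have "(norm (LINT u|lborel. of_real (indicator {0<..} u) * H u * exp (- freq \<sigma> k * of_real u)))\<^sup>2
         = G\<^sup>2 * ((norm (freq \<sigma> k) powr (- \<alpha> - 1))\<^sup>2 * (norm (?W k))\<^sup>2)"
        by (simp add: power_mult_distrib)
      also have "(norm (freq \<sigma> k) powr (- \<alpha> - 1))\<^sup>2 = norm (freq \<sigma> k) powr (- 2 * \<alpha> - 2)"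
        by (simp add: power2_eq_square flip: powr_add)
      finally show "(norm (LINT u|lborel. of_real (indicator {0<..} u) * H u * exp (- freq \<sigma> k * of_real u)))\<^sup>2
         = G\<^sup>2 * (norm (freq \<sigma> k) powr (- 2 * \<alpha> - 2) * (norm (?W k))\<^sup>2)" .
    qed
    finally have B: "ennreal (G\<^sup>2 * A) \<le> ennreal (K * \<sigma> powr (- s - 1)) * X" .
    have I: "(\<integral>\<^sup>+R\<in>{0<..}. ennreal ((norm (of_real (2 * (\<alpha> + 1) * R powr (- 2 * \<alpha> - 3)) * H (R\<^sup>2)))\<^sup>2 * R) \<partial>lborel) = ennreal c * X"
    proof -
      define f where "f u = c * (u powr (- s) * (norm (H u))\<^sup>2)" for u
      have "(\<integral>\<^sup>+R\<in>{0<..}. ennreal ((norm (of_real (2 * (\<alpha> + 1) * R powr (- 2 * \<alpha> - 3)) * H (R\<^sup>2)))\<^sup>2 * R) \<partial>lborel)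
         = (\<integral>\<^sup>+R\<in>{0<..}. ennreal (f (R\<^sup>2) * (2 * R)) \<partial>lborel)"
      proof (intro nn_integral_cong)
        fix R :: real
        have eq: "(norm (of_real (2 * (\<alpha> + 1) * R powr (- 2 * \<alpha> - 3)) * H (R\<^sup>2)))\<^sup>2 * R = f (R\<^sup>2) * (2 * R)" if "R > 0"
        proof -
          have "(R powr (- 2 * \<alpha> - 3))\<^sup>2 = (R\<^sup>2) powr (- s)"
            using that by (simp add: s_def power2_eq_square powr_mult)
          then have "(norm (of_real (2 * (\<alpha> + 1) * R powr (- 2 * \<alpha> - 3)) * H (R\<^sup>2)))\<^sup>2 = 4 * (\<alpha> + 1)\<^sup>2 * ((R\<^sup>2) powr (- s) * (norm (H (R\<^sup>2)))\<^sup>2)"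
            by (simp only: norm_mult norm_of_real power_mult_distrib power2_abs) simp
          then show ?thesis by (simp only: f_def c_def)
        qed
        show "ennreal ((norm (of_real (2 * (\<alpha> + 1) * R powr (- 2 * \<alpha> - 3)) * H (R\<^sup>2)))\<^sup>2 * R) * indicator {0<..} R
            = ennreal (f (R\<^sup>2) * (2 * R)) * indicator {0<..} R"
          proof (cases "R > 0")
            case True
            then show ?thesis by (simp only: eq)
          qed simp
      qed
      also have "\<dots> = (\<integral>\<^sup>+u\<in>{0<..}. ennreal (f u) \<partial>lborel)"
        by (rule nn_integral_square_substitution) (simp add: f_def)
      also have "\<dots> = (\<integral>\<^sup>+u. ennreal c * (ennreal (u powr (- s) * (norm (H u))\<^sup>2) * indicator {0<..} u) \<partial>lborel)"
        using c by (simp add: f_def ennreal_mult mult.assoc)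
      also have "\<dots> = ennreal c * X"
        unfolding X_def by (rule nn_integral_cmult) measurable
      finally show ?thesis .
    qed
    have "ennreal (c * G\<^sup>2 / K * \<sigma> powr (2 * \<alpha> + 4) * A) = ennreal (c / K * \<sigma> powr (s + 1)) * ennreal (G\<^sup>2 * A)"
    proof -
      have e: "2 * \<alpha> + 4 = s + 1" by (simp add: s_def)
      show ?thesis unfolding e using c K(1) G A by (simp add: mult_ac flip: ennreal_mult)
    qed
    also have "\<dots> \<le> ennreal (c / K * \<sigma> powr (s + 1)) * (ennreal (K * \<sigma> powr (- s - 1)) * X)"
      by (intro mult_left_mono B) auto
    also have "\<dots> = ennreal ((c / K * \<sigma> powr (s + 1)) * (K * \<sigma> powr (- s - 1))) * X"
    proof -
      have P: "0 \<le> c / K * \<sigma> powr (s + 1)" "0 \<le> K * \<sigma> powr (- s - 1)" using c K(1) by simp_all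
      show ?thesis unfolding ennreal_mult[OF P] by (rule mult.assoc[symmetric])
    qed
    also have "(c / K * \<sigma> powr (s + 1)) * (K * \<sigma> powr (- s - 1)) = c * (\<sigma> powr (s + 1) * \<sigma> powr (- s - 1))"
      using K by simp
    also have "\<sigma> powr (s + 1) * \<sigma> powr (- s - 1) = 1"
      using \<sigma> by (simp flip: powr_add)
    finally show "ennreal (c * G\<^sup>2 / K * \<sigma> powr (2 * \<alpha> + 4) * (\<Sum>k\<in>S. norm (freq \<sigma> k) powr (- 2 * \<alpha> - 2)
          * (norm (LINT z|lborel. of_real ((norm z)\<^sup>2) * F z * exp (- freq \<sigma> k * of_real ((norm z)\<^sup>2))))\<^sup>2))
      \<le> (\<integral>\<^sup>+R\<in>{0<..}. ennreal ((norm (of_real (2 * (\<alpha> + 1) * R powr (- 2 * \<alpha> - 3))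
            * riesz_mean \<alpha> (R\<^sup>2) (\<lambda>z. of_real ((norm z)\<^sup>2) * F z)))\<^sup>2 * R) \<partial>lborel)"
      using I unfolding A_def H_def h_def by simp
  qed
qed

section \<open>Gaussian test functions\<close>

text \<open>
  Multiples of a fixed Gaussian by these functions are stable under partial derivatives, which is how
  Gaussians are seen to be Schwartz functions.
\<close>

inductive polynomial_fun :: "(real ^ 'n \<Rightarrow> complex) \<Rightarrow> bool" where
  const: "polynomial_fun (\<lambda>x. c)"
| coord: "polynomial_fun (\<lambda>x. of_real (x $ j))"
| add: "polynomial_fun P \<Longrightarrow> polynomial_fun Q \<Longrightarrow> polynomial_fun (\<lambda>x. P x + Q x)"
| mult: "polynomial_fun P \<Longrightarrow> polynomial_fun Q \<Longrightarrow> polynomial_fun (\<lambda>x. P x * Q x)"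

lemma polynomial_fun_has_derivative:
  fixes P :: "real ^ 'n \<Rightarrow> complex"
  assumes "polynomial_fun P"
  shows "\<exists>D. (\<forall>x. (P has_derivative D x) (at x)) \<and> (\<forall>j. polynomial_fun (\<lambda>x. D x (axis j 1)))"
  using assms
proof induction
  case (const c)
  show ?case by (intro exI[of _ "\<lambda>x h. 0"]) (auto intro: polynomial_fun.const)
next
  case (coord i)
  have "((\<lambda>x. complex_of_real (x $ i)) has_derivative (\<lambda>h. of_real (h $ i))) (at x)" for x :: "real ^ 'n"
    by (intro derivative_intros) (rule bounded_linear_imp_has_derivative, rule bounded_linear_vec_nth)
  then show ?case by (intro exI[of _ "\<lambda>x h. of_real (h $ i)"]) (auto intro: polynomial_fun.const)
next
  case (add P Q)
  then obtain D E where "\<And>x. (P has_derivative D x) (at x)" "\<And>j. polynomial_fun (\<lambda>x. D x (axis j 1))"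
    "\<And>x. (Q has_derivative E x) (at x)" "\<And>j. polynomial_fun (\<lambda>x. E x (axis j 1))" by blast
  then show ?case
    by (intro exI[of _ "\<lambda>x h. D x h + E x h"]) (auto intro: polynomial_fun.add has_derivative_add)
next
  case (mult P Q)
  then obtain D E where *: "\<And>x. (P has_derivative D x) (at x)" "\<And>j. polynomial_fun (\<lambda>x. D x (axis j 1))"
    "\<And>x. (Q has_derivative E x) (at x)" "\<And>j. polynomial_fun (\<lambda>x. E x (axis j 1))" by blast
  have "((\<lambda>x. P x * Q x) has_derivative (\<lambda>h. P x * E x h + D x h * Q x)) (at x)" for x
    using has_derivative_mult[OF *(1) *(3), of x] .
  then show ?case
    using * mult.hyps
    by (intro exI[of _ "\<lambda>x h. P x * E x h + D x h * Q x"]) (auto intro!: polynomial_fun.add polynomial_fun.mult)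
qed

lemma polynomial_fun_bound:
  fixes P :: "real ^ 'n \<Rightarrow> complex"
  assumes "polynomial_fun P"
  shows "\<exists>C m. C \<ge> 0 \<and> (\<forall>x. norm (P x) \<le> C * (1 + norm x) ^ m)"
  using assms
proof induction
  case (const c)
  show ?case by (intro exI[of _ "norm c"] exI[of _ 0]) auto
next
  case (coord i)
  have "norm (complex_of_real (x $ i)) \<le> 1 * (1 + norm x) ^ 1" for x :: "real ^ 'n"
    using component_le_norm_cart[of x i] by simp
  then show ?case by (intro exI[of _ 1] exI[of _ 1]) auto
next
  case (add P Q)
  then obtain C m D k where *: "C \<ge> 0" "\<And>x. norm (P x) \<le> C * (1 + norm x) ^ m" "D \<ge> 0" "\<And>x. norm (Q x) \<le> D * (1 + norm x) ^ k"
    by blast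
  have "norm (P x + Q x) \<le> (C + D) * (1 + norm x) ^ (m + k)" for x
  proof -
    have "norm (P x + Q x) \<le> C * (1 + norm x) ^ m + D * (1 + norm x) ^ k"
      using norm_triangle_ineq[of "P x" "Q x"] *(2)[of x] *(4)[of x] by linarith
    also have "\<dots> \<le> C * (1 + norm x) ^ (m + k) + D * (1 + norm x) ^ (m + k)"
      using * by (intro add_mono mult_left_mono power_increasing) auto
    finally show ?thesis by (simp add: distrib_right)
  qed
  then show ?case using * by (intro exI[of _ "C + D"] exI[of _ "m + k"]) auto
next
  case (mult P Q)
  then obtain C m D k where *: "C \<ge> 0" "\<And>x. norm (P x) \<le> C * (1 + norm x) ^ m" "D \<ge> 0" "\<And>x. norm (Q x) \<le> D * (1 + norm x) ^ k"
    by blast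
  have "norm (P x * Q x) \<le> (C * D) * (1 + norm x) ^ (m + k)" for x
  proof -
    have "norm (P x * Q x) \<le> (C * (1 + norm x) ^ m) * (D * (1 + norm x) ^ k)"
      unfolding norm_mult using * by (intro mult_mono) auto
    then show ?thesis by (simp add: power_add mult_ac)
  qed
  then show ?case using * by (intro exI[of _ "C * D"] exI[of _ "m + k"]) auto
qed

lemma power_times_gaussian_bounded:
  fixes \<beta> r :: real
  assumes "\<beta> > 0" "r \<ge> 0"
  shows "(1 + r) ^ N * exp (- \<beta> * r\<^sup>2) \<le> fact N * exp (1 + 1 / (4 * \<beta>))"
proof -
  have "(1 + r) ^ N /\<^sub>R fact N \<le> exp (1 + r)"
    using assms sum_le_suminf[OF summable_exp_generic[of "1 + r"], of "{N}"] by (simp add: exp_def)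
  then have 1: "(1 + r) ^ N \<le> fact N * exp (1 + r)" by (simp add: field_simps)
  have "4 * \<beta> * r \<le> 4 * \<beta> * (\<beta> * r\<^sup>2) + 1"
    using zero_le_power2[of "2 * \<beta> * r - 1"] by (simp add: power2_eq_square algebra_simps)
  then have 2: "r \<le> \<beta> * r\<^sup>2 + 1 / (4 * \<beta>)" using assms by (simp add: field_simps)
  have "(1 + r) ^ N * exp (- \<beta> * r\<^sup>2) \<le> fact N * exp (1 + r) * exp (- \<beta> * r\<^sup>2)"
    using 1 by (intro mult_right_mono) auto
  also have "\<dots> = fact N * exp (1 + r - \<beta> * r\<^sup>2)" by (simp add: mult.assoc flip: exp_add)
  also have "\<dots> \<le> fact N * exp (1 + 1 / (4 * \<beta>))" using 2 by (intro mult_left_mono) auto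
  finally show ?thesis .
qed

text \<open>
  A Gaussian of complex width \<open>b\<close>, modulated to frequency \<open>v\<close>: a wave packet if \<open>b\<close> is real, and a
  chirp if \<open>b\<close> is not real.
\<close>

definition gabor :: "complex \<Rightarrow> real ^ 'n \<Rightarrow> real ^ 'n \<Rightarrow> complex" where
  "gabor b v x = exp (- b * (pi * (norm x)\<^sup>2)) * cis (2 * pi * (v \<bullet> x))"

lemma norm_gabor: "norm (gabor b v x) = exp (- (pi * Re b) * (norm x)\<^sup>2)"
  by (simp add: gabor_def norm_mult mult_ac)

lemma has_derivative_gabor:
  "(gabor b v has_derivative (\<lambda>h. (of_real (2 * pi) * (\<i> * of_real (v \<bullet> h) - b * of_real (x \<bullet> h))) * gabor b v x)) (at x)"
proof -
  have eq: "gabor b v = (\<lambda>x. exp (of_real (2 * pi) * \<i> * of_real (v \<bullet> x) - b * of_real pi * of_real (x \<bullet> x)))"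
    by (rule ext) (simp add: gabor_def cis_conv_exp power2_norm_eq_inner mult_ac flip: exp_add)
  have d: "((\<lambda>x. of_real (2 * pi) * \<i> * of_real (v \<bullet> x) - b * of_real pi * of_real (x \<bullet> x)) has_derivative
      (\<lambda>h. of_real (2 * pi) * \<i> * of_real (v \<bullet> h) - b * of_real pi * of_real (x \<bullet> h + h \<bullet> x))) (at x)"
    by (intro derivative_intros)
  have e: "(exp has_derivative (\<lambda>y. exp w * y)) (at w)" for w :: complex
    using DERIV_exp[of w] by (simp add: has_field_derivative_def)
  show ?thesis
    unfolding eq
    by (rule has_derivative_eq_rhs[OF has_derivative_compose[OF d e]]) (auto simp: fun_eq_iff inner_commute algebra_simps)
qed

lemma schwartz_gabor:
  assumes b: "Re b > 0"
  shows "schwartz (gabor b (v :: real ^ 'n))"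
proof -
  have iter: "\<exists>P. polynomial_fun P \<and> iter_partial js (gabor b v) = (\<lambda>x. P x * gabor b v x)" for js
  proof (induction js)
    case Nil
    show ?case by (intro exI[of _ "\<lambda>x. 1"]) (auto intro: polynomial_fun.const)
  next
    case (Cons j js)
    then obtain P where P: "polynomial_fun P" "iter_partial js (gabor b v) = (\<lambda>x. P x * gabor b v x)" by blast
    obtain D where D: "\<And>x. (P has_derivative D x) (at x)" "\<And>j. polynomial_fun (\<lambda>x. D x (axis j 1))"
      using polynomial_fun_has_derivative[OF P(1)] by blast
    have "frechet_derivative (\<lambda>x. P x * gabor b v x) (at x) =
       (\<lambda>h. P x * ((of_real (2 * pi) * (\<i> * of_real (v \<bullet> h) - b * of_real (x \<bullet> h))) * gabor b v x) + D x h * gabor b v x)" for x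
      by (rule frechet_derivative_at[symmetric], rule has_derivative_mult[OF D(1) has_derivative_gabor])
    then have "iter_partial (j # js) (gabor b v) =
       (\<lambda>x. (P x * (of_real (2 * pi) * (\<i> * of_real (v $ j)) + (- of_real (2 * pi) * b) * of_real (x $ j)) + D x (axis j 1)) * gabor b v x)"
      using P(2) by (auto simp: inner_axis algebra_simps)
    moreover have "polynomial_fun (\<lambda>x. of_real (2 * pi) * (\<i> * of_real (v $ j)) + (- of_real (2 * pi) * b) * of_real (x $ j))"
      by (intro polynomial_fun.intros)
    then have "polynomial_fun (\<lambda>x. P x * (of_real (2 * pi) * (\<i> * of_real (v $ j)) + (- of_real (2 * pi) * b) * of_real (x $ j)) + D x (axis j 1))"
      by (rule polynomial_fun.add[OF polynomial_fun.mult[OF P(1)] D(2)])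
    ultimately show ?case by blast
  qed
  show ?thesis
    unfolding schwartz_def
  proof (intro allI conjI)
    fix js :: "'n list"
    obtain P where P: "polynomial_fun P" "iter_partial js (gabor b v) = (\<lambda>x. P x * gabor b v x)"
      using iter by blast
    obtain D where D: "\<And>x. (P has_derivative D x) (at x)"
      using polynomial_fun_has_derivative[OF P(1)] by blast
    show "iter_partial js (gabor b v) differentiable at x" for x
      unfolding P(2) differentiable_def using has_derivative_mult[OF D has_derivative_gabor] by blast
    fix k :: nat
    obtain C m where C: "C \<ge> 0" "\<And>x. norm (P x) \<le> C * (1 + norm x) ^ m"
      using polynomial_fun_bound[OF P(1)] by blast
    have "norm x ^ k * norm (iter_partial js (gabor b v) x) \<le> C * (fact (k + m) * exp (1 + 1 / (4 * (pi * Re b))))" for x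
    proof -
      have "norm x ^ k * norm (iter_partial js (gabor b v) x) = norm x ^ k * norm (P x) * exp (- (pi * Re b) * (norm x)\<^sup>2)"
        by (simp add: P(2) norm_mult norm_gabor)
      also have "\<dots> \<le> (1 + norm x) ^ k * (C * (1 + norm x) ^ m) * exp (- (pi * Re b) * (norm x)\<^sup>2)"
        using C by (intro mult_right_mono mult_mono power_mono) auto
      also have "\<dots> = C * ((1 + norm x) ^ (k + m) * exp (- (pi * Re b) * (norm x)\<^sup>2))"
        by (simp add: power_add mult_ac)
      also have "\<dots> \<le> C * (fact (k + m) * exp (1 + 1 / (4 * (pi * Re b))))"
        using b C by (intro mult_left_mono power_times_gaussian_bounded) auto
      finally show ?thesis .
    qed
    then show "\<exists>C. \<forall>x. norm x ^ k * norm (iter_partial js (gabor b v) x) \<le> C" by blast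
  qed
qed

lemma fourier_gabor:
  fixes b :: complex
  assumes b: "Re b > 0"
  shows "fourier (gabor b (v :: real ^ 'n)) \<xi> = exp (- (pi * (norm (\<xi> - v))\<^sup>2) / b) / csqrt b ^ CARD('n)"
proof -
  have "gabor b v x * cis (- 2 * pi * (x \<bullet> \<xi>))
     = exp (2 * pi * ((0 :: complex) * of_real ((0 :: real ^ 'n) \<bullet> x) + \<i> * ((v - \<xi>) \<bullet> x))) * exp (- b * (pi * (norm x)\<^sup>2))" for x
    by (simp add: gabor_def cis_conv_exp inner_diff_left inner_commute algebra_simps flip: exp_add)
  then have "fourier (gabor b v) \<xi> = (LINT x|lborel. exp (2 * pi * ((0 :: complex) * of_real ((0 :: real ^ 'n) \<bullet> x) + \<i> * ((v - \<xi>) \<bullet> x))) * exp (- b * (pi * (norm x)\<^sup>2)))"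
    unfolding fourier_def by presburger
  also have "\<dots> = exp (- (pi * (norm (\<xi> - v))\<^sup>2) / b) / csqrt b ^ CARD('n)"
    by (subst integral_gaussian[OF b]) (simp add: norm_minus_commute)
  finally show ?thesis .
qed

lemma epowr_ennreal: "r \<ge> 0 \<Longrightarrow> epowr (ennreal r) a = ennreal (r powr a)"
  by (simp add: epowr_def)

lemma epowr_mono:
  assumes "a \<ge> 0" "s \<le> t"
  shows "epowr s a \<le> epowr t a"
proof (cases "t = \<infinity>")
  case False
  then have "s \<noteq> \<infinity>" using assms by (auto simp: top_unique)
  then show ?thesis
    using False assms by (auto simp: epowr_def intro!: ennreal_leI powr_mono2 enn2real_mono simp: less_top)
qed (simp add: epowr_def)

lemma Lp_norm_gabor_le:
  fixes v :: "real ^ 'n"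
  assumes b: "Re b > 0" and p: "p \<ge> 1"
  shows "Lp_norm p (\<lambda>x. ennreal (norm (gabor b v x))) \<le> ennreal (Re b powr (- (real CARD('n) / 2 * enn2real (1 / p))))"
proof (cases p)
  case top
  have "(\<lambda>x. gabor b v x) \<in> borel_measurable borel"
    by (intro borel_measurable_continuous_onI continuous_at_imp_continuous_on ballI)
       (use has_derivative_gabor has_derivative_continuous in blast)
  then have "esssup lborel (\<lambda>x. ennreal (norm (gabor b v x))) \<le> 1"
    using b by (intro esssup_I) (auto simp: norm_gabor)
  then show ?thesis using top b by (simp add: Lp_norm_def)
next
  case (real q)
  have q: "q \<ge> 1" using p real by simp
  have ip: "enn2real (1 / p) = 1 / q"
    using q real by (simp add: divide_ennreal flip: ennreal_1)
  have pq: "enn2real p = q" "p \<noteq> \<infinity>" using real q by auto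
  have "(\<integral>\<^sup>+x. epowr (ennreal (norm (gabor b v x))) q \<partial>lborel) = (\<integral>\<^sup>+x. ennreal (exp (- (q * pi * Re b) * (norm x)\<^sup>2)) \<partial>(lborel :: (real ^ 'n) measure))"
    by (simp add: epowr_ennreal norm_gabor powr_def mult_ac)
  also have "\<dots> = ennreal ((pi / (q * pi * Re b)) powr (CARD('n) / 2))"
    using b q integrable_gaussian_norm[of "q * pi * Re b", where 'a="real ^ 'n"] integral_gaussian_norm[of "q * pi * Re b", where 'a="real ^ 'n"]
    by (subst nn_integral_eq_integral) auto
  also have "pi / (q * pi * Re b) = 1 / (q * Re b)" by simp
  finally have "Lp_norm p (\<lambda>x. ennreal (norm (gabor b v x))) = ennreal (((1 / (q * Re b)) powr (CARD('n) / 2)) powr (1 / q))"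
    by (simp only: Lp_norm_def if_not_P[OF pq(2)] pq(1)) (simp add: epowr_ennreal)
  also have "\<dots> \<le> ennreal ((1 / Re b) powr (CARD('n) / 2 * (1 / q)))"
  proof (rule ennreal_leI)
    have "1 / (q * Re b) \<le> 1 / Re b" using b q by (simp add: field_simps)
    then show "((1 / (q * Re b)) powr (CARD('n) / 2)) powr (1 / q) \<le> (1 / Re b) powr (CARD('n) / 2 * (1 / q))"
      unfolding powr_powr using b q by (intro powr_mono2) auto
  qed
  also have "(1 / Re b) powr (CARD('n) / 2 * (1 / q)) = Re b powr (- (CARD('n) / 2 * (1 / q)))"
    by (simp add: powr_divide powr_minus_divide)
  finally show ?thesis unfolding ip .
qed

lemma emeasure_cball_0_pos:
  assumes "r > 0"
  shows "emeasure lborel (cball (0 :: 'a::euclidean_space) r) > 0"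
proof (rule ccontr)
  assume "\<not> ?thesis"
  then have "measure lborel (cball (0 :: 'a) r) = 0" by (simp add: measure_def)
  then show False using content_cball_pos[OF assms, of "0 :: 'a"] by simp
qed

lemma Lp_norm_ge_on_ball:
  fixes p :: ennreal and r :: real
  assumes p: "p > 0" and r: "r > 0"
  obtains c where "c > 0"
    "\<And>(u :: real ^ 'n \<Rightarrow> ennreal) m. m \<ge> 0 \<Longrightarrow> (\<And>x. norm x \<le> r \<Longrightarrow> ennreal m \<le> u x) \<Longrightarrow> ennreal (c * m) \<le> Lp_norm p u"
proof (cases p)
  case top
  show ?thesis
  proof
    show "(1::real) > 0" by simp
    fix u :: "real ^ 'n \<Rightarrow> ennreal" and m :: real
    assume m: "m \<ge> 0" and u: "\<And>x. norm x \<le> r \<Longrightarrow> ennreal m \<le> u x"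
    have "ennreal m \<le> esssup lborel u"
    proof (rule ccontr)
      assume "\<not> ennreal m \<le> esssup lborel u"
      then have less: "esssup lborel u < ennreal m" by simp
      have "AE x in lborel. u x \<le> esssup lborel u" by (rule esssup_AE)
      then have "AE x in lborel. x \<notin> cball (0 :: real ^ 'n) r"
        by (rule eventually_mono) (use u less in \<open>force simp: mem_cball\<close>)
      then have "emeasure lborel (cball (0 :: real ^ 'n) r) = 0"
        by (subst (asm) AE_iff_measurable[where N="cball 0 r"]) auto
      then show False using r emeasure_cball_0_pos[OF r, where 'a="real ^ 'n"] by simp
    qed
    then show "ennreal (1 * m) \<le> Lp_norm p u" using top by (simp add: Lp_norm_def)
  qed
next
  case (real q)
  have q: "q > 0" "enn2real p = q" "p \<noteq> \<infinity>" using real p by auto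
  define \<mu> where "\<mu> = measure lborel (cball (0 :: real ^ 'n) r)"
  have em: "emeasure lborel (cball (0 :: real ^ 'n) r) = ennreal \<mu>"
    unfolding \<mu>_def by (rule emeasure_eq_ennreal_measure) (use emeasure_lborel_cball_finite[of "0 :: real ^ 'n" r] in auto)
  have \<mu>: "\<mu> > 0"
    using emeasure_cball_0_pos[OF r, where 'a="real ^ 'n"] unfolding em by simp
  show ?thesis
  proof
    show "\<mu> powr (1 / q) > 0" using \<mu> by simp
    fix u :: "real ^ 'n \<Rightarrow> ennreal" and m :: real
    assume m: "m \<ge> 0" and u: "\<And>x. norm x \<le> r \<Longrightarrow> ennreal m \<le> u x"
    have "ennreal (m powr q * \<mu>) = (\<integral>\<^sup>+x. ennreal (m powr q) * indicator (cball (0 :: real ^ 'n) r) x \<partial>lborel)"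
      using \<mu> by (subst nn_integral_cmult_indicator) (auto simp: em ennreal_mult)
    also have "\<dots> \<le> (\<integral>\<^sup>+x. epowr (u x) q \<partial>lborel)"
    proof (rule nn_integral_mono)
      fix x :: "real ^ 'n"
      show "ennreal (m powr q) * indicator (cball 0 r) x \<le> epowr (u x) q"
      proof (cases "norm x \<le> r")
        case True
        then show ?thesis
          using epowr_mono[OF _ u, of q x] q m by (simp add: epowr_ennreal mem_cball)
      qed (simp add: mem_cball)
    qed
    finally have "epowr (ennreal (m powr q * \<mu>)) (1 / q) \<le> epowr (\<integral>\<^sup>+x. epowr (u x) q \<partial>lborel) (1 / q)"
      using q by (intro epowr_mono) auto
    moreover have "epowr (ennreal (m powr q * \<mu>)) (1 / q) = ennreal (\<mu> powr (1 / q) * m)"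
      using m \<mu> q by (subst epowr_ennreal) (auto simp: powr_mult powr_powr mult.commute)
    ultimately show "ennreal (\<mu> powr (1 / q) * m) \<le> Lp_norm p u"
      by (simp only: Lp_norm_def if_not_P[OF q(3)] q(2))
  qed
qed

section \<open>The square function of a pair of Gaussians\<close>

lemma bilinear_BR_eq_bochner_riesz:
  fixes f g :: "real ^ 'n \<Rightarrow> complex" and x :: "real ^ 'n"
  defines "F \<equiv> \<lambda>z. fourier f (fst z) * fourier g (snd z) * cis (2 * pi * (x \<bullet> (fst z + snd z)))"
  assumes F: "bounded_continuous_fun F C" and \<beta>: "\<beta> > -1" and R: "R > 0"
  shows "bilinear_BR \<beta> R f g x = bochner_riesz \<beta> R F"
proof -
  interpret bounded_continuous_fun F C by fact
  have "integrable (lborel \<Otimes>\<^sub>M lborel) (\<lambda>z. of_real (max 0 (1 - (norm z)\<^sup>2 / R\<^sup>2) powr \<beta>) * F z)"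
    unfolding lborel_prod by (rule integrable_bochner_riesz[OF \<beta> R])
  from lborel_pair.integral_fst'[OF this]
  have "bochner_riesz \<beta> R F = (LINT \<xi>|lborel. LINT \<eta>|lborel. of_real (max 0 (1 - (norm (\<xi>, \<eta>))\<^sup>2 / R\<^sup>2) powr \<beta>) * F (\<xi>, \<eta>))"
    unfolding bochner_riesz_def lborel_prod by simp
  then show ?thesis
    unfolding bilinear_BR_def F_def by (simp add: norm_Pair mult.assoc)
qed

lemma BR_square_lower_bound:
  fixes \<alpha> :: real
  assumes \<alpha>: "\<alpha> > -1"
  obtains \<kappa> where "\<kappa> > 0"
    "\<And>(f :: real ^ 'n \<Rightarrow> complex) g x F C \<sigma> S.
      F = (\<lambda>z. fourier f (fst z) * fourier g (snd z) * cis (2 * pi * (x \<bullet> (fst z + snd z)))) \<Longrightarrow>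
      bounded_continuous_fun F C \<Longrightarrow> \<sigma> > 0 \<Longrightarrow> finite S \<Longrightarrow>
      ennreal (sqrt (\<kappa> * \<sigma> powr (2 * \<alpha> + 4) * (\<Sum>k\<in>S. norm (freq \<sigma> k) powr (- 2 * \<alpha> - 2)
          * (norm (LINT z|lborel. of_real ((norm z)\<^sup>2) * F z * exp (- freq \<sigma> k * of_real ((norm z)\<^sup>2))))\<^sup>2)))
      \<le> BR_square \<alpha> f g x"
proof -
  obtain \<kappa> where \<kappa>: "\<kappa> > 0"
    "\<And>(F :: (real ^ 'n) \<times> (real ^ 'n) \<Rightarrow> complex) C \<sigma> S. bounded_continuous_fun F C \<Longrightarrow> \<sigma> > 0 \<Longrightarrow> finite S \<Longrightarrow>
      ennreal (\<kappa> * \<sigma> powr (2 * \<alpha> + 4) * (\<Sum>k\<in>S. norm (freq \<sigma> k) powr (- 2 * \<alpha> - 2)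
          * (norm (LINT z|lborel. of_real ((norm z)\<^sup>2) * F z * exp (- freq \<sigma> k * of_real ((norm z)\<^sup>2))))\<^sup>2))
      \<le> (\<integral>\<^sup>+R\<in>{0<..}. ennreal ((norm (of_real (2 * (\<alpha> + 1) * R powr (- 2 * \<alpha> - 3))
            * riesz_mean \<alpha> (R\<^sup>2) (\<lambda>z. of_real ((norm z)\<^sup>2) * F z)))\<^sup>2 * R) \<partial>lborel)"
    using riesz_square_function_lower_bound[OF \<alpha>, where 'v="(real ^ 'n) \<times> (real ^ 'n)"] by blast
  show ?thesis
  proof
    show "\<kappa> > 0" by fact
    fix f g :: "real ^ 'n \<Rightarrow> complex" and x F C \<sigma> and S :: "nat set"
    assume F_eq: "F = (\<lambda>z. fourier f (fst z) * fourier g (snd z) * cis (2 * pi * (x \<bullet> (fst z + snd z))))"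
      and F: "bounded_continuous_fun F C" and \<sigma>: "(\<sigma>::real) > 0" and S: "finite S"
    let ?A = "\<kappa> * \<sigma> powr (2 * \<alpha> + 4) * (\<Sum>k\<in>S. norm (freq \<sigma> k) powr (- 2 * \<alpha> - 2)
          * (norm (LINT z|lborel. of_real ((norm z)\<^sup>2) * F z * exp (- freq \<sigma> k * of_real ((norm z)\<^sup>2))))\<^sup>2)"
    have A: "?A \<ge> 0" using \<kappa> by (intro mult_nonneg_nonneg sum_nonneg) auto
    interpret bounded_continuous_fun F C by fact
    have vd: "vector_derivative (\<lambda>r. bilinear_BR (\<alpha> + 1) r f g x) (at R)
       = of_real (2 * (\<alpha> + 1) * R powr (- 2 * \<alpha> - 3)) * riesz_mean \<alpha> (R\<^sup>2) (\<lambda>z. of_real ((norm z)\<^sup>2) * F z)" if R: "R > 0" for R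
    proof (rule vector_derivative_at, rule has_vector_derivative_transform_within_open[of _ _ _ "{0<..}"])
      show "((\<lambda>r. bochner_riesz (\<alpha> + 1) r F) has_vector_derivative
         of_real (2 * (\<alpha> + 1) * R powr (- 2 * \<alpha> - 3)) * riesz_mean \<alpha> (R\<^sup>2) (\<lambda>z. of_real ((norm z)\<^sup>2) * F z)) (at R)"
        by (rule has_vector_derivative_bochner_riesz[OF \<alpha> R])
      fix r :: real assume "r \<in> {0<..}"
      then show "bochner_riesz (\<alpha> + 1) r F = bilinear_BR (\<alpha> + 1) r f g x"
        using bilinear_BR_eq_bochner_riesz[OF F[unfolded F_eq], of "\<alpha> + 1" r] \<alpha> by (simp add: F_eq)
    qed (use R in auto)
    have "ennreal (sqrt ?A) = epowr (ennreal ?A) (1 / 2)"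
      using A by (simp only: epowr_ennreal powr_half_sqrt)
    also have "\<dots> \<le> epowr (\<integral>\<^sup>+R\<in>{0<..}. ennreal ((norm (of_real (2 * (\<alpha> + 1) * R powr (- 2 * \<alpha> - 3))
            * riesz_mean \<alpha> (R\<^sup>2) (\<lambda>z. of_real ((norm z)\<^sup>2) * F z)))\<^sup>2 * R) \<partial>lborel) (1 / 2)"
      by (intro epowr_mono \<kappa>(2)[OF F \<sigma> S]) auto
    also have "\<dots> = BR_square \<alpha> f g x"
      unfolding BR_square_def
      by (intro arg_cong2[where f=epowr] nn_integral_cong refl) (simp add: vd split: split_indicator)
    finally show "ennreal (sqrt ?A) \<le> BR_square \<alpha> f g x" .
  qed
qed

text \<open>
  The Laplace transform of \<open>F\<close> itself is a Gaussian integral \<open>M s\<close>, and the factor \<open>(norm z)\<^sup>2\<close> is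
  produced by \<open>- M'\<close>.  The square roots in the Fourier transform of a Gaussian disappear because \<open>F\<close>
  contains it twice.
\<close>

lemma
  fixes v x :: "real ^ 'n" and b s a B Q :: complex and F :: "(real ^ 'n) \<times> (real ^ 'n) \<Rightarrow> complex"
  assumes b: "Re b > 0" and s: "Re s > 0"
  defines "F \<equiv> \<lambda>z. fourier (gabor b v) (fst z) * fourier (gabor b v) (snd z) * cis (2 * pi * (x \<bullet> (fst z + snd z)))"
    and "a \<equiv> 1 / b"
  defines "B \<equiv> a + s / pi" and "Q \<equiv> a\<^sup>2 * (norm v)\<^sup>2 - (norm x)\<^sup>2 + 2 * \<i> * a * (v \<bullet> x)"
  shows bounded_continuous_gabor: "bounded_continuous_fun F (norm a ^ CARD('n))"
    and laplace_gabor: "(LINT z|lborel. of_real ((norm z)\<^sup>2) * F z * exp (- s * of_real ((norm z)\<^sup>2)))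
      = (a / B) ^ CARD('n) * exp (2 * pi * Q / B - 2 * pi * a * (norm v)\<^sup>2) * (CARD('n) / (pi * B) + 2 * Q / B\<^sup>2)"
proof -
  have b0: "b \<noteq> 0" using b by auto
  have a: "Re a > 0" using b b0 by (simp add: a_def Re_divide cmod_power2 [symmetric] del: cmod_power2)
  have cs: "csqrt z ^ CARD('n) * csqrt z ^ CARD('n) = z ^ CARD('n)" for z
    by (metis mult.commute power2_csqrt power2_eq_square power_mult_distrib)
  have F_eq: "F z = a ^ CARD('n) * exp (- (pi * ((norm (fst z - v))\<^sup>2 + (norm (snd z - v))\<^sup>2)) * a) * cis (2 * pi * (x \<bullet> (fst z + snd z)))" for z
  proof -
    have "F z = exp (- (pi * (norm (fst z - v))\<^sup>2) / b) * exp (- (pi * (norm (snd z - v))\<^sup>2) / b) * cis (2 * pi * (x \<bullet> (fst z + snd z))) / (csqrt b ^ CARD('n) * csqrt b ^ CARD('n))"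
      unfolding F_def fourier_gabor[OF b] by (simp add: mult_ac)
    also have "\<dots> = a ^ CARD('n) * (exp (- (pi * (norm (fst z - v))\<^sup>2) / b) * exp (- (pi * (norm (snd z - v))\<^sup>2) / b)) * cis (2 * pi * (x \<bullet> (fst z + snd z)))"
      unfolding cs by (simp add: a_def power_divide)
    also have "exp (- (pi * (norm (fst z - v))\<^sup>2) / b) * exp (- (pi * (norm (snd z - v))\<^sup>2) / b)
       = exp (- (pi * ((norm (fst z - v))\<^sup>2 + (norm (snd z - v))\<^sup>2)) * a)"
      by (simp add: a_def diff_divide_distrib algebra_simps flip: exp_add)
    finally show ?thesis .
  qed
  show bc: "bounded_continuous_fun F (norm a ^ CARD('n))"
  proof
    show "continuous_on UNIV F" unfolding F_eq cis_conv_exp by (intro continuous_intros)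
    fix z
    have "norm (F z) = norm a ^ CARD('n) * exp (- (pi * ((norm (fst z - v))\<^sup>2 + (norm (snd z - v))\<^sup>2)) * Re a)"
      unfolding F_eq by (simp add: norm_mult norm_power flip: of_real_power of_real_add of_real_mult)
    also have "\<dots> \<le> norm a ^ CARD('n) * 1"
      using a by (intro mult_left_mono) auto
    finally show "norm (F z) \<le> norm a ^ CARD('n)" by simp
  qed
  interpret bounded_continuous_fun F "norm a ^ CARD('n)" by (rule bc)
  have Fi: "integrable lborel (\<lambda>z. norm (F z) * exp (- t * (norm z)\<^sup>2))" if "t > 0" for t :: real
  proof (rule Bochner_Integration.integrable_bound)
    show "integrable lborel (\<lambda>z::(real ^ 'n) \<times> (real ^ 'n). norm a ^ CARD('n) * exp (- t * (norm z)\<^sup>2))"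
      using integrable_gaussian_norm[OF that] by (intro integrable_mult_right)
    show "AE z in lborel. norm (norm (F z) * exp (- t * (norm z)\<^sup>2)) \<le> norm (norm a ^ CARD('n) * exp (- t * (norm z)\<^sup>2))"
      using bound by (intro AE_I2) (simp add: abs_mult mult_right_mono)
  qed measurable
  define Bf where "Bf l = a + l / pi" for l :: complex
  define M where "M l = (a / Bf l) ^ CARD('n) * exp (2 * pi * Q / Bf l - 2 * pi * a * (norm v)\<^sup>2)" for l
  have ReB: "Re (Bf l) > 0" if "Re l > 0" for l using a that by (simp add: Bf_def add_pos_pos)
  have M: "(LINT z|lborel. F z * exp (- l * of_real ((norm z)\<^sup>2))) = M l" if l: "Re l > 0" for l
  proof -
    have "F z * exp (- l * of_real ((norm z)\<^sup>2)) = (a ^ CARD('n) * exp (- 2 * pi * a * (norm v)\<^sup>2)) *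
       (exp (2 * pi * (a * ((v, v) \<bullet> z) + \<i> * ((x, x) \<bullet> z))) * exp (- Bf l * (pi * (norm z)\<^sup>2)))" for z
    proof -
      obtain \<xi> \<eta> where z: "z = (\<xi>, \<eta>)" by (cases z)
      have n1: "(norm (\<xi> - v))\<^sup>2 + (norm (\<eta> - v))\<^sup>2 = (norm z)\<^sup>2 - 2 * ((v, v) \<bullet> z) + 2 * (norm v)\<^sup>2"
        unfolding z power2_norm_eq_inner by (simp add: inner_diff_left inner_diff_right inner_commute)
      have "F z * exp (- l * of_real ((norm z)\<^sup>2)) = a ^ CARD('n) * exp (- (pi * ((norm z)\<^sup>2 - 2 * ((v, v) \<bullet> z) + 2 * (norm v)\<^sup>2)) * a
          + \<i> * of_real (2 * pi * ((x, x) \<bullet> z)) + (- l * of_real ((norm z)\<^sup>2)))"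
        unfolding F_eq exp_add cis_conv_exp n1[symmetric] by (simp add: z inner_add_right)
      also have "- (pi * ((norm z)\<^sup>2 - 2 * ((v, v) \<bullet> z) + 2 * (norm v)\<^sup>2)) * a
          + \<i> * of_real (2 * pi * ((x, x) \<bullet> z)) + (- l * of_real ((norm z)\<^sup>2))
         = - 2 * pi * a * (norm v)\<^sup>2 + (2 * pi * (a * ((v, v) \<bullet> z) + \<i> * ((x, x) \<bullet> z)) + - Bf l * (pi * (norm z)\<^sup>2))"
        by (simp add: Bf_def algebra_simps)
      finally show ?thesis unfolding exp_add by (simp add: mult.assoc)
    qed
    then have "(LINT z|lborel. F z * exp (- l * of_real ((norm z)\<^sup>2))) = (a ^ CARD('n) * exp (- 2 * pi * a * (norm v)\<^sup>2)) *
       (LINT z|lborel. (exp (2 * pi * (a * ((v, v) \<bullet> z) + \<i> * ((x, x) \<bullet> z))) * exp (- Bf l * (pi * (norm z)\<^sup>2))))"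
      by (simp only: integral_mult_right_zero)
    also have "\<dots> = (a ^ CARD('n) * exp (- 2 * pi * a * (norm v)\<^sup>2)) *
       (exp (pi * (a\<^sup>2 * (norm (v, v))\<^sup>2 + \<i>\<^sup>2 * (norm (x, x))\<^sup>2 + 2 * a * \<i> * ((v, v) \<bullet> (x, x))) / Bf l) / csqrt (Bf l) ^ DIM((real ^ 'n) \<times> (real ^ 'n)))"
      by (subst integral_gaussian[OF ReB[OF l]]) simp
    also have "csqrt (Bf l) ^ DIM((real ^ 'n) \<times> (real ^ 'n)) = Bf l ^ CARD('n)"
      by (simp add: power_add cs)
    also have "pi * (a\<^sup>2 * (norm (v, v))\<^sup>2 + \<i>\<^sup>2 * (norm (x, x))\<^sup>2 + 2 * a * \<i> * ((v, v) \<bullet> (x, x))) / Bf l = 2 * pi * Q / Bf l"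
      by (simp add: Q_def norm_Pair algebra_simps)
    also have "(a ^ CARD('n) * exp (- 2 * pi * a * (norm v)\<^sup>2)) * (exp (2 * pi * Q / Bf l) / Bf l ^ CARD('n)) = M l"
      by (simp add: M_def exp_diff exp_minus power_divide field_simps)
    finally show ?thesis .
  qed
  let ?W = "LINT z|lborel. of_real ((norm z)\<^sup>2) * F z * exp (- s * of_real ((norm z)\<^sup>2))"
  have "((\<lambda>l. LINT z|lborel. F z * exp (- l * of_real ((norm z)\<^sup>2))) has_field_derivative - ?W) (at s)"
    by (rule has_field_derivative_exp_integral) (use Fi s in auto)
  then have D1: "(M has_field_derivative - ?W) (at s)"
    by (rule has_field_derivative_transform_within_open[of _ _ _ "{z. Re z > 0}"])
       (use s M in \<open>auto intro: open_halfspace_Re_gt\<close>)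
  have Bs: "Bf s \<noteq> 0" using ReB[OF s] by auto
  have D2: "(M has_field_derivative - (M s * (CARD('n) / (pi * Bf s) + 2 * Q / (Bf s)\<^sup>2))) (at s)"
  proof -
    have dB: "(Bf has_field_derivative 1 / pi) (at s)"
      unfolding Bf_def by (auto intro!: derivative_eq_intros)
    have d1: "((\<lambda>l. (a / Bf l) ^ CARD('n)) has_field_derivative (of_nat CARD('n) * (a / Bf s) ^ (CARD('n) - 1)) * (- (a / pi) / (Bf s)\<^sup>2)) (at s)"
      using Bs by (auto intro!: derivative_eq_intros dB simp: power2_eq_square)
    have e1: "(of_nat CARD('n) * (a / Bf s) ^ (CARD('n) - 1)) * (- (a / pi) / (Bf s)\<^sup>2) = - ((a / Bf s) ^ CARD('n) * (CARD('n) / (pi * Bf s)))"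
    proof -
      have "(a / Bf s) ^ CARD('n) = (a / Bf s) ^ (CARD('n) - 1) * (a / Bf s)"
        by (metis zero_less_card_finite power_minus_mult)
      then show ?thesis using Bs by (simp add: field_simps power2_eq_square)
    qed
    have d2: "((\<lambda>l. exp (2 * pi * Q / Bf l - 2 * pi * a * (norm v)\<^sup>2)) has_field_derivative
        exp (2 * pi * Q / Bf s - 2 * pi * a * (norm v)\<^sup>2) * (- (2 * Q / (Bf s)\<^sup>2))) (at s)"
      using Bs by (auto intro!: derivative_eq_intros dB simp: power2_eq_square)
    show ?thesis
      unfolding M_def
      by (rule DERIV_cong[OF DERIV_mult[OF d1[unfolded e1] d2]]) (simp add: algebra_simps)
  qed
  have "?W = M s * (CARD('n) / (pi * Bf s) + 2 * Q / (Bf s)\<^sup>2)"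
    using DERIV_unique[OF D1 D2] by simp
  then show "?W = (a / B) ^ CARD('n) * exp (2 * pi * Q / B - 2 * pi * a * (norm v)\<^sup>2) * (CARD('n) / (pi * B) + 2 * Q / B\<^sup>2)"
    unfolding M_def Bf_def B_def .
qed

text \<open>
  For \<open>f = g = gabor b v\<close> this is \<open>\<integral> (norm z)\<^sup>2 * F z * exp (- s * (norm z)\<^sup>2) dz\<close>, by \<open>laplace_gabor\<close>.
\<close>

definition gabor_laplace :: "complex \<Rightarrow> real ^ 'n \<Rightarrow> real ^ 'n \<Rightarrow> complex \<Rightarrow> complex" where
  "gabor_laplace b v x s = (let a = 1 / (b :: complex); B = a + (s :: complex) / pi;
       Q = (a :: complex)\<^sup>2 * (norm v)\<^sup>2 - (norm x)\<^sup>2 + 2 * \<i> * a * (v \<bullet> x)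
     in (a / B) ^ CARD('n) * exp (2 * pi * Q / B - 2 * pi * a * (norm v)\<^sup>2) * (CARD('n) / (pi * B) + 2 * Q / B\<^sup>2))"

lemma BR_square_gabor_lower_bound:
  fixes \<alpha> :: real
  assumes \<alpha>: "\<alpha> > -1"
  obtains \<kappa> where "\<kappa> > 0"
    "\<And>b (v :: real ^ 'n) x \<sigma> S w. Re b > 0 \<Longrightarrow> \<sigma> > 0 \<Longrightarrow> finite S \<Longrightarrow>
      (\<And>k. k \<in> S \<Longrightarrow> 0 \<le> w k \<and> w k \<le> norm (gabor_laplace b v x (freq \<sigma> k))) \<Longrightarrow>
      ennreal (sqrt (\<kappa> * \<sigma> powr (2 * \<alpha> + 4) * (\<Sum>k\<in>S. norm (freq \<sigma> k) powr (- 2 * \<alpha> - 2) * (w k)\<^sup>2)))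
      \<le> BR_square \<alpha> (gabor b v) (gabor b v) x"
proof -
  obtain \<kappa> where \<kappa>: "\<kappa> > 0"
    "\<And>(f :: real ^ 'n \<Rightarrow> complex) g x F C \<sigma> S.
      F = (\<lambda>z. fourier f (fst z) * fourier g (snd z) * cis (2 * pi * (x \<bullet> (fst z + snd z)))) \<Longrightarrow>
      bounded_continuous_fun F C \<Longrightarrow> \<sigma> > 0 \<Longrightarrow> finite S \<Longrightarrow>
      ennreal (sqrt (\<kappa> * \<sigma> powr (2 * \<alpha> + 4) * (\<Sum>k\<in>S. norm (freq \<sigma> k) powr (- 2 * \<alpha> - 2)
          * (norm (LINT z|lborel. of_real ((norm z)\<^sup>2) * F z * exp (- freq \<sigma> k * of_real ((norm z)\<^sup>2))))\<^sup>2)))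
      \<le> BR_square \<alpha> f g x"
    using BR_square_lower_bound[OF \<alpha>, where 'n='n] by blast
  show ?thesis
  proof
    show "\<kappa> > 0" by fact
    fix b and v x :: "real ^ 'n" and \<sigma> :: real and S and w :: "nat \<Rightarrow> real"
    assume b: "Re b > 0" and \<sigma>: "\<sigma> > 0" and S: "finite S"
      and w: "\<And>k. k \<in> S \<Longrightarrow> 0 \<le> w k \<and> w k \<le> norm (gabor_laplace b v x (freq \<sigma> k))"
    define F where "F = (\<lambda>z. fourier (gabor b v) (fst z) * fourier (gabor b v) (snd z) * cis (2 * pi * (x \<bullet> (fst z + snd z))))"
    have W: "(LINT z|lborel. of_real ((norm z)\<^sup>2) * F z * exp (- freq \<sigma> k * of_real ((norm z)\<^sup>2))) = gabor_laplace b v x (freq \<sigma> k)" for k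
      unfolding F_def gabor_laplace_def Let_def using \<sigma> by (subst laplace_gabor[OF b]) auto
    have "\<kappa> * \<sigma> powr (2 * \<alpha> + 4) * (\<Sum>k\<in>S. norm (freq \<sigma> k) powr (- 2 * \<alpha> - 2) * (w k)\<^sup>2)
       \<le> \<kappa> * \<sigma> powr (2 * \<alpha> + 4) * (\<Sum>k\<in>S. norm (freq \<sigma> k) powr (- 2 * \<alpha> - 2) * (norm (gabor_laplace b v x (freq \<sigma> k)))\<^sup>2)"
      using w \<kappa>(1) by (intro mult_left_mono sum_mono power_mono) auto
    then have "ennreal (sqrt (\<kappa> * \<sigma> powr (2 * \<alpha> + 4) * (\<Sum>k\<in>S. norm (freq \<sigma> k) powr (- 2 * \<alpha> - 2) * (w k)\<^sup>2)))
       \<le> ennreal (sqrt (\<kappa> * \<sigma> powr (2 * \<alpha> + 4) * (\<Sum>k\<in>S. norm (freq \<sigma> k) powr (- 2 * \<alpha> - 2) * (norm (gabor_laplace b v x (freq \<sigma> k)))\<^sup>2)))"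
      by (intro ennreal_leI real_sqrt_le_mono)
    also have "\<dots> \<le> BR_square \<alpha> (gabor b v) (gabor b v) x"
    proof -
      have bc: "bounded_continuous_fun F (norm (1 / b) ^ CARD('n))"
        unfolding F_def by (rule bounded_continuous_gabor[OF b, where s=1]) simp
      show ?thesis using \<kappa>(2)[OF F_def bc \<sigma> S] unfolding W .
    qed
    finally show "ennreal (sqrt (\<kappa> * \<sigma> powr (2 * \<alpha> + 4) * (\<Sum>k\<in>S. norm (freq \<sigma> k) powr (- 2 * \<alpha> - 2) * (w k)\<^sup>2)))
       \<le> BR_square \<alpha> (gabor b v) (gabor b v) x" .
  qed
qed

section \<open>Lower bounds for the exponent\<close>

lemma bilinear_bounded_gabor:
  assumes "bilinear_bounded (BR_square \<alpha> :: (real ^ 'n \<Rightarrow> complex) \<Rightarrow> (real ^ 'n \<Rightarrow> complex) \<Rightarrow> real ^ 'n \<Rightarrow> ennreal) p1 p2 p"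
    and p1: "p1 \<ge> 1" and p2: "p2 \<ge> 1"
  obtains C where "C \<ge> 0"
    "\<And>b (v :: real ^ 'n). Re b > 0 \<Longrightarrow> Lp_norm p (BR_square \<alpha> (gabor b v) (gabor b v))
       \<le> ennreal (C * Re b powr (- (real CARD('n) / 2 * (enn2real (1 / p1) + enn2real (1 / p2)))))"
proof -
  obtain C where C: "C \<ge> 0" "\<And>f g :: real ^ 'n \<Rightarrow> complex. schwartz f \<Longrightarrow> schwartz g \<Longrightarrow>
     Lp_norm p (BR_square \<alpha> f g) \<le> ennreal C * Lp_norm p1 (\<lambda>x. ennreal (norm (f x))) * Lp_norm p2 (\<lambda>x. ennreal (norm (g x)))"
    using assms(1) unfolding bilinear_bounded_def by blast
  show ?thesis
  proof
    fix b and v :: "real ^ 'n" assume b: "Re b > 0"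
    have "Lp_norm p (BR_square \<alpha> (gabor b v) (gabor b v))
      \<le> ennreal C * Lp_norm p1 (\<lambda>x. ennreal (norm (gabor b v x))) * Lp_norm p2 (\<lambda>x. ennreal (norm (gabor b v x)))"
      by (rule C(2)[OF schwartz_gabor[OF b] schwartz_gabor[OF b]])
    also have "\<dots> \<le> ennreal C * ennreal (Re b powr (- (real CARD('n) / 2 * enn2real (1 / p1)))) * ennreal (Re b powr (- (real CARD('n) / 2 * enn2real (1 / p2))))"
      by (intro mult_mono Lp_norm_gabor_le b p1 p2) auto
    also have "\<dots> = ennreal (C * Re b powr (- (real CARD('n) / 2 * (enn2real (1 / p1) + enn2real (1 / p2)))))"
      using C(1) by (simp add: mult.assoc distrib_left powr_add[symmetric] flip: ennreal_mult)
    finally show "Lp_norm p (BR_square \<alpha> (gabor b v) (gabor b v))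
       \<le> ennreal (C * Re b powr (- (real CARD('n) / 2 * (enn2real (1 / p1) + enn2real (1 / p2)))))" .
  qed (rule C(1))
qed

lemma exponent_nonpos_if_bounded:
  fixes K \<delta> :: real
  assumes "\<And>N::nat. N \<ge> 1 \<Longrightarrow> real N powr \<delta> \<le> K"
  shows "\<delta> \<le> 0"
proof (rule ccontr)
  assume "\<not> \<delta> \<le> 0"
  then have \<delta>: "\<delta> > 0" by simp
  obtain M :: nat where M: "real M \<ge> (\<bar>K\<bar> + 1) powr (1 / \<delta>)" using real_arch_simple by blast
  let ?N = "max 1 M"
  have "\<bar>K\<bar> + 1 = ((\<bar>K\<bar> + 1) powr (1 / \<delta>)) powr \<delta>" using \<delta> by (simp add: powr_powr)
  also have "\<dots> \<le> real ?N powr \<delta>" using M \<delta> by (intro powr_mono2) auto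
  also have "\<dots> \<le> K" by (rule assms) simp
  finally show False by simp
qed

text \<open>
  Take \<open>1 / b = 1 - \<i> * N / pi\<close>.  Then \<open>1 / b + s / pi\<close> is independent of \<open>N\<close> for \<open>s = 1 + \<i> * N\<close>, the
  oscillations of \<open>f\<close> and of the exponential cancel, and the Laplace transform has size \<open>N ^ n\<close> near
  the origin.  On the other side \<open>Re b\<close> is comparable to \<open>1 / N\<^sup>2\<close>, so the norms of \<open>f\<close> are at most of size
  \<open>N powr (n / p1)\<close> and \<open>N powr (n / p2)\<close>.
\<close>

lemma chirps_imp_exponent_ge:
  fixes \<alpha> :: real and p p1 p2 :: ennreal
  assumes \<alpha>: "\<alpha> > -1" and p: "p > 0" and p1: "p1 \<ge> 1" and p2: "p2 \<ge> 1"
    and bdd: "bilinear_bounded (BR_square \<alpha> :: (real ^ 'n \<Rightarrow> complex) \<Rightarrow> (real ^ 'n \<Rightarrow> complex) \<Rightarrow> real ^ 'n \<Rightarrow> ennreal) p1 p2 p"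
  shows "\<alpha> \<ge> real CARD('n) - real CARD('n) * (enn2real (1 / p1) + enn2real (1 / p2)) - 1"
proof -
  define n where "n = CARD('n)"
  have n: "n \<ge> 1" unfolding n_def by (simp add: Suc_leI)
  define P where "P = enn2real (1 / p1) + enn2real (1 / p2)"
  have P: "P \<ge> 0" by (simp add: P_def)
  obtain \<kappa> where \<kappa>: "\<kappa> > 0"
    "\<And>b (v :: real ^ 'n) x \<sigma> S w. Re b > 0 \<Longrightarrow> \<sigma> > 0 \<Longrightarrow> finite S \<Longrightarrow>
      (\<And>k. k \<in> S \<Longrightarrow> 0 \<le> w k \<and> w k \<le> norm (gabor_laplace b v x (freq \<sigma> k))) \<Longrightarrow>
      ennreal (sqrt (\<kappa> * \<sigma> powr (2 * \<alpha> + 4) * (\<Sum>k\<in>S. norm (freq \<sigma> k) powr (- 2 * \<alpha> - 2) * (w k)\<^sup>2)))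
      \<le> BR_square \<alpha> (gabor b v) (gabor b v) x"
    using BR_square_gabor_lower_bound[OF \<alpha>, where 'n='n] by blast
  obtain C where C: "C \<ge> 0"
    "\<And>b (v :: real ^ 'n). Re b > 0 \<Longrightarrow> Lp_norm p (BR_square \<alpha> (gabor b v) (gabor b v))
       \<le> ennreal (C * Re b powr (- (real n / 2 * P)))"
    using bilinear_bounded_gabor[OF bdd p1 p2] unfolding n_def P_def by blast
  obtain c where c: "c > 0"
    "\<And>(u :: real ^ 'n \<Rightarrow> ennreal) m. m \<ge> 0 \<Longrightarrow> (\<And>x. norm x \<le> 1 / 4 \<Longrightarrow> ennreal m \<le> u x) \<Longrightarrow> ennreal (c * m) \<le> Lp_norm p u"
    using Lp_norm_ge_on_ball[OF p, of "1 / 4"] by (metis zero_less_divide_1_iff zero_less_numeral)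
  define c1 where "c1 = sqrt \<kappa> * 2 powr (- \<alpha> - 1) * (3 / 40 * exp (- 1) / 5 ^ n)"
  have c1: "c1 > 0" using \<kappa> by (simp add: c1_def)
  have main: "real N powr (n - \<alpha> - 1 - n * P) \<le> C * 2 powr (n / 2 * P) / (c * c1)" if N: "N \<ge> 1" for N :: nat
  proof -
    define a where "a = 1 - \<i> * (N / pi)"
    define b where "b = 1 / a"
    have a: "Re a = 1" "Im a = - (N / pi)" "(norm a)\<^sup>2 = 1 + (N / pi)\<^sup>2" by (simp_all add: a_def cmod_power2)
    have a0: "a \<noteq> 0" using a(1) by auto
    have rb: "Re b = 1 / (norm a)\<^sup>2" using a by (simp add: b_def Re_divide cmod_power2)
    have b: "Re b > 0" using rb a0 by simp
    define w where "w = (N / 5) ^ n * (exp (- 1) * (3 / 40))"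
    have w: "w \<ge> 0" by (simp add: w_def)
    have low: "w \<le> norm (gabor_laplace b 0 x (freq 1 N))" if x: "norm x \<le> 1 / 4" for x :: "real ^ 'n"
    proof -
      define B where "B = 1 + 1 / pi"
      have B: "B > 1" "B \<le> 5 / pi" "pi * B \<le> 5" using pi_less_4 by (auto simp: B_def field_simps)
      have Beq: "a + freq 1 N / pi = of_real B"
        by (simp add: a_def freq_def B_def add_divide_distrib)
      have x2: "(norm x)\<^sup>2 \<le> 1 / 16" using power_mono[OF x, of 2] by (simp add: power2_eq_square)
      have "gabor_laplace b 0 x (freq 1 N) = (a / of_real B) ^ n * of_real (exp (- 2 * pi * (norm x)\<^sup>2 / B)) * of_real (n / (pi * B) - 2 * (norm x)\<^sup>2 / B\<^sup>2)"
        unfolding gabor_laplace_def Let_def n_def[symmetric] b_def using a0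
        by (simp add: Beq flip: exp_of_real)
      then have eq: "norm (gabor_laplace b 0 x (freq 1 N)) = (norm a / B) ^ n * (exp (- 2 * pi * (norm x)\<^sup>2 / B) * \<bar>n / (pi * B) - 2 * (norm x)\<^sup>2 / B\<^sup>2\<bar>)"
        using B by (simp only: norm_mult norm_power norm_divide norm_of_real abs_exp_cancel mult.assoc)
      have 1: "N / 5 \<le> norm a / B"
      proof -
        have "real N * (pi * B) \<le> real N * 5" using B by (intro mult_left_mono) auto
        then have "N / 5 * B \<le> N / pi" using pi_gt_zero by (simp add: field_simps)
        also have "\<dots> \<le> norm a" using abs_Im_le_cmod[of a] a(2) by simp
        finally show ?thesis using B by (simp add: field_simps)
      qed
      have 2: "exp (- 1) \<le> exp (- 2 * pi * (norm x)\<^sup>2 / B)"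
      proof -
        have "2 * pi * (norm x)\<^sup>2 / B \<le> 2 * pi * (norm x)\<^sup>2 / 1"
          using B by (intro divide_left_mono) auto
        also have "\<dots> = 2 * (pi * (norm x)\<^sup>2)" by simp
        also have "\<dots> \<le> 2 * (4 * (1 / 16))" using x2 pi_less_4 by (intro mult_left_mono mult_mono) auto
        finally show ?thesis by simp
      qed
      have 3: "3 / 40 \<le> \<bar>n / (pi * B) - 2 * (norm x)\<^sup>2 / B\<^sup>2\<bar>"
      proof -
        have "1 / 5 \<le> 1 / (pi * B)" using B by (intro divide_left_mono) auto
        also have "\<dots> \<le> n / (pi * B)" using n B by (intro divide_right_mono) auto
        finally have "1 / 5 \<le> n / (pi * B)" .
        moreover have "2 * (norm x)\<^sup>2 / B\<^sup>2 \<le> 2 * (norm x)\<^sup>2 / 1"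
          using B one_le_power[of B 2] by (intro divide_left_mono) auto
        ultimately show ?thesis using x2 by linarith
      qed
      show ?thesis
        unfolding eq w_def using 1 2 3 B(1) by (intro mult_mono power_mono) auto
    qed
    let ?m = "c1 * real N powr (n - \<alpha> - 1)"
    have m: "?m \<ge> 0" using c1 by simp
    have "ennreal ?m \<le> BR_square \<alpha> (gabor b 0) (gabor b 0) x" if x: "norm x \<le> 1 / 4" for x :: "real ^ 'n"
    proof -
      have fr: "norm (freq 1 N) \<le> 2 * N"
        using norm_triangle_ineq[of 1 "\<i> * of_nat N"] N by (simp add: freq_def norm_mult)
      have "sqrt (\<kappa> * ((2 * N) powr (- \<alpha> - 1) * w)\<^sup>2) = sqrt \<kappa> * ((2 * N) powr (- \<alpha> - 1) * w)"
        using w by (simp add: real_sqrt_mult)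
      also have "\<dots> = c1 * (real N powr (- \<alpha> - 1) * real N powr n)"
        using N by (simp add: c1_def w_def powr_mult power_divide powr_realpow mult_ac)
      also have "real N powr (- \<alpha> - 1) * real N powr n = real N powr (n - \<alpha> - 1)"
        by (simp add: algebra_simps flip: powr_add)
      finally have "?m = sqrt (\<kappa> * ((2 * N) powr (- \<alpha> - 1) * w)\<^sup>2)" by simp
      also have "((2 * N) powr (- \<alpha> - 1) * w)\<^sup>2 = (2 * N) powr (- 2 * \<alpha> - 2) * w\<^sup>2"
        by (simp add: power_mult_distrib power2_eq_square flip: powr_add)
      also have "sqrt (\<kappa> * ((2 * N) powr (- 2 * \<alpha> - 2) * w\<^sup>2)) \<le> sqrt (\<kappa> * 1 powr (2 * \<alpha> + 4) * (\<Sum>k\<in>{N}. norm (freq 1 k) powr (- 2 * \<alpha> - 2) * w\<^sup>2))"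
      proof -
        have "norm (freq 1 N) > 0" using Re_freq[of 1 N] by (metis norm_zero zero_complex.sel(1) zero_less_norm_iff zero_neq_one)
        then have "(2 * N) powr (- 2 * \<alpha> - 2) \<le> norm (freq 1 N) powr (- 2 * \<alpha> - 2)"
          using fr \<alpha> by (intro powr_mono2') auto
        then show ?thesis using \<kappa>(1) by (simp add: mult_right_mono)
      qed
      finally have "ennreal ?m \<le> ennreal (sqrt (\<kappa> * 1 powr (2 * \<alpha> + 4) * (\<Sum>k\<in>{N}. norm (freq 1 k) powr (- 2 * \<alpha> - 2) * w\<^sup>2)))"
        by (rule ennreal_leI)
      also have "\<dots> \<le> BR_square \<alpha> (gabor b 0) (gabor b 0) x"
        by (rule \<kappa>(2)[where w="\<lambda>_. w"]) (use b w low[OF x] in auto)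
      finally show ?thesis .
    qed
    then have "ennreal (c * ?m) \<le> Lp_norm p (BR_square \<alpha> (gabor b (0 :: real ^ 'n)) (gabor b 0))"
      by (intro c(2) m) auto
    also have "\<dots> \<le> ennreal (C * Re b powr (- (real n / 2 * P)))" by (rule C(2)[OF b])
    finally have "c * ?m \<le> C * Re b powr (- (real n / 2 * P))"
      using C(1) by (subst (asm) ennreal_le_iff) auto
    also have "Re b powr (- (real n / 2 * P)) = ((norm a)\<^sup>2) powr (real n / 2 * P)"
      using a0 by (simp add: rb powr_divide powr_minus_divide)
    also have "\<dots> \<le> (2 * (real N)\<^sup>2) powr (real n / 2 * P)"
    proof (intro powr_mono2)
      have "(N / pi)\<^sup>2 \<le> (real N)\<^sup>2" using pi_ge_two by (intro power_mono) (auto simp: divide_le_eq mult_le_cancel_left1)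
      moreover have "1 \<le> (real N)\<^sup>2" using N by simp
      ultimately show "(norm a)\<^sup>2 \<le> 2 * (real N)\<^sup>2" unfolding a(3) by linarith
    qed (use P in auto)
    also have "(2 * (real N)\<^sup>2) powr (real n / 2 * P) = 2 powr (real n / 2 * P) * real N powr (n * P)"
    proof -
      have "(real N)\<^sup>2 = real N powr 2" using N by simp
      then have "((real N)\<^sup>2) powr (real n / 2 * P) = real N powr (n * P)" by (simp only: powr_powr) simp
      then show ?thesis by (simp add: powr_mult)
    qed
    finally have "c * (c1 * real N powr (n - \<alpha> - 1)) \<le> C * (2 powr (real n / 2 * P) * real N powr (n * P))"
      using C(1) by (simp add: mult_left_mono)
    moreover have "real N powr (n - \<alpha> - 1) = real N powr (n - \<alpha> - 1 - n * P) * real N powr (n * P)"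
      by (simp flip: powr_add)
    ultimately have "(c * c1 * real N powr (n - \<alpha> - 1 - n * P)) * real N powr (n * P) \<le> (C * 2 powr (real n / 2 * P)) * real N powr (n * P)"
      by (simp only: mult.assoc)
    moreover have "real N powr (n * P) > 0" using N by simp
    ultimately have "c * c1 * real N powr (n - \<alpha> - 1 - n * P) \<le> C * 2 powr (real n / 2 * P)"
      using mult_right_le_imp_le by blast
    then show ?thesis using c(1) c1 by (simp add: field_simps)
  qed
  have "real n - \<alpha> - 1 - n * P \<le> 0"
    using exponent_nonpos_if_bounded[OF main] .
  then show ?thesis unfolding n_def P_def by simp
qed

text \<open>
  For \<open>f\<close> modulated to a frequency of length \<open>N\<close> the relevant \<open>u = R\<^sup>2\<close> are of size \<open>N\<^sup>2\<close>, hence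
  \<open>\<sigma> = 1 / N\<^sup>2\<close>.  As \<open>(norm z)\<^sup>2\<close> varies by about \<open>N\<close> on the essential support of \<open>F\<close>, the Laplace
  transform keeps its maximal size \<open>N\<^sup>2\<close> while \<open>\<sigma> * k \<le> 1 / N\<close>, which are the \<open>N\<close> values \<open>k = 1, \<dots>, N\<close>.
  For \<open>\<alpha> \<le> - 1 / 2\<close> each of them contributes at least a multiple of \<open>1 / k\<close>, whereas the norms of \<open>f\<close> do
  not depend on \<open>N\<close>.
\<close>

lemma wave_packets_imp_exponent_gt_minus_half:
  fixes \<alpha> :: real and p p1 p2 :: ennreal
  assumes \<alpha>: "\<alpha> > -1" and p: "p > 0" and p1: "p1 \<ge> 1" and p2: "p2 \<ge> 1"
    and bdd: "bilinear_bounded (BR_square \<alpha> :: (real ^ 'n \<Rightarrow> complex) \<Rightarrow> (real ^ 'n \<Rightarrow> complex) \<Rightarrow> real ^ 'n \<Rightarrow> ennreal) p1 p2 p"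
  shows "\<alpha> > - (1 / 2)"
proof (rule ccontr)
  assume "\<not> \<alpha> > - (1 / 2)"
  then have \<alpha>2: "\<alpha> \<le> - (1 / 2)" by simp
  define n where "n = CARD('n)"
  obtain \<kappa> where \<kappa>: "\<kappa> > 0"
    "\<And>b (v :: real ^ 'n) x \<sigma> S w. Re b > 0 \<Longrightarrow> \<sigma> > 0 \<Longrightarrow> finite S \<Longrightarrow>
      (\<And>k. k \<in> S \<Longrightarrow> 0 \<le> w k \<and> w k \<le> norm (gabor_laplace b v x (freq \<sigma> k))) \<Longrightarrow>
      ennreal (sqrt (\<kappa> * \<sigma> powr (2 * \<alpha> + 4) * (\<Sum>k\<in>S. norm (freq \<sigma> k) powr (- 2 * \<alpha> - 2) * (w k)\<^sup>2)))
      \<le> BR_square \<alpha> (gabor b v) (gabor b v) x"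
    using BR_square_gabor_lower_bound[OF \<alpha>, where 'n='n] by blast
  obtain C where C: "C \<ge> 0"
    "\<And>b (v :: real ^ 'n). Re b > 0 \<Longrightarrow> Lp_norm p (BR_square \<alpha> (gabor b v) (gabor b v))
       \<le> ennreal (C * Re b powr (- (real CARD('n) / 2 * (enn2real (1 / p1) + enn2real (1 / p2)))))"
    using bilinear_bounded_gabor[OF bdd p1 p2] by blast
  obtain c where c: "c > 0"
    "\<And>(u :: real ^ 'n \<Rightarrow> ennreal) m. m \<ge> 0 \<Longrightarrow> (\<And>x. norm x \<le> 1 \<Longrightarrow> ennreal m \<le> u x) \<Longrightarrow> ennreal (c * m) \<le> Lp_norm p u"
    using Lp_norm_ge_on_ball[OF p, of 1] by (metis zero_less_one)
  define c2 where "c2 = (1 / 3) ^ n * exp (- 14 * pi) / 9"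
  have c2: "c2 > 0" by (simp add: c2_def)
  have main: "c * sqrt (\<kappa> * c2\<^sup>2 / 2 * harm N) \<le> C" if N: "N \<ge> 1" "real (2 + 9 * n) \<le> (real N)\<^sup>2" for N :: nat
  proof -
    obtain j :: 'n where True by blast
    define v :: "real ^ 'n" where "v = real N *\<^sub>R axis j 1"
    have v: "norm v = N" "v \<bullet> x = N * (x $ j)" for x by (simp_all add: v_def inner_axis inner_commute[of "axis j 1"] norm_axis_1)
    define \<sigma> where "\<sigma> = 1 / (real N)\<^sup>2"
    have \<sigma>: "\<sigma> > 0" "\<sigma> * (real N)\<^sup>2 = 1" "\<sigma> \<le> 1" using N by (simp_all add: \<sigma>_def)
    have low: "c2 * (real N)\<^sup>2 \<le> norm (gabor_laplace 1 v x (freq \<sigma> k))" if x: "norm x \<le> 1" and k: "k \<in> {1..N}" for x k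
    proof -
      define s where "s = freq \<sigma> k"
      define B where "B = 1 + s / pi"
      define Q where "Q = complex_of_real ((real N)\<^sup>2 - (norm x)\<^sup>2) + 2 * \<i> * (N * (x $ j))"
      have xj: "\<bar>x $ j\<bar> \<le> 1" using component_le_norm_cart[of x j] x by simp
      have x2: "(norm x)\<^sup>2 \<le> 1" using power_mono[OF x, of 2] by simp
      have kN: "real k \<le> N" "real k \<ge> 0" using k by auto
      have \<sigma>k: "\<sigma> * k * N \<le> 1"
      proof -
        have "\<sigma> * k * N \<le> \<sigma> * N * N" using \<sigma> kN by (intro mult_right_mono mult_left_mono) auto
        also have "\<dots> = 1" using \<sigma> by (simp add: power2_eq_square mult.assoc)
        finally show ?thesis .
      qed
      have \<sigma>k1: "\<sigma> * k \<le> 1"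
      proof -
        have "\<sigma> * k * 1 \<le> \<sigma> * k * N" using N \<sigma> by (intro mult_left_mono) auto
        then show ?thesis using \<sigma>k by simp
      qed
      have B: "Re B = 1 + \<sigma> / pi" "Im B = \<sigma> * k / pi" by (simp_all add: B_def s_def)
      have le: "t / pi \<le> t" if "t \<ge> 0" for t :: real
        using that pi_ge_two by (simp add: divide_le_eq mult_le_cancel_left1)
      have B': "1 \<le> Re B" "Re B \<le> 2" "0 \<le> Im B" "Im B * N \<le> 1" "Im B \<le> 1"
      proof -
        show "1 \<le> Re B" "0 \<le> Im B" unfolding B using \<sigma> by simp_all
        show "Re B \<le> 2" unfolding B using le[of \<sigma>] \<sigma> by linarith
        show "Im B \<le> 1" unfolding B by (rule order_trans[OF le \<sigma>k1]) (use \<sigma> in simp)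
        have "Im B * N = \<sigma> * k * N / pi" unfolding B by simp
        also have "\<dots> \<le> 1" by (rule order_trans[OF le \<sigma>k]) (use \<sigma> in simp)
        finally show "Im B * N \<le> 1" .
      qed
      have nB: "1 \<le> norm B" "norm B \<le> 3"
        using B' complex_Re_le_cmod[of B] cmod_le[of B] by simp_all
      have B0: "B \<noteq> 0" using nB by auto
      have g: "gabor_laplace 1 v x s = (1 / B) ^ n * exp (2 * pi * Q / B - 2 * pi * (real N)\<^sup>2) * (n / (pi * B) + 2 * Q / B\<^sup>2)"
        unfolding gabor_laplace_def Let_def v n_def[symmetric] by (simp add: B_def Q_def)
      have 1: "(1 / 3) ^ n \<le> norm ((1 / B) ^ n)"
      proof -
        have "1 / 3 \<le> 1 / norm B" using nB B0 by (intro divide_left_mono) auto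
        then show ?thesis unfolding norm_power norm_divide norm_one by (intro power_mono) auto
      qed
      have 2: "exp (- 14 * pi) \<le> norm (exp (2 * pi * Q / B - 2 * pi * (real N)\<^sup>2))"
      proof -
        \<comment> \<open>The exponent is \<open>2 * pi * P / B\<close>; in \<open>P\<close> the terms of size \<open>N\<^sup>2\<close> have cancelled.\<close>
        define P where "P = Q - (real N)\<^sup>2 * B"
        have P: "Re P = - (norm x)\<^sup>2 - 1 / pi" "Im P = 2 * N * (x $ j) - k / pi"
        proof -
          have "(real N)\<^sup>2 * (\<sigma> * t) = t" for t using \<sigma>(2) by (simp add: mult_ac flip: mult.assoc)
          from this[of "1 / pi"] this[of "k / pi"]
          show "Re P = - (norm x)\<^sup>2 - 1 / pi" "Im P = 2 * N * (x $ j) - k / pi"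
            by (simp_all add: P_def Q_def B algebra_simps)
        qed
        have "\<bar>Re P\<bar> \<le> 2"
        proof -
          have "1 / pi \<le> 1" "0 \<le> 1 / pi" "0 \<le> (norm x)\<^sup>2" using pi_ge_two by auto
          then show ?thesis using x2 unfolding P by linarith
        qed
        have "\<bar>Im P\<bar> \<le> 3 * N"
        proof -
          have "\<bar>2 * N * (x $ j)\<bar> \<le> 2 * N" using xj by (simp add: abs_mult mult_left_le)
          moreover have "0 \<le> k / pi" by simp
          moreover have "k / pi \<le> N" by (rule order_trans[OF le kN(1)]) simp
          ultimately show ?thesis unfolding P by linarith
        qed
        have "\<bar>Re P * Re B + Im P * Im B\<bar> \<le> \<bar>Re P\<bar> * Re B + \<bar>Im P\<bar> * Im B"
          using B' by (intro order_trans[OF abs_triangle_ineq]) (simp add: abs_mult)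
        also have "\<dots> \<le> 2 * 2 + (3 * N) * Im B"
          using B' \<open>\<bar>Re P\<bar> \<le> 2\<close> \<open>\<bar>Im P\<bar> \<le> 3 * N\<close> by (intro add_mono mult_mono) auto
        also have "\<dots> \<le> 7" using B' by (simp add: mult_ac)
        also have "Re P * Re B + Im P * Im B = Re (P / B) * (norm B)\<^sup>2"
          using B'(1) by (simp add: Re_divide cmod_power2 add_pos_nonneg)
        finally have "\<bar>Re (P / B)\<bar> * (norm B)\<^sup>2 \<le> 7" by (simp add: abs_mult)
        moreover have "\<bar>Re (P / B)\<bar> * 1 \<le> \<bar>Re (P / B)\<bar> * (norm B)\<^sup>2"
          using nB by (intro mult_left_mono) auto
        ultimately have "Re (P / B) \<ge> - 7" by linarith
        then have "2 * pi * - 7 \<le> 2 * pi * Re (P / B)" by (intro mult_left_mono) auto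
        moreover have e: "2 * pi * Q / B - 2 * pi * (real N)\<^sup>2 = of_real (2 * pi) * (P / B)"
          using B0 by (simp add: P_def field_simps)
        have "norm (exp (2 * pi * Q / B - 2 * pi * (real N)\<^sup>2)) = exp (2 * pi * Re (P / B))"
          unfolding e norm_exp_eq_Re by (simp only: times_complex.sel Re_complex_of_real Im_complex_of_real) simp
        ultimately show ?thesis by simp
      qed
      have 3: "(real N)\<^sup>2 / 9 \<le> norm (n / (pi * B) + 2 * Q / B\<^sup>2)"
      proof -
        have "Re Q = (real N)\<^sup>2 - (norm x)\<^sup>2" by (simp add: Q_def)
        then have "(real N)\<^sup>2 - 1 \<le> norm Q" using complex_Re_le_cmod[of Q] x2 by linarith
        then have "2 * ((real N)\<^sup>2 - 1) / 9 \<le> 2 * norm Q / (norm B)\<^sup>2"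
        proof (intro frac_le)
          show "(norm B)\<^sup>2 \<le> 9" using power_mono[OF nB(2), of 2] by simp
          show "0 < (norm B)\<^sup>2" using B0 by simp
        qed auto
        moreover have "n / (pi * norm B) \<le> n"
        proof -
          have "1 * 1 \<le> pi * norm B" using nB pi_ge_two by (intro mult_mono) auto
          then show ?thesis by (simp add: divide_le_eq mult_le_cancel_left1)
        qed
        moreover have "norm (2 * Q / B\<^sup>2) - norm (complex_of_real (real n) / (complex_of_real pi * B)) \<le> norm (complex_of_real (real n) / (complex_of_real pi * B) + 2 * Q / B\<^sup>2)"
          using norm_diff_ineq[of "2 * Q / B\<^sup>2" "complex_of_real (real n) / (complex_of_real pi * B)"] by (simp only: add.commute)
        moreover have "norm (complex_of_real (real n) / (complex_of_real pi * B)) = n / (pi * norm B)" "norm (2 * Q / B\<^sup>2) = 2 * norm Q / (norm B)\<^sup>2"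
          by (simp_all add: norm_divide norm_mult norm_power)
        moreover have "(real N)\<^sup>2 / 9 \<le> 2 * ((real N)\<^sup>2 - 1) / 9 - real n"
        proof -
          have "X / 9 \<le> 2 * (X - 1) / 9 - m" if "2 + 9 * m \<le> X" for X m :: real
            using that by (simp add: field_simps)
          moreover have "2 + 9 * real n \<le> (real N)\<^sup>2" using N(2) by simp
          ultimately show ?thesis by blast
        qed
        ultimately have "(real N)\<^sup>2 / 9 \<le> norm (complex_of_real (real n) / (complex_of_real pi * B) + 2 * Q / B\<^sup>2)"
          by linarith
        then show ?thesis by simp
      qed
      have "c2 * (real N)\<^sup>2 = (1 / 3) ^ n * exp (- 14 * pi) * ((real N)\<^sup>2 / 9)" by (simp add: c2_def)
      also have "\<dots> \<le> norm (gabor_laplace 1 v x s)"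
        unfolding g norm_mult using 1 2 3 by (intro mult_mono) auto
      finally show ?thesis unfolding s_def .
    qed
    let ?m = "sqrt (\<kappa> * c2\<^sup>2 / 2 * harm N)"
    have "ennreal ?m \<le> BR_square \<alpha> (gabor 1 v) (gabor 1 v) x" if x: "norm x \<le> 1" for x
    proof -
      have "\<kappa> * c2\<^sup>2 / 2 * harm N = \<kappa> * (\<Sum>k\<in>{1..N}. \<sigma>\<^sup>2 * (1 / (2 * k)) * (c2 * (real N)\<^sup>2)\<^sup>2)"
      proof -
        have eq: "\<sigma>\<^sup>2 * (1 / (2 * real k)) * (c2 * (real N)\<^sup>2)\<^sup>2 = c2\<^sup>2 / 2 * inverse (real k)" for k
        proof -
          have "\<sigma>\<^sup>2 * (1 / (2 * real k)) * (c2 * (real N)\<^sup>2)\<^sup>2 = (\<sigma> * (real N)\<^sup>2)\<^sup>2 * (c2\<^sup>2 / 2 * inverse (real k))"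
          proof -
            have "s\<^sup>2 * (1 / (2 * r)) * (d * X)\<^sup>2 = (s * X)\<^sup>2 * (d\<^sup>2 / 2 * inverse r)" for s r d X :: real
              by (simp add: power2_eq_square inverse_eq_divide)
            then show ?thesis .
          qed
          also have "\<dots> = c2\<^sup>2 / 2 * inverse (real k)" unfolding \<sigma>(2) by simp
          finally show ?thesis .
        qed
        have "(\<Sum>k\<in>{1..N}. \<sigma>\<^sup>2 * (1 / (2 * k)) * (c2 * (real N)\<^sup>2)\<^sup>2) = (\<Sum>k\<in>{1..N}. c2\<^sup>2 / 2 * inverse (real k))"
          by (intro sum.cong refl) (simp only: of_nat_mult of_nat_numeral eq)
        also have "\<dots> = c2\<^sup>2 / 2 * harm N" by (simp only: harm_def sum_distrib_left)
        finally show ?thesis by simp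
      qed
      also have "\<dots> \<le> \<kappa> * (\<Sum>k\<in>{1..N}. \<sigma> powr (2 * \<alpha> + 4) * norm (freq \<sigma> k) powr (- 2 * \<alpha> - 2) * (c2 * (real N)\<^sup>2)\<^sup>2)"
      proof (intro mult_left_mono sum_mono mult_right_mono)
        fix k assume k: "k \<in> {1..N}"
        define t where "t = norm (1 + \<i> * of_nat k)"
        have t: "1 \<le> t" "t \<le> 2 * k"
          using complex_Re_le_cmod[of "1 + \<i> * of_nat k"] norm_triangle_ineq[of 1 "\<i> * of_nat k"] k
          by (auto simp: t_def norm_mult)
        have "\<sigma>\<^sup>2 * (1 / (2 * k)) \<le> \<sigma>\<^sup>2 * t powr (- 2 * \<alpha> - 2)"
        proof (rule mult_left_mono)
          have "1 / (2 * k) \<le> 1 / t" using t k by (intro divide_left_mono) auto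
          also have "\<dots> = t powr (- 1)" using t by (simp add: powr_minus_divide)
          also have "\<dots> \<le> t powr (- 2 * \<alpha> - 2)" using t \<alpha>2 by (intro powr_mono) auto
          finally show "1 / (2 * k) \<le> t powr (- 2 * \<alpha> - 2)" .
        qed auto
        also have "\<sigma>\<^sup>2 * t powr (- 2 * \<alpha> - 2) = \<sigma> powr (2 * \<alpha> + 4) * norm (freq \<sigma> k) powr (- 2 * \<alpha> - 2)"
        proof -
          have "\<sigma>\<^sup>2 = \<sigma> powr (2 * \<alpha> + 4) * \<sigma> powr (- 2 * \<alpha> - 2)"
            using \<sigma> by (simp flip: powr_add)
          moreover have "norm (freq \<sigma> k) = \<sigma> * t" using \<sigma> by (simp add: freq_def norm_mult t_def)
          ultimately show ?thesis by (simp only: powr_mult mult.assoc)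
        qed
        finally show "\<sigma>\<^sup>2 * (1 / (2 * k)) \<le> \<sigma> powr (2 * \<alpha> + 4) * norm (freq \<sigma> k) powr (- 2 * \<alpha> - 2)" .
      qed (use \<kappa> in auto)
      also have "\<dots> = \<kappa> * \<sigma> powr (2 * \<alpha> + 4) * (\<Sum>k\<in>{1..N}. norm (freq \<sigma> k) powr (- 2 * \<alpha> - 2) * (c2 * (real N)\<^sup>2)\<^sup>2)"
        by (simp add: sum_distrib_left mult.assoc)
      finally have "ennreal ?m \<le> ennreal (sqrt (\<kappa> * \<sigma> powr (2 * \<alpha> + 4) * (\<Sum>k\<in>{1..N}. norm (freq \<sigma> k) powr (- 2 * \<alpha> - 2) * (c2 * (real N)\<^sup>2)\<^sup>2)))"
        by (intro ennreal_leI real_sqrt_le_mono)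
      also have "\<dots> \<le> BR_square \<alpha> (gabor 1 v) (gabor 1 v) x"
        by (rule \<kappa>(2)[where w="\<lambda>_. c2 * (real N)\<^sup>2"]) (use \<sigma> c2 low[OF x] in auto)
      finally show ?thesis .
    qed
    then have "ennreal (c * ?m) \<le> Lp_norm p (BR_square \<alpha> (gabor 1 v) (gabor 1 v))"
      using \<kappa>(1) by (intro c(2)) (auto intro!: mult_nonneg_nonneg harm_nonneg)
    also have "\<dots> \<le> ennreal C" using C(2)[of 1 v] by simp
    finally show ?thesis using C(1) by (subst (asm) ennreal_le_iff) auto
  qed
  have "filterlim (\<lambda>N. c * sqrt (\<kappa> * c2\<^sup>2 / 2 * harm N)) at_top sequentially"
    using c(1) \<kappa>(1) c2
    by (intro filterlim_tendsto_pos_mult_at_top[OF tendsto_const] filterlim_compose[OF sqrt_at_top] harm_at_top) auto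
  then have "eventually (\<lambda>N. c * sqrt (\<kappa> * c2\<^sup>2 / 2 * harm N) > C) sequentially"
    by (simp add: filterlim_at_top_dense)
  moreover have "eventually (\<lambda>N. N \<ge> max 1 (2 + 9 * n)) sequentially" by (rule eventually_ge_at_top)
  ultimately have "eventually (\<lambda>N. False) sequentially"
  proof eventually_elim
    case (elim N)
    have "real (2 + 9 * n) \<le> real N * 1" using elim(2) by simp
    also have "\<dots> \<le> (real N)\<^sup>2" unfolding power2_eq_square using elim(2) by (intro mult_left_mono) auto
    finally show ?case using main[of N] elim by simp
  qed
  then show False by simp
qed

text \<open>
  The integrand is homogeneous of degree \<open>- DIM('v)\<close>, so the integrals over \<open>norm x \<ge> \<rho>\<close> and over
  \<open>norm x \<ge> \<rho> / 2\<close> agree.  If they were finite, the annulus between the two spheres would be a null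
  set.
\<close>

lemma nn_integral_norm_power_at_infinity:
  fixes \<rho> :: real
  assumes \<rho>: "\<rho> > 0"
  shows "(\<integral>\<^sup>+x. ennreal (indicator {x. \<rho> \<le> norm x} x * norm x powr (- real DIM('v))) \<partial>(lborel :: 'v::euclidean_space measure)) = \<infinity>"
proof (rule ccontr)
  define f where "f r x = indicator {x. r \<le> norm x} x * norm x powr (- real DIM('v))" for r :: real and x :: 'v
  have [measurable]: "f r \<in> borel_measurable borel" for r unfolding f_def by measurable
  assume "\<not> ?thesis"
  then have fin: "(\<integral>\<^sup>+x. ennreal (f \<rho> x) \<partial>lborel) < \<infinity>" by (simp add: f_def less_top)
  have I: "integrable lborel (f \<rho>)"
    by (rule integrableI_nonneg) (use fin in \<open>auto simp: f_def\<close>)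
  have sc: "f r (2 *\<^sub>R x) = f (r / 2) x / 2 ^ DIM('v)" for r x
  proof -
    have "norm (2 *\<^sub>R x) powr (- real DIM('v)) = 2 powr (- real DIM('v)) * norm x powr (- real DIM('v))"
      by (simp add: powr_mult)
    also have "2 powr (- real DIM('v)) = 1 / 2 ^ DIM('v)" by (simp add: powr_minus_divide powr_realpow)
    finally have "norm (2 *\<^sub>R x) powr (- real DIM('v)) = norm x powr (- real DIM('v)) / 2 ^ DIM('v)" by simp
    moreover have "indicator {x. r \<le> norm x} (2 *\<^sub>R x) = (indicator {x. r / 2 \<le> norm x} x :: real)"
      by (auto simp: indicator_def)
    ultimately show ?thesis by (simp only: f_def times_divide_eq_right)
  qed
  have I2: "integrable lborel (f (\<rho> / 2))"
  proof -
    have "integrable lborel (\<lambda>x. f (\<rho> / 2) x / 2 ^ DIM('v))"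
      using integrable_lborel_scaleR[of 2 "f \<rho>"] I unfolding sc by simp
    from integrable_mult_right[OF this, of "2 ^ DIM('v)"] show ?thesis by simp
  qed
  have "(LINT x|lborel. f \<rho> x) = (LINT x|lborel. f (\<rho> / 2) x)"
    using integral_lborel_scaleR[of 2 "f \<rho>"] unfolding sc by simp
  then have 0: "(LINT x|lborel. f (\<rho> / 2) x - f \<rho> x) = 0" using I I2 by simp
  have nonneg: "0 \<le> f (\<rho> / 2) x - f \<rho> x" for x
    using norm_ge_zero[of x] \<rho> by (auto simp: f_def indicator_def simp del: norm_ge_zero)
  have "AE x in lborel. f (\<rho> / 2) x - f \<rho> x = 0"
    using 0 I I2 nonneg by (subst (asm) integral_nonneg_eq_0_iff_AE) auto
  obtain e :: 'v where e: "e \<in> Basis" using nonempty_Basis by blast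
  let ?c = "(3 * \<rho> / 4) *\<^sub>R e"
  have in_ball: "f (\<rho> / 2) x - f \<rho> x > 0" if "x \<in> ball ?c (\<rho> / 8)" for x
  proof -
    have c: "norm ?c = 3 * \<rho> / 4" using e \<rho> by simp
    have "norm (?c - x) < \<rho> / 8" using that by (simp add: dist_norm)
    then have "\<rho> / 2 \<le> norm x" "norm x < \<rho>"
      using norm_triangle_ineq2[of ?c x] norm_triangle_ineq2[of x ?c] c \<rho> by (simp_all add: norm_minus_commute)
    then show ?thesis using \<rho> by (auto simp: f_def)
  qed
  have "AE x in lborel. x \<notin> ball ?c (\<rho> / 8)"
    by (rule eventually_mono[OF \<open>AE x in lborel. f (\<rho> / 2) x - f \<rho> x = 0\<close>]) (use in_ball in force)
  then have "emeasure lborel (ball ?c (\<rho> / 8)) = 0"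
    by (subst (asm) AE_iff_measurable[where N="ball ?c (\<rho> / 8)"]) auto
  then have "measure lborel (ball ?c (\<rho> / 8)) = 0" by (simp add: measure_def)
  then show False using content_ball_pos[of "\<rho> / 8" ?c] \<rho> by simp
qed

text \<open>
  The Laplace transform at \<open>1 + \<i> * k\<close> contains the factor \<open>exp (- 2 * pi * \<bar>x\<bar>\<^sup>2 * Re (1 / B))\<close>, where
  \<open>Re (1 / B)\<close> is comparable to \<open>1 / k\<^sup>2\<close>.  It is therefore of size \<open>\<bar>x\<bar> powr (- n)\<close> for the roughly \<open>\<bar>x\<bar>\<close>
  values of \<open>k\<close> between \<open>\<bar>x\<bar>\<close> and \<open>2 * \<bar>x\<bar>\<close>.
\<close>

lemma gaussian_pointwise_lower_bound:
  fixes \<alpha> :: real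
  assumes \<alpha>: "\<alpha> > -1"
  obtains c \<rho> where "c > 0" "\<rho> > 1"
    "\<And>x :: real ^ 'n. \<rho> \<le> norm x \<Longrightarrow>
      ennreal (c * norm x powr (- (\<alpha> + real CARD('n) + 1 / 2))) \<le> BR_square \<alpha> (gabor 1 0) (gabor 1 0) x"
proof -
  define n where "n = CARD('n)"
  obtain \<kappa> where \<kappa>: "\<kappa> > 0"
    "\<And>b (v :: real ^ 'n) x \<sigma> S w. Re b > 0 \<Longrightarrow> \<sigma> > 0 \<Longrightarrow> finite S \<Longrightarrow>
      (\<And>k. k \<in> S \<Longrightarrow> 0 \<le> w k \<and> w k \<le> norm (gabor_laplace b v x (freq \<sigma> k))) \<Longrightarrow>
      ennreal (sqrt (\<kappa> * \<sigma> powr (2 * \<alpha> + 4) * (\<Sum>k\<in>S. norm (freq \<sigma> k) powr (- 2 * \<alpha> - 2) * (w k)\<^sup>2)))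
      \<le> BR_square \<alpha> (gabor b v) (gabor b v) x"
    using BR_square_gabor_lower_bound[OF \<alpha>, where 'n='n] by blast
  define e where "e = \<alpha> + n + 1 / 2"
  have "real n \<ge> 1" by (simp add: n_def Suc_leI)
  then have e: "e \<ge> 0" using \<alpha> by (simp add: e_def)
  define c where "c = sqrt \<kappa> * 3 powr (- \<alpha> - 1) * exp (- 256 * pi)"
  have c: "c > 0" using \<kappa>(1) by (simp add: c_def)
  define \<rho> where "\<rho> = real (6 + 2 * n)"
  have \<rho>: "\<rho> > 1" by (simp add: \<rho>_def)
  have "ennreal (c * norm x powr (- e)) \<le> BR_square \<alpha> (gabor 1 0) (gabor 1 0) x" if x: "\<rho> \<le> norm x" for x :: "real ^ 'n"
  proof -
    define K where "K = nat \<lfloor>norm x\<rfloor>"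
    have K: "real K \<le> norm x" "norm x < real K + 1" by (auto simp: K_def)
    have K6: "6 + 2 * n \<le> K" using x unfolding \<rho>_def K_def by linarith
    define w where "w = (1 / real K) ^ n * exp (- 256 * pi)"
    have w: "w \<ge> 0" by (simp add: w_def)
    have low: "w \<le> norm (gabor_laplace 1 0 x (freq 1 k))" if k: "k \<in> {K..2 * K}" for k
    proof -
      define B where "B = 1 + freq 1 k / pi"
      have B: "Re B = 1 + 1 / pi" "Im B = k / pi" by (simp_all add: B_def)
      have le: "1 / pi \<le> 1" using pi_ge_two by simp
      have Bn: "real K / 4 \<le> norm B" "norm B \<le> K"
      proof -
        have "real K / 4 \<le> k / pi" using k pi_less_4 by (intro frac_le) auto
        then show "real K / 4 \<le> norm B" using abs_Im_le_cmod[of B] unfolding B by linarith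
        have "k / pi \<le> real (2 * K) / 3" using k pi_gt3 by (intro frac_le) auto
        moreover have "norm B \<le> 1 + 1 / pi + k / pi" using cmod_le[of B] unfolding B by simp
        moreover have "6 \<le> real K" "real (2 * K) = 2 * real K" using K6 by simp_all
        ultimately show "norm B \<le> K" using le by linarith
      qed
      have B0: "norm B > 0" "B \<noteq> 0" using Bn K6 by auto
      have g: "gabor_laplace 1 0 x (freq 1 k) = (1 / B) ^ n * exp (of_real (2 * pi * (norm x)\<^sup>2) * (- (1 / B))) * (n / (pi * B) - of_real (2 * (norm x)\<^sup>2) / B\<^sup>2)"
        unfolding gabor_laplace_def Let_def n_def[symmetric] by (simp add: B_def)
      have 1: "(1 / real K) ^ n \<le> norm ((1 / B) ^ n)"
      proof -
        have "1 / real K \<le> 1 / norm B" using Bn B0 K6 by (intro divide_left_mono) auto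
        then show ?thesis unfolding norm_power norm_divide norm_one by (intro power_mono) auto
      qed
      have 2: "exp (- 256 * pi) \<le> norm (exp (of_real (2 * pi * (norm x)\<^sup>2) * (- (1 / B))))"
      proof -
        have "Re (1 / B) = Re B / (norm B)\<^sup>2" by (simp add: Re_divide cmod_power2)
        also have "\<dots> \<le> 2 / (real K / 4)\<^sup>2"
          using Bn le B0 K6 by (intro frac_le power_mono) (auto simp: B)
        also have "\<dots> = 32 / (real K)\<^sup>2" by (simp add: power_divide)
        finally have "(norm x)\<^sup>2 * Re (1 / B) \<le> (norm x)\<^sup>2 * (32 / (real K)\<^sup>2)" by (intro mult_left_mono) auto
        also have "\<dots> \<le> (2 * real K)\<^sup>2 * (32 / (real K)\<^sup>2)"
          using K K6 by (intro mult_right_mono power_mono) auto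
        also have "\<dots> = 128" using K6 by (simp add: power_mult_distrib)
        finally have "2 * pi * ((norm x)\<^sup>2 * Re (1 / B)) \<le> 2 * pi * 128" by (intro mult_left_mono) auto
        moreover have "norm (exp (of_real (2 * pi * (norm x)\<^sup>2) * (- (1 / B)))) = exp (- (2 * pi * ((norm x)\<^sup>2 * Re (1 / B))))"
          unfolding norm_exp_eq_Re by (simp only: times_complex.sel Re_complex_of_real Im_complex_of_real uminus_complex.sel) simp
        ultimately show ?thesis by simp
      qed
      have 3: "1 \<le> norm (n / (pi * B) - of_real (2 * (norm x)\<^sup>2) / B\<^sup>2)"
      proof -
        have "2 \<le> 2 * (norm x)\<^sup>2 / (norm B)\<^sup>2"
        proof -
          have "(norm B)\<^sup>2 \<le> (norm x)\<^sup>2" using Bn K B0 by (intro power_mono) auto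
          then show ?thesis using B0 by (simp add: le_divide_eq)
        qed
        moreover have "n / (pi * norm B) \<le> 1"
        proof -
          have "real n \<le> 2 * (real K / 4)" using K6 by simp
          also have "\<dots> \<le> pi * norm B" using Bn pi_ge_two K6 by (intro mult_mono) auto
          finally show ?thesis using B0 pi_gt_zero by (simp add: divide_le_eq)
        qed
        moreover have "norm (of_real (2 * (norm x)\<^sup>2) / B\<^sup>2) - norm (n / (pi * B)) \<le> norm (n / (pi * B) - of_real (2 * (norm x)\<^sup>2) / B\<^sup>2)"
          by (metis norm_minus_commute norm_triangle_ineq2)
        moreover have "norm (complex_of_real n / (pi * B)) = n / (pi * norm B)" "norm (of_real (2 * (norm x)\<^sup>2) / B\<^sup>2) = 2 * (norm x)\<^sup>2 / (norm B)\<^sup>2"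
          by (simp_all add: norm_divide norm_mult norm_power)
        ultimately show ?thesis by simp
      qed
      have "w = (1 / real K) ^ n * exp (- 256 * pi) * 1" by (simp add: w_def)
      also have "\<dots> \<le> norm (gabor_laplace 1 0 x (freq 1 k))"
        unfolding g norm_mult using 1 2 3 by (intro mult_mono) auto
      finally show ?thesis .
    qed
    have "c * norm x powr (- e) \<le> c * real K powr (- e)"
      using c e K K6 by (intro mult_left_mono powr_mono2') auto
    also have "\<dots> = sqrt (\<kappa> * (real K powr (1 / 2) * ((3 * real K) powr (- \<alpha> - 1) * w))\<^sup>2)"
    proof -
      have "real K powr (- e) = real K powr (1 / 2) * (real K powr (- \<alpha> - 1) * real K powr (- n))"
        by (simp add: e_def flip: powr_add)
      also have "real K powr (- n) = (1 / real K) ^ n"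
        using K6 by (simp add: powr_minus_divide powr_realpow power_one_over)
      finally show ?thesis
        by (simp add: real_sqrt_mult w c_def powr_mult) (simp add: w_def)
    qed
    also have "(real K powr (1 / 2) * ((3 * real K) powr (- \<alpha> - 1) * w))\<^sup>2 = real K * ((3 * real K) powr (- 2 * \<alpha> - 2) * w\<^sup>2)"
    proof -
      have "(real K powr (1 / 2))\<^sup>2 = real K" by (simp add: powr_half_sqrt)
      moreover have "((3 * real K) powr (- \<alpha> - 1))\<^sup>2 = (3 * real K) powr (- 2 * \<alpha> - 2)"
        by (simp add: power2_eq_square flip: powr_add)
      ultimately show ?thesis by (simp only: power_mult_distrib)
    qed
    also have "sqrt (\<kappa> * (real K * ((3 * real K) powr (- 2 * \<alpha> - 2) * w\<^sup>2)))
      \<le> sqrt (\<kappa> * 1 powr (2 * \<alpha> + 4) * (\<Sum>k\<in>{K..2 * K}. norm (freq 1 k) powr (- 2 * \<alpha> - 2) * w\<^sup>2))"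
    proof (rule real_sqrt_le_mono)
      have "real K * ((3 * real K) powr (- 2 * \<alpha> - 2) * w\<^sup>2) \<le> real (card {K..2 * K}) * ((3 * real K) powr (- 2 * \<alpha> - 2) * w\<^sup>2)"
        by (intro mult_right_mono) auto
      also have "\<dots> = (\<Sum>k\<in>{K..2 * K}. (3 * real K) powr (- 2 * \<alpha> - 2) * w\<^sup>2)" by simp
      also have "\<dots> \<le> (\<Sum>k\<in>{K..2 * K}. norm (freq 1 k) powr (- 2 * \<alpha> - 2) * w\<^sup>2)"
      proof (intro sum_mono mult_right_mono powr_mono2')
        fix k assume k: "k \<in> {K..2 * K}"
        have "norm (freq 1 k) \<ge> 1" using complex_Re_le_cmod[of "freq 1 k"] by simp
        then show "norm (freq 1 k) > 0" by linarith
        show "norm (freq 1 k) \<le> 3 * real K"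
          using norm_triangle_ineq[of 1 "\<i> * of_nat k"] k K6 by (simp add: freq_def norm_mult)
      qed (use \<alpha> in auto)
      finally show "\<kappa> * (real K * ((3 * real K) powr (- 2 * \<alpha> - 2) * w\<^sup>2))
         \<le> \<kappa> * 1 powr (2 * \<alpha> + 4) * (\<Sum>k\<in>{K..2 * K}. norm (freq 1 k) powr (- 2 * \<alpha> - 2) * w\<^sup>2)"
        using \<kappa>(1) by simp
    qed
    finally have "ennreal (c * norm x powr (- e)) \<le> ennreal (sqrt (\<kappa> * 1 powr (2 * \<alpha> + 4) * (\<Sum>k\<in>{K..2 * K}. norm (freq 1 k) powr (- 2 * \<alpha> - 2) * w\<^sup>2)))"
      by (rule ennreal_leI)
    also have "\<dots> \<le> BR_square \<alpha> (gabor 1 0) (gabor 1 0) x"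
      by (rule \<kappa>(2)[where w="\<lambda>_. w"]) (use w low in auto)
    finally show ?thesis .
  qed
  then show ?thesis using that c \<rho> unfolding e_def n_def by blast
qed

lemma kernel_decay_imp_exponent_gt:
  fixes \<alpha> :: real and p1 p2 :: ennreal and q :: real
  assumes \<alpha>: "\<alpha> > -1" and q: "q > 0" and p1: "p1 \<ge> 1" and p2: "p2 \<ge> 1"
    and bdd: "bilinear_bounded (BR_square \<alpha> :: (real ^ 'n \<Rightarrow> complex) \<Rightarrow> (real ^ 'n \<Rightarrow> complex) \<Rightarrow> real ^ 'n \<Rightarrow> ennreal) p1 p2 (ennreal q)"
  shows "\<alpha> > real CARD('n) * (1 / q - 1) - 1 / 2"
proof (rule ccontr)
  define n where "n = CARD('n)"
  assume "\<not> ?thesis"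
  then have "\<alpha> + n + 1 / 2 \<le> n / q" by (simp add: n_def algebra_simps)
  then have qe: "q * (\<alpha> + n + 1 / 2) \<le> n" using q by (simp add: field_simps)
  obtain c \<rho> where c: "c > 0" "\<rho> > 1"
    "\<And>x :: real ^ 'n. \<rho> \<le> norm x \<Longrightarrow>
      ennreal (c * norm x powr (- (\<alpha> + real n + 1 / 2))) \<le> BR_square \<alpha> (gabor 1 0) (gabor 1 0) x"
    using gaussian_pointwise_lower_bound[OF \<alpha>, where 'n='n] unfolding n_def by blast
  obtain C where C: "C \<ge> 0"
    "\<And>b (v :: real ^ 'n). Re b > 0 \<Longrightarrow> Lp_norm (ennreal q) (BR_square \<alpha> (gabor b v) (gabor b v))
       \<le> ennreal (C * Re b powr (- (real CARD('n) / 2 * (enn2real (1 / p1) + enn2real (1 / p2)))))"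
    using bilinear_bounded_gabor[OF bdd p1 p2] by blast
  let ?G = "BR_square \<alpha> (gabor 1 (0 :: real ^ 'n)) (gabor 1 0)"
  have "(\<integral>\<^sup>+x. ennreal (c powr q) * ennreal (indicator {x. \<rho> \<le> norm x} x * norm x powr (- real DIM(real ^ 'n))) \<partial>(lborel :: (real ^ 'n) measure))
      \<le> (\<integral>\<^sup>+x. epowr (?G x) q \<partial>lborel)"
  proof (rule nn_integral_mono)
    fix x :: "real ^ 'n"
    show "ennreal (c powr q) * ennreal (indicator {x. \<rho> \<le> norm x} x * norm x powr (- real DIM(real ^ 'n))) \<le> epowr (?G x) q"
    proof (cases "\<rho> \<le> norm x")
      case True
      have "c powr q * norm x powr (- n) \<le> c powr q * norm x powr (- (q * (\<alpha> + n + 1 / 2)))"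
        using True c qe by (intro mult_left_mono powr_mono) auto
      also have "\<dots> = (c * norm x powr (- (\<alpha> + n + 1 / 2))) powr q"
        by (simp only: powr_mult powr_powr mult_minus_left mult.commute[of q])
      finally have "ennreal (c powr q * norm x powr (- n)) \<le> epowr (ennreal (c * norm x powr (- (\<alpha> + n + 1 / 2)))) q"
        using c by (subst epowr_ennreal) (auto intro: ennreal_leI)
      also have "\<dots> \<le> epowr (?G x) q" using q c(3)[OF True] by (intro epowr_mono) auto
      finally show ?thesis using True by (simp add: n_def ennreal_mult)
    qed simp
  qed
  moreover have "(\<integral>\<^sup>+x. ennreal (c powr q) * ennreal (indicator {x. \<rho> \<le> norm x} x * norm x powr (- real DIM(real ^ 'n))) \<partial>(lborel :: (real ^ 'n) measure)) = \<infinity>"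
    using c nn_integral_norm_power_at_infinity[of \<rho>, where 'v="real ^ 'n"]
    by (subst nn_integral_cmult) (auto simp: ennreal_mult_top)
  ultimately have "(\<integral>\<^sup>+x. epowr (?G x) q \<partial>lborel) = \<infinity>" by (simp add: top_unique)
  then have "Lp_norm (ennreal q) ?G = \<infinity>" using q by (simp add: Lp_norm_def epowr_def)
  moreover have "Lp_norm (ennreal q) ?G \<le> ennreal C" using C(2)[of 1 0] by simp
  ultimately show False by (simp add: top_unique)
qed

theorem proposition2p5:
  fixes \<alpha> :: real and p1 p2 p :: ennreal and n :: nat
  assumes "n = CARD('n)"
    and "\<alpha> > -1" and "p1 \<ge> 1" and "p2 \<ge> 1" and "p > 0"
    and "bilinear_bounded
           (BR_square \<alpha> :: (real ^ 'n \<Rightarrow> complex) \<Rightarrow> (real ^ 'n \<Rightarrow> complex) \<Rightarrow> real ^ 'n \<Rightarrow> ennreal)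
           p1 p2 p"
  shows "\<alpha> > max (real n * (enn2real (1 / p) - 1) - 1 / 2) (- (1 / 2)) \<and>
         (n \<ge> 2 \<and> p \<ge> 1 \<longrightarrow>
           \<alpha> > Max {real n / 2 - real n * enn2real (1 / p1) - real n / 2 * enn2real (1 / p2) - 1,
                    real n / 2 - real n / 2 * enn2real (1 / p1) - real n * enn2real (1 / p2) - 1,
                    - (1 / 2)})"
proof -
  have n: "real n \<ge> 1" using assms(1) by (simp add: Suc_leI)
  define a b where "a = enn2real (1 / p1)" and "b = enn2real (1 / p2)"
  have half: "\<alpha> > - (1 / 2)"
    using wave_packets_imp_exponent_gt_minus_half[OF assms(2) assms(5) assms(3) assms(4) assms(6)] .
  have chirp: "\<alpha> \<ge> real n - real n * (a + b) - 1"
    using chirps_imp_exponent_ge[OF assms(2) assms(5) assms(3) assms(4) assms(6)] assms(1) by (simp add: a_def b_def)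
  have decay: "\<alpha> > real n * (enn2real (1 / p) - 1) - 1 / 2"
  proof (cases p)
    case (real q)
    then have q: "q > 0" using assms(5) by auto
    have "enn2real (1 / p) = 1 / q" using q real by (simp add: divide_ennreal flip: ennreal_1)
    then show ?thesis
      using kernel_decay_imp_exponent_gt[OF assms(2) q assms(3) assms(4)] assms(1,6) real by simp
  next
    case top
    then show ?thesis using half n by simp
  qed
  have le1: "enn2real (1 / r) \<le> 1" "enn2real (1 / r) \<ge> 0" if "r \<ge> 1" for r :: ennreal
  proof -
    have "1 / r \<le> 1"
      using that by (cases r) (auto simp: divide_ennreal simp flip: ennreal_1)
    then show "enn2real (1 / r) \<le> 1" by (metis enn2real_1 enn2real_mono ennreal_one_less_top)
  qed simp
  have a: "0 \<le> a" "a \<le> 1" and b: "0 \<le> b" "b \<le> 1"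
    unfolding a_def b_def using le1 assms(3,4) by auto
  \<comment> \<open>Here \<open>s\<close> and \<open>t\<close> are the reciprocals of the two exponents, in either order.\<close>
  have improve: "\<alpha> > real n / 2 - real n * s - real n / 2 * t - 1"
    if st: "0 \<le> s" "0 \<le> t" "t \<le> 1" and low: "\<alpha> \<ge> real n - real n * (s + t) - 1" for s t
  proof (cases "t = 1")
    case True
    have "0 \<le> real n * s" using st n by simp
    then show ?thesis using True half by simp
  next
    case False
    then have "0 < real n / 2 * (1 - t)" using st n by simp
    then show ?thesis using low by (simp add: algebra_simps)
  qed
  have "\<alpha> > real n / 2 - real n * a - real n / 2 * b - 1"
    using improve[of a b] a b chirp by simp
  moreover have "\<alpha> > real n / 2 - real n / 2 * a - real n * b - 1"
    using improve[of b a] a b chirp by (simp add: add.commute algebra_simps)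
  ultimately show ?thesis using decay half unfolding a_def b_def by simp
qed

end
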